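(* Let $\alpha\ge 1$ be fixed and let $t>0$. Suppose that there exists $\delta>0$ such that $$\int_0^t\int_{x<-1}e^{-(\alpha+\delta)x}K_s(dx)\,ds<\infty .$$ Then $m^{(\alpha)}_t$ is well-defined (finite) and the following recurrent integral equation holds: $$m^{(\alpha)}_t=\alpha\int_0^t m^{(\alpha-1)}_{u,t}\,e^{-\Phi(u,\alpha)}\,du .$$ If, in addition, $X$ is a Lévy process (with parameters $(b_0,c_0,K_0)$ and Laplace exponent $\Phi(\alpha)$), then for all $t>0$ $$m^{(\alpha)}_t=\alpha e^{-\Phi(\alpha)t}\int_0^t m^{(\alpha-1)}_s\,e^{\Phi(\alpha)s}\,ds,$$ and moreover $$\frac{d}{dt}\big[m^{(\alpha)}_t\big]=-m^{(\alpha)}_t\,\Phi(\alpha)+\alpha\, m^{(\alpha-1)}_t .$$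
   Context: $X=(X_t)_{t\ge 0}$ is a real-valued càdlàg process with independent increments, $X_0=0$, which is a semimartingale with respect to its natural filtration, with deterministic characteristics absolutely continuous in time: there are measurable functions $b=(b_s)_{s\ge 0}$, $c=(c_s)_{s\ge 0}$ ($c\ge 0$), locally integrable, and a kernel $K=(K_s)_{s\ge 0}$ on $\mathbb{R}\setminus\{0\}$ such that for each $t>0$ $$\int_0^t\int_{\mathbb{R}\setminus\{0\}}(x^2\wedge|x|)K_s(dx)\,ds<\infty,$$ $B_t=\int_0^tb_s\,ds$, $C_t=\int_0^tc_s\,ds$, $\nu(dt,dx)=dt\,K_t(dx)$. Because of the integrability condition no truncation of jumps is used, i.e. for $\lambda\in\mathbb{R}$ $${\bf E}e^{i\lambda X_t}=\exp\Big\{i\lambda B_t-\tfrac12\lambda^2C_t+\int_0^t\int_{\mathbb{R}\setminus\{0\}}(e^{i\lambda x}-1-i\lambda x)K_s(dx)\,ds\Big\}.$$ The Laplace exponent is defined by ${\bf E}(e^{-\alpha X_t})=e^{-\Phi(t,\alpha)}$, i.e. $$\Phi(t,\alpha)=\alpha B_t-\tfrac12\alpha^2C_t-\int_0^t\int_{\mathbb{R}\setminus\{0\}}(e^{-\alpha x}-1+\alpha x)K_s(dx)\,ds.$$ When $X$ is a Lévy process with parameters $(b_0,c_0,K_0)$ (so $b_s=b_0$, $c_s=c_0$, $K_s=K_0$), $\Phi(t,\alpha)=t\,\Phi(\alpha)$ with $\Phi(\alpha)=\alpha b_0-\frac12\alpha^2c_0-\int_{\mathbb{R}\setminus\{0\}}(e^{-\alpha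 x}-1+\alpha x)K_0(dx)$. Notation: $I_t=\int_0^te^{-X_s}ds$, $m^{(\alpha)}_t={\bf E}(I_t^{\alpha})$, and for $0\le s\le t$, $m^{(\alpha)}_{s,t}={\bf E}\big[\big(\int_s^te^{-(X_u-X_{s-})}du\big)^{\alpha}\big]$ (with $X_{0-}=X_0=0$). *)

theory Defs
  imports "HOL-Probability.Probability"
begin

text \<open>
  Processes are maps \<open>X :: real \<Rightarrow> 'a \<Rightarrow> real\<close> (time first); only the times \<open>t \<ge> 0\<close> matter.
\<close>

definition cadlag :: "(real \<Rightarrow> real) \<Rightarrow> bool" where
  "cadlag f \<longleftrightarrow>
     (\<forall>t\<ge>0. (f \<longlongrightarrow> f t) (at_right t)) \<and> (\<forall>t>0. \<exists>l. (f \<longlongrightarrow> l) (at_left t))"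

definition left_limit :: "(real \<Rightarrow> real) \<Rightarrow> real \<Rightarrow> real" where
  "left_limit f t = (if t \<le> 0 then f 0 else Lim (at_left t) f)"

definition finite_variation :: "(real \<Rightarrow> real) \<Rightarrow> bool" where
  "finite_variation f \<longleftrightarrow>
     (\<forall>t>0. \<exists>V. \<forall>n (p :: nat \<Rightarrow> real). mono_on {..n} p \<longrightarrow> p ` {..n} \<subseteq> {0..t} \<longrightarrow>
        (\<Sum>i<n. \<bar>f (p (Suc i)) - f (p i)\<bar>) \<le> V)"

definition natural_filtration ::
    "'a measure \<Rightarrow> (real \<Rightarrow> 'a \<Rightarrow> real) \<Rightarrow> real \<Rightarrow> 'a measure" where
  "natural_filtration M X t =
     sigma (space M) (\<Union>s\<in>{0..t}. {X s -` A \<inter> space M | A. A \<in> sets borel})"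

definition adapted :: "(real \<Rightarrow> 'a measure) \<Rightarrow> (real \<Rightarrow> 'a \<Rightarrow> real) \<Rightarrow> bool" where
  "adapted F Y \<longleftrightarrow> (\<forall>t\<ge>0. Y t \<in> borel_measurable (F t))"

definition martingale ::
    "'a measure \<Rightarrow> (real \<Rightarrow> 'a measure) \<Rightarrow> (real \<Rightarrow> 'a \<Rightarrow> real) \<Rightarrow> bool" where
  "martingale M F Y \<longleftrightarrow>
     adapted F Y \<and> (\<forall>t\<ge>0. integrable M (Y t)) \<and>
     (\<forall>s\<ge>0. \<forall>t\<ge>s. AE \<omega> in M. real_cond_exp M (F s) (Y t) \<omega> = Y s \<omega>)"

text \<open>
  Real-valued localizing times are no restriction: replacing \<open>T n\<close> by \<open>min (T n) n\<close> preserves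
  all the requirements, so stopping times with value infinity are not needed.
\<close>

definition local_martingale ::
    "'a measure \<Rightarrow> (real \<Rightarrow> 'a measure) \<Rightarrow> (real \<Rightarrow> 'a \<Rightarrow> real) \<Rightarrow> bool" where
  "local_martingale M F Y \<longleftrightarrow>
     adapted F Y \<and> (\<forall>\<omega>\<in>space M. cadlag (\<lambda>t. Y t \<omega>)) \<and>
     (\<exists>T :: nat \<Rightarrow> 'a \<Rightarrow> real.
        (\<forall>n. stopping_time F (T n)) \<and> (\<forall>n. \<forall>\<omega>\<in>space M. 0 \<le> T n \<omega>) \<and>
        (AE \<omega> in M. incseq (\<lambda>n. T n \<omega>) \<and> filterlim (\<lambda>n. T n \<omega>) at_top sequentially) \<and>
        (\<forall>n. martingale M F (\<lambda>t \<omega>. Y (min t (T n \<omega>)) \<omega>)))"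

definition semimartingale ::
    "'a measure \<Rightarrow> (real \<Rightarrow> 'a measure) \<Rightarrow> (real \<Rightarrow> 'a \<Rightarrow> real) \<Rightarrow> bool" where
  "semimartingale M F X \<longleftrightarrow>
     X 0 \<in> borel_measurable (F 0) \<and>
     (\<exists>N A. local_martingale M F N \<and> (\<forall>\<omega>\<in>space M. N 0 \<omega> = 0) \<and>
        adapted F A \<and> (\<forall>\<omega>\<in>space M. A 0 \<omega> = 0) \<and>
        (\<forall>\<omega>\<in>space M. cadlag (\<lambda>t. A t \<omega>) \<and> finite_variation (\<lambda>t. A t \<omega>)) \<and>
        (\<forall>t\<ge>0. \<forall>\<omega>\<in>space M. X t \<omega> = X 0 \<omega> + N t \<omega> + A t \<omega>))"

text \<open>
  The characteristics \<open>(B, C, \<nu>)\<close> of \<open>X\<close> relative to the truncation function \<open>h(x) = x\<close> are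
  \<open>B t = \<integral>\<^sub>0\<^sup>t b s ds\<close>, \<open>C t = \<integral>\<^sub>0\<^sup>t c s ds\<close> and \<open>\<nu>(ds, dx) = K s (dx) ds\<close>. As \<open>X\<close> has
  independent increments and the characteristics are deterministic, they are identified by the
  characteristic functions of the \<open>X t\<close>. The measures \<open>K s\<close> live on the real line without
  \<open>0\<close>.
\<close>

locale pii_semimartingale = prob_space M for M :: "'a measure" +
  fixes X :: "real \<Rightarrow> 'a \<Rightarrow> real"
    and b c :: "real \<Rightarrow> real"
    and K :: "real \<Rightarrow> real measure"
  assumes random_variable_X: "t \<ge> 0 \<Longrightarrow> random_variable borel (X t)"
    and X_zero: "\<omega> \<in> space M \<Longrightarrow> X 0 \<omega> = 0"
    and cadlag_X: "\<omega> \<in> space M \<Longrightarrow> cadlag (\<lambda>t. X t \<omega>)"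
    and independent_increments:
      "0 \<le> s \<Longrightarrow> s \<le> t \<Longrightarrow>
       indep_set (sets (vimage_algebra (space M) (\<lambda>\<omega>. X t \<omega> - X s \<omega>) borel))
                 (sets (natural_filtration M X s))"
    and semimartingale_X: "semimartingale M (natural_filtration M X) X"
    and b_locally_integrable: "t > 0 \<Longrightarrow> set_integrable lborel {0..t} b"
    and c_locally_integrable: "t > 0 \<Longrightarrow> set_integrable lborel {0..t} c"
    and c_nonneg: "s \<ge> 0 \<Longrightarrow> c s \<ge> 0"
    and sets_K: "s \<ge> 0 \<Longrightarrow> sets (K s) = sets (restrict_space borel (- {0}))"
    and kernel_K: "A \<in> sets (restrict_space borel (- {0})) \<Longrightarrow>
       (\<lambda>s. emeasure (K s) A) \<in> borel_measurable (restrict_space borel {0..})"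
    and K_integrable: "t > 0 \<Longrightarrow>
       (\<integral>\<^sup>+ s\<in>{0..t}. (\<integral>\<^sup>+ x. ennreal (min (x\<^sup>2) \<bar>x\<bar>) \<partial>K s) \<partial>lborel) < \<infinity>"
    and char_X: "t \<ge> 0 \<Longrightarrow>
       char (distr M borel (X t)) l =
         exp (\<i> * complex_of_real (l * (LINT s:{0..t}|lborel. b s))
              - complex_of_real (l\<^sup>2 / 2 * (LINT s:{0..t}|lborel. c s))
              + (LINT s:{0..t}|lborel. (LINT x|K s. iexp (l * x) - 1 - \<i> * complex_of_real (l * x))))"

definition laplace_exponent ::
    "(real \<Rightarrow> real) \<Rightarrow> (real \<Rightarrow> real) \<Rightarrow> (real \<Rightarrow> real measure) \<Rightarrow> real \<Rightarrow> real \<Rightarrow> real" where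
  "laplace_exponent b c K t \<alpha> =
     \<alpha> * (LINT s:{0..t}|lborel. b s) - \<alpha>\<^sup>2 / 2 * (LINT s:{0..t}|lborel. c s)
     - (LINT s:{0..t}|lborel. (LINT x|K s. exp (- \<alpha> * x) - 1 + \<alpha> * x))"

definition levy_laplace_exponent :: "real \<Rightarrow> real \<Rightarrow> real measure \<Rightarrow> real \<Rightarrow> real" where
  "levy_laplace_exponent b0 c0 K0 \<alpha> =
     \<alpha> * b0 - \<alpha>\<^sup>2 / 2 * c0 - (LINT x|K0. exp (- \<alpha> * x) - 1 + \<alpha> * x)"

text \<open>
  Only meant for an \<open>X\<close> that is already a process with independent increments and local
  characteristics \<open>(b, c, K)\<close>.
\<close>

definition levy_with_parameters ::
    "'a measure \<Rightarrow> (real \<Rightarrow> 'a \<Rightarrow> real) \<Rightarrow> (real \<Rightarrow> real) \<Rightarrow> (real \<Rightarrow> real) \<Rightarrow> (real \<Rightarrow> real measure)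
     \<Rightarrow> real \<Rightarrow> real \<Rightarrow> real measure \<Rightarrow> bool" where
  "levy_with_parameters M X b c K b0 c0 K0 \<longleftrightarrow>
     (\<forall>s\<ge>0. \<forall>h\<ge>0. distr M borel (\<lambda>\<omega>. X (s + h) \<omega> - X s \<omega>) = distr M borel (X h)) \<and>
     (\<forall>s\<ge>0. b s = b0 \<and> c s = c0 \<and> K s = K0)"

definition exp_functional :: "(real \<Rightarrow> 'a \<Rightarrow> real) \<Rightarrow> real \<Rightarrow> 'a \<Rightarrow> real" where
  "exp_functional X t \<omega> = (LINT s:{0..t}|lborel. exp (- X s \<omega>))"

definition exp_functional_from :: "(real \<Rightarrow> 'a \<Rightarrow> real) \<Rightarrow> real \<Rightarrow> real \<Rightarrow> 'a \<Rightarrow> real" where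
  "exp_functional_from X s t \<omega> =
     (LINT u:{s..t}|lborel. exp (- (X u \<omega> - left_limit (\<lambda>r. X r \<omega>) s)))"

text \<open>
  The functionals are positive for \<open>s < t\<close>, so exponent \<open>0\<close> gives moment \<open>1\<close> there; the
  convention \<open>0 powr 0 = 0\<close> only concerns the degenerate interval \<open>s = t\<close>. Both moments are
  Bochner integrals and need integrability to be meaningful.
\<close>

definition moment :: "'a measure \<Rightarrow> (real \<Rightarrow> 'a \<Rightarrow> real) \<Rightarrow> real \<Rightarrow> real \<Rightarrow> real" where
  "moment M X \<alpha> t = (LINT \<omega>|M. exp_functional X t \<omega> powr \<alpha>)"

definition moment_from :: "'a measure \<Rightarrow> (real \<Rightarrow> 'a \<Rightarrow> real) \<Rightarrow> real \<Rightarrow> real \<Rightarrow> real \<Rightarrow> real" where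
  "moment_from M X \<alpha> s t = (LINT \<omega>|M. exp_functional_from X s t \<omega> powr \<alpha>)"

end

theory Submission
  imports Defs "HOL-Real_Asymp.Real_Asymp"
begin

text \<open>
  Pathwise, with \<open>T u = \<integral>\<^sub>u\<^sup>t exp (- X s) ds\<close>, one has
  \<open>T 0 powr \<alpha> = \<alpha> \<integral>\<^sub>0\<^sup>t T u powr (\<alpha> - 1) * exp (- X u) du\<close>. The integrand equals \<open>exp (- \<alpha> X u)\<close>
  times the power \<open>\<alpha> - 1\<close> of a functional of the increments after \<open>u\<close>; by independence the
  expectation factors, and \<open>X\<close> almost surely does not jump at \<open>u\<close>.
  The value \<open>E (exp (- \<alpha> X u))\<close> is not part of the hypotheses. It is obtained by
  approximating the law of \<open>X u\<close> by sums of independent rare jumps, whose characteristic functions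
  converge, and whose exponential moments of order \<open>\<alpha> + \<delta>\<close> stay bounded, which gives the
  uniform integrability needed to pass to the limit in the moment of order \<open>\<alpha>\<close>.
\<close>

section \<open>Sums of measures and convolution powers\<close>

text \<open>Substituting an imaginary argument into the characteristic function says nothing before
  exponential integrability of \<open>X u\<close> is known, and the hypotheses bound only the jump
  measure. The margin \<delta> closes this gap: a bound on the moments of order \<alpha> + \<delta>
  makes the part of the moment of order \<alpha> coming from x < -k at most of size exp (- \<delta>
  k), uniformly along the approximation. Finiteness of the moment is a separate matter: Jensen's
  inequality in time bounds the power of the integral by an integral of powers, and independence
  turns E (exp (- \<alpha> (X s - X u))) into a quotient of two Laplace transforms, bounded on
  compact time intervals. Two further obstacles shape the proof. Independence is given for one
  increment at a time, so it is carried to integrals of the path through Riemann sums. And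
  \<open>0 powr 0 = 0\<close> makes the weight in the pathwise identity discontinuous at u = t when
  \<alpha> = 1, a case treated apart; for the same reason the derivative is taken on an interval
  away from time 0.\<close>

definition add_measure :: "'a measure \<Rightarrow> 'a measure \<Rightarrow> 'a measure" where
  "add_measure M N = measure_of (space M) (sets M) (\<lambda>A. emeasure M A + emeasure N A)"

lemma sets_add_measure [simp, measurable_cong]: "sets (add_measure M N) = sets M"
  by (simp add: add_measure_def)

lemma space_add_measure [simp]: "space (add_measure M N) = space M"
  by (simp add: add_measure_def)

lemma emeasure_add_measure:
  assumes "sets N = sets M" "A \<in> sets M"
  shows "emeasure (add_measure M N) A = emeasure M A + emeasure N A"
proof (rule emeasure_measure_of[OF add_measure_def])
  show "countably_additive (sets (add_measure M N)) (\<lambda>A. emeasure M A + emeasure N A)"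
    using assms(1)
    by (auto intro!: countably_additiveI simp: suminf_add[symmetric] suminf_emeasure)
qed (use assms sets.space_closed[of M] in \<open>auto simp: positive_def\<close>)

lemma nn_integral_add_measure:
  assumes N [measurable_cong]: "sets N = sets M" and f: "f \<in> borel_measurable M"
  shows "nn_integral (add_measure M N) f = nn_integral M f + nn_integral N f"
  using f
proof (induction rule: borel_measurable_induct)
  case (cong f g)
  then show ?case
    using sets_eq_imp_space_eq[OF N] by (simp cong: nn_integral_cong_simp)
next
  case (set A)
  then show ?case using N by (simp add: emeasure_add_measure)
next
  case (mult u c)
  then show ?case by (simp add: nn_integral_cmult distrib_left)
next
  case (add u v)
  then show ?case by (simp add: nn_integral_add ac_simps)
next
  case (seq U)
  have *: "nn_integral L (SUP i. U i) = (SUP i. nn_integral L (U i))" if "sets L = sets M" for L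
    unfolding SUP_apply image_comp using seq that
    by (subst nn_integral_monotone_convergence_SUP[symmetric]) (auto simp: SUP_apply image_comp cong: measurable_cong_sets)
  have mono: "incseq (\<lambda>i. nn_integral L (U i))" for L
    using seq by (auto simp: incseq_def le_fun_def intro!: nn_integral_mono)
  show ?case
    unfolding \<open>f = _\<close>
    by (simp add: * N seq ennreal_SUP_add[OF mono mono] del: Sup_apply SUP_apply)
qed

text \<open>Values in a Banach space, because the complex characteristic functions and the real
  exponential moments are both computed from it.\<close>

lemma has_bochner_integral_add_measure:
  fixes f :: "'a \<Rightarrow> 'b::{banach, second_countable_topology}"
  assumes N [measurable_cong]: "sets N = sets M"
    and M: "integrable M f" and Nf: "integrable N f"
  shows "has_bochner_integral (add_measure M N) f (integral\<^sup>L M f + integral\<^sup>L N f)"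
proof -
  have sp: "space N = space M" by (rule sets_eq_imp_space_eq[OF N])
  have iff: "integrable (add_measure M N) g \<longleftrightarrow> integrable M g \<and> integrable N g" for g :: "'a \<Rightarrow> 'b"
    unfolding integrable_iff_bounded measurable_cong_sets[OF sets_add_measure refl]
      measurable_cong_sets[OF N refl]
    by (auto simp: nn_integral_add_measure[OF N])
  have "integrable (add_measure M N) f" using M Nf by (simp add: iff)
  then have "integral\<^sup>L (add_measure M N) f = integral\<^sup>L M f + integral\<^sup>L N f"
  proof induction
    case (base A c)
    then have "emeasure M A < \<infinity>" "emeasure N A < \<infinity>" and A: "A \<in> sets M" "A \<in> sets N"
      using N by (auto simp: emeasure_add_measure)
    moreover have "measure (add_measure M N) A = measure M A + measure N A"
      using calculation N by (simp add: measure_def emeasure_add_measure enn2real_plus)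
    ultimately show ?case using base by (simp add: scaleR_left_distrib)
  next
    case (add f g)
    then show ?case by (simp add: iff)
  next
    case (lim f s)
    \<comment> \<open>The measure \<open>L\<close> is left open so that one dominated convergence
      argument serves both summands and their sum; the bound \<open>2 * norm (f x)\<close> comes
      with the simple approximations.\<close>
    have "(\<lambda>i. integral\<^sup>L L (s i)) \<longlonglongrightarrow> integral\<^sup>L L f"
      if "integrable L f" "space L = space M" "\<And>i. integrable L (s i)" for L
      by (rule integral_dominated_convergence[where w="\<lambda>x. 2 * norm (f x)"])
         (use that lim in auto)
    from this[of M] this[of N] this[of "add_measure M N"] lim sp show ?case
      by (auto simp: iff intro!: LIMSEQ_unique tendsto_add)
  qed
  with M Nf show ?thesis by (simp add: has_bochner_integral_iff iff)
qed

primrec conv_power :: "real measure \<Rightarrow> nat \<Rightarrow> real measure" where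
  "conv_power P 0 = return borel 0"
| "conv_power P (Suc m) = convolution P (conv_power P m)"

lemma real_distribution_return: "real_distribution (return borel x)"
  by (auto simp: real_distribution_def real_distribution_axioms_def intro: prob_space_return)

lemma real_distribution_convolution:
  assumes "real_distribution P" "real_distribution Q"
  shows "real_distribution (convolution P Q)"
proof -
  interpret P: real_distribution P by fact
  interpret Q: real_distribution Q by fact
  interpret PQ: pair_prob_space P Q ..
  show ?thesis unfolding convolution_def
    by (auto simp: real_distribution_def real_distribution_axioms_def intro!: PQ.P.prob_space_distr)
qed

lemma char_return: "char (return borel x) l = iexp (l * x)"
  by (simp add: char_def integral_return)

lemma char_convolution:
  assumes "real_distribution P" "real_distribution Q"
  shows "char (convolution P Q) l = char P l * char Q l"
proof -
  interpret P: real_distribution P by fact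
  interpret Q: real_distribution Q by fact
  interpret PQ: pair_prob_space P Q ..
  have "integrable (P \<Otimes>\<^sub>M Q) (\<lambda>(x, y). iexp (l * (x + y)))"
    by (rule PQ.P.integrable_const_bound[where B=1]) auto
  from PQ.integral_fst'[OF this]
  have "char (convolution P Q) l = (CLINT x|P. CLINT y|Q. iexp (l * x) * iexp (l * y))"
    unfolding char_def convolution_def
    by (subst integral_distr) (auto simp: case_prod_beta' exp_add distrib_left)
  then show ?thesis by (simp add: char_def)
qed

lemma real_distribution_conv_power:
  "real_distribution P \<Longrightarrow> real_distribution (conv_power P m)"
  by (induction m) (auto intro: real_distribution_return real_distribution_convolution)

lemma char_conv_power: "real_distribution P \<Longrightarrow> char (conv_power P m) l = char P l ^ m"
  by (induction m) (auto simp: char_return char_convolution real_distribution_conv_power)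

lemma nn_integral_exp_convolution:
  assumes "real_distribution P" "real_distribution Q"
  shows "(\<integral>\<^sup>+x. ennreal (exp (a * x)) \<partial>(convolution P Q)) =
    (\<integral>\<^sup>+x. ennreal (exp (a * x)) \<partial>P) * (\<integral>\<^sup>+x. ennreal (exp (a * x)) \<partial>Q)"
proof -
  interpret P: real_distribution P by fact
  interpret Q: real_distribution Q by fact
  show ?thesis
    by (subst nn_integral_convolution)
       (auto simp: distrib_left exp_add ennreal_mult nn_integral_cmult nn_integral_multc
          intro: P.finite_measure_axioms Q.finite_measure_axioms)
qed

lemma nn_integral_exp_conv_power:
  "real_distribution P \<Longrightarrow>
    (\<integral>\<^sup>+x. ennreal (exp (a * x)) \<partial>conv_power P m) = (\<integral>\<^sup>+x. ennreal (exp (a * x)) \<partial>P) ^ m"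
  by (induction m)
     (auto simp: nn_integral_return nn_integral_exp_convolution real_distribution_conv_power)

section \<open>Powers of 1 + z/m against the exponential\<close>

text \<open>Both \<open>1 + z / m\<close> and \<open>exp (z / m)\<close> lie in the closed unit
  disc, so their \<open>m\<close>-th powers differ by at most \<open>m\<close> times the distance of
  the bases, and that distance is a second-order Taylor remainder. The factor 3 bounds
  \<open>exp 1\<close>.\<close>

lemma exp_power_approx_complex:
  fixes z :: complex
  assumes m: "real m \<ge> 2 * norm z" "m > 0" and 1: "norm (1 + z / m) \<le> 1" and Re: "Re z \<le> 0"
  shows "norm ((1 + z / m) ^ m - exp z) \<le> 3 * (norm z)\<^sup>2 / m"
proof -
  let ?w = "z / of_nat m"
  have w: "norm ?w \<le> 1 / 2" using m by (simp add: norm_divide field_simps)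
  have "norm (exp ?w - (1 + ?w)) \<le> exp \<bar>Re ?w\<bar> * (norm ?w)\<^sup>2"
    using Taylor_exp[of ?w 1] by (simp add: numeral_2_eq_2)
  also have "exp \<bar>Re ?w\<bar> \<le> exp 1"
    using abs_Re_le_cmod[of ?w] w by simp
  also have "exp (1::real) \<le> 3" by (rule exp_le)
  finally have b: "norm (exp ?w - (1 + ?w)) \<le> 3 * (norm ?w)\<^sup>2"
    by (simp add: mult_right_mono)
  have e: "exp z = exp ?w ^ m" using m by (simp add: exp_of_nat_mult[symmetric])
  have "norm ((1 + ?w) ^ m - exp ?w ^ m) \<le> m * norm ((1 + ?w) - exp ?w)"
    using Re m by (intro norm_power_diff 1) (auto simp: Re_divide_of_nat divide_nonpos_pos)
  also have "\<dots> \<le> m * (3 * (norm ?w)\<^sup>2)"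
    using b by (intro mult_left_mono) (auto simp: norm_minus_commute)
  also have "\<dots> = 3 * (norm z)\<^sup>2 / m"
    using m by (simp add: norm_divide power2_eq_square field_simps)
  finally show ?thesis by (simp add: e)
qed

text \<open>Here the base may exceed 1, so the comparison goes through the logarithm: for |w| at
  most 1/2, \<open>ln (1 + w)\<close> lies between w - 2 w^2 and w. The error therefore sits inside
  the exponent.\<close>

lemma exp_power_approx_real:
  fixes y :: real
  assumes m: "real m \<ge> 2 * \<bar>y\<bar>" "m > 0"
  shows "(1 + y / m) ^ m \<le> exp y" "exp (y - 2 * y\<^sup>2 / m) \<le> (1 + y / m) ^ m" "1 + y / m \<ge> 0"
proof -
  have w: "\<bar>y / m\<bar> \<le> 1 / 2" using m by (simp add: field_simps)
  have p: "1 + y / m > 0" using w by linarith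
  then show "1 + y / m \<ge> 0" by simp
  have e: "(1 + y / m) ^ m = exp (m * ln (1 + y / m))"
    using p by (simp add: exp_of_nat_mult)
  have "m * ln (1 + y / m) \<le> m * (y / m)"
    using p by (intro mult_left_mono ln_add_one_self_le_self2) auto
  then show "(1 + y / m) ^ m \<le> exp y" unfolding e using m by simp
  have "m * (y / m - 2 * (y / m)\<^sup>2) \<le> m * ln (1 + y / m)"
    using abs_ln_one_plus_x_minus_x_bound[OF w] by (intro mult_left_mono) auto
  also have "m * (y / m - 2 * (y / m)\<^sup>2) = y - 2 * y\<^sup>2 / m"
    using m by (simp add: field_simps power2_eq_square)
  finally show "exp (y - 2 * y\<^sup>2 / m) \<le> (1 + y / m) ^ m" unfolding e by simp
qed

section \<open>Approximation by compound Poisson laws\<close>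

text \<open>
  Convolving \<open>m\<close> copies of \<open>(1 - g/m) \<delta>\<^sub>0 + G/m\<close>, where \<open>g\<close> is the mass of \<open>G\<close>, avoids the construction of
  the compound Poisson law with jump measure \<open>G\<close>.
\<close>

lemma poisson_approximation:
  fixes G :: "real measure" and B \<epsilon> :: real
  assumes sG [measurable_cong]: "sets G = sets borel" and fin: "finite_measure G"
    and x: "integrable G (\<lambda>x. x)"
    and ia: "integrable G (\<lambda>x. exp (- a * x))" and ia': "integrable G (\<lambda>x. exp (- a' * x))"
    and e: "\<epsilon> > 0"
  obtains \<nu> where "real_distribution \<nu>"
    "\<And>l. norm (char \<nu> l - exp (\<i> * of_real (l * B) + (CLINT x|G. iexp (l * x) - 1 - \<i> * of_real (l * x)))) \<le> \<epsilon>"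
    "integrable \<nu> (\<lambda>x. exp (- a * x))"
    "exp (- a * B + (LINT x|G. exp (- a * x) - 1 + a * x) - \<epsilon>) \<le> (LINT x|\<nu>. exp (- a * x))"
    "(LINT x|\<nu>. exp (- a * x)) \<le> exp (- a * B + (LINT x|G. exp (- a * x) - 1 + a * x))"
    "(\<integral>\<^sup>+x. ennreal (exp (- a' * x)) \<partial>\<nu>) \<le> ennreal (exp (- a' * B + (LINT x|G. exp (- a' * x) - 1 + a' * x)))"
proof -
  interpret G: finite_measure G by fact
  have sp [simp]: "space G = UNIV" using sets_eq_imp_space_eq[OF sG] by simp
  define g where "g = measure G UNIV"
  \<comment> \<open>Removing the compensator of the jump integral shifts the drift by the mean of
    \<open>G\<close>.\<close>
  define \<beta> where "\<beta> = B - (LINT x|G. x)"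
  define y where "y = (\<lambda>a. LINT x|G. exp (- a * x) - 1)"
  define z where "z = (\<lambda>l. CLINT x|G. iexp (l * x) - 1)"
  \<comment> \<open>The bound by 4 g gives m >= 2 |z l| and a nonnegative weight 1 - g/m; the terms
    in \<open>y\<close> meet the hypothesis of the real estimate; the last term pushes the errors 3
    (2 g)^2 / m and 2 (y a)^2 / m below \<epsilon>.\<close>
  obtain m :: nat where m: "real m \<ge> 1 + 4 * g + 2 * \<bar>y a\<bar> + 2 * \<bar>y a'\<bar> + (12 * g\<^sup>2 + 2 * (y a)\<^sup>2) / \<epsilon>"
    using real_arch_simple by blast
  have g0: "g \<ge> 0" by (simp add: g_def)
  have q0: "(12 * g\<^sup>2 + 2 * (y a)\<^sup>2) / \<epsilon> \<ge> 0" using e by simp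
  have m1: "real m \<ge> 4 * g" "real m > g" "real m > 0" "real m \<ge> 2 * \<bar>y a\<bar>" "real m \<ge> 2 * \<bar>y a'\<bar>" "m > 0"
    using m g0 q0 by linarith+
  have "(12 * g\<^sup>2 + 2 * (y a)\<^sup>2) / \<epsilon> \<le> m" using m g0 by linarith
  then have m2: "(12 * g\<^sup>2 + 2 * (y a)\<^sup>2) / m \<le> \<epsilon>" using e m1(3) by (simp add: field_simps)
  define P where "P = add_measure (density G (\<lambda>_. ennreal (1 / m)))
    (density (return borel 0) (\<lambda>_. ennreal (1 - g / m)))"
  have sP [measurable_cong, simp]: "sets P = sets borel" by (simp add: P_def sG)
  have gm: "1 - g / m \<ge> 0" using m1 by simp
  have nnP: "nn_integral P f = ennreal (1 / m) * nn_integral G f + ennreal (1 - g / m) * f 0"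
    if [measurable]: "f \<in> borel_measurable borel" for f
    unfolding P_def
    by (subst nn_integral_add_measure)
       (auto simp: sG nn_integral_density nn_integral_cmult nn_integral_return)
  have bP: "has_bochner_integral P f ((1 / m) *\<^sub>R integral\<^sup>L G f + (1 - g / m) *\<^sub>R f 0)"
    if f: "integrable G f" for f :: "real \<Rightarrow> 'b :: {banach, second_countable_topology}"
  proof -
    have [measurable]: "f \<in> borel_measurable borel"
      using borel_measurable_integrable[OF f] by (simp cong: measurable_cong_sets)
    have "integrable (return borel 0) f"
      by (simp add: integrable_iff_bounded nn_integral_return)
    moreover have "f \<in> borel_measurable G" using f by simp
    ultimately have "has_bochner_integral P f
        (integral\<^sup>L (density G (\<lambda>_. ennreal (1 / m))) f + integral\<^sup>L (density (return borel 0) (\<lambda>_. ennreal (1 - g / m))) f)"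
      unfolding P_def using f m1 gm
      by (intro has_bochner_integral_add_measure) (auto simp: sG integrable_density)
    with \<open>f \<in> borel_measurable G\<close> show ?thesis
      using gm m1 by (simp add: integral_density integral_return)
  qed
  have "emeasure P UNIV = 1"
  proof -
    have "emeasure P UNIV = ennreal (1 / m) * ennreal g + ennreal (1 - g / m)"
      using nnP[of "\<lambda>_. 1"] by (simp add: sets_eq_imp_space_eq[OF sP] g_def G.emeasure_eq_measure)
    also have "\<dots> = ennreal (1 / m * g + (1 - g / m))"
      using m1 gm g0 by (simp add: ennreal_mult[symmetric] ennreal_plus[symmetric] del: ennreal_plus)
    finally show ?thesis by simp
  qed
  then have P: "real_distribution P"
    unfolding real_distribution_def real_distribution_axioms_def
    by (simp add: sets_eq_imp_space_eq[OF sP] prob_spaceI)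
  define \<nu> where "\<nu> = convolution (conv_power P m) (return borel \<beta>)"
  note rd = real_distribution_conv_power[OF P] real_distribution_return
  have \<nu>: "real_distribution \<nu>" unfolding \<nu>_def by (intro real_distribution_convolution rd)
  have ii: "integrable G (\<lambda>x. iexp (l * x))" for l
    by (rule G.integrable_const_bound[where B=1]) auto
  have c1: "norm (char \<nu> l - exp (\<i> * of_real (l * B) + (CLINT x|G. iexp (l * x) - 1 - \<i> * of_real (l * x)))) \<le> \<epsilon>" for l
  proof -
    have "char P l = (1 / m) *\<^sub>R (CLINT x|G. iexp (l * x)) + (1 - g / m) *\<^sub>R 1"
      using has_bochner_integral_integral_eq[OF bP[OF ii[of l]]] by (simp add: char_def)
    also have "(CLINT x|G. iexp (l * x)) = z l + g"
      using ii[of l] by (simp add: z_def g_def scaleR_conv_of_real)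
    also have "(1 / m) *\<^sub>R (z l + g) + (1 - g / m) *\<^sub>R 1 = 1 + z l / m"
      using m1(3) by (simp add: scaleR_conv_of_real) (simp add: field_simps)
    finally have cP: "char P l = 1 + z l / m" .
    have nz: "norm (z l) \<le> 2 * g"
    proof -
      have "norm (z l) \<le> (LINT x|G. 2)"
        unfolding z_def using ii[of l]
        by (intro order.trans[OF integral_norm_bound] integral_mono integrable_norm)
           (auto intro!: order.trans[OF norm_triangle_ineq4])
      then show ?thesis by (simp add: g_def)
    qed
    have Rez: "Re (z l) \<le> 0"
    proof -
      have "Re (z l) = (LINT x|G. Re (iexp (l * x) - 1))"
        unfolding z_def using ii[of l] by (intro integral_Re[symmetric]) auto
      moreover have "0 \<le> (LINT x|G. - Re (iexp (l * x) - 1))"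
        by (intro integral_nonneg_AE) (auto simp: Re_exp)
      ultimately show ?thesis
        using Bochner_Integration.integral_minus[of G "\<lambda>x. Re (iexp (l * x) - 1)"] by linarith
    qed
    have eq: "\<i> * of_real (l * B) + (CLINT x|G. iexp (l * x) - 1 - \<i> * of_real (l * x)) = z l + \<i> * of_real (l * \<beta>)"
      using ii[of l] x by (simp add: z_def \<beta>_def algebra_simps)
    have "char \<nu> l - exp (z l + \<i> * of_real (l * \<beta>)) = ((1 + z l / m) ^ m - exp (z l)) * iexp (l * \<beta>)"
      unfolding \<nu>_def by (simp add: char_convolution rd char_return char_conv_power P cP exp_add algebra_simps)
    then have "norm (char \<nu> l - exp (z l + \<i> * of_real (l * \<beta>))) = norm ((1 + z l / m) ^ m - exp (z l))"
      by (simp add: norm_mult)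
    \<comment> \<open>The base \<open>1 + z l / m\<close> is the characteristic function of
      \<open>P\<close>, hence of modulus at most 1.\<close>
    also have "\<dots> \<le> 3 * (norm (z l))\<^sup>2 / m"
      using real_distribution.cmod_char_le_1[OF P, of l] nz Rez m1 cP
      by (intro exp_power_approx_complex) auto
    also have "\<dots> \<le> 3 * (2 * g)\<^sup>2 / m"
      using nz by (intro divide_right_mono mult_left_mono power_mono) auto
    also have "\<dots> \<le> (12 * g\<^sup>2 + 2 * (y a)\<^sup>2) / m"
      by (intro divide_right_mono) (auto simp: power2_eq_square)
    also have "\<dots> \<le> \<epsilon>" by (rule m2)
    finally show ?thesis by (simp only: eq)
  qed
  \<comment> \<open>Exponential moments are multiplicative under convolution. Computing with
    nonnegative integrals gives integrability together with the value, for both orders.\<close>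
  have L: "(\<integral>\<^sup>+x. ennreal (exp (- a * x)) \<partial>\<nu>) = ennreal ((1 + y a / m) ^ m * exp (- a * \<beta>))"
    if i: "integrable G (\<lambda>x. exp (- a * x))" and my: "2 * \<bar>y a\<bar> \<le> m" for a
  proof -
    have n0: "0 \<le> 1 + y a / m" using my m1 by (intro exp_power_approx_real)
    have "(\<integral>\<^sup>+x. ennreal (exp (- a * x)) \<partial>P) = ennreal (LINT x|P. exp (- a * x))"
      by (intro nn_integral_eq_integral integrable.intros[OF bP[OF i]]) auto
    also have "(LINT x|P. exp (- a * x)) = (1 / m) *\<^sub>R (LINT x|G. exp (- a * x)) + (1 - g / m) *\<^sub>R 1"
      using has_bochner_integral_integral_eq[OF bP[OF i]] by simp
    also have "(LINT x|G. exp (- a * x)) = y a + g"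
      using i by (simp add: y_def g_def)
    also have "(1 / m) *\<^sub>R (y a + g) + (1 - g / m) *\<^sub>R 1 = 1 + y a / m"
      using m1(3) by (simp add: field_simps)
    finally have *: "(\<integral>\<^sup>+x. ennreal (exp (- a * x)) \<partial>P) = ennreal (1 + y a / m)" .
    show ?thesis
      unfolding \<nu>_def
      by (subst nn_integral_exp_convolution, (rule rd)+, subst nn_integral_exp_conv_power[OF P], subst *)
         (use n0 in \<open>simp add: nn_integral_return ennreal_power[symmetric] ennreal_mult\<close>)
  qed
  have eq: "- a * B + (LINT x|G. exp (- a * x) - 1 + a * x) = y a - a * \<beta>"
    if i: "integrable G (\<lambda>x. exp (- a * x))" for a
    using i x by (simp add: y_def \<beta>_def algebra_simps)
  have ex: "0 \<le> (1 + y a / m) ^ m" using m1 by (intro zero_le_power exp_power_approx_real)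
  have int: "integrable \<nu> (\<lambda>x. exp (- a * x))"
    using L[OF ia] m1 \<nu> unfolding integrable_iff_bounded
    by (auto simp: real_distribution_def real_distribution_axioms_def cong: measurable_cong_sets)
  have "ennreal (LINT x|\<nu>. exp (- a * x)) = ennreal ((1 + y a / m) ^ m * exp (- a * \<beta>))"
    using L[OF ia] m1 int by (subst nn_integral_eq_integral[symmetric]) auto
  then have La: "(LINT x|\<nu>. exp (- a * x)) = (1 + y a / m) ^ m * exp (- a * \<beta>)"
    using ex by (subst (asm) ennreal_inj) (auto intro!: integral_nonneg_AE)
  show ?thesis
  proof (rule that[OF \<nu> c1 int])
    show "(LINT x|\<nu>. exp (- a * x)) \<le> exp (- a * B + (LINT x|G. exp (- a * x) - 1 + a * x))"
      unfolding La eq[OF ia] using exp_power_approx_real(1)[of "y a" m] m1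
      by (simp add: exp_diff exp_minus field_simps)
    have "2 * (y a)\<^sup>2 / m \<le> (12 * g\<^sup>2 + 2 * (y a)\<^sup>2) / m"
      by (intro divide_right_mono) auto
    then have "2 * (y a)\<^sup>2 / m \<le> \<epsilon>" using m2 by linarith
    then have "exp (y a - \<epsilon>) \<le> exp (y a - 2 * (y a)\<^sup>2 / m)" by simp
    also have "\<dots> \<le> (1 + y a / m) ^ m" using m1 by (intro exp_power_approx_real)
    finally have "exp (y a - \<epsilon>) * exp (- a * \<beta>) \<le> (1 + y a / m) ^ m * exp (- a * \<beta>)"
      by (rule mult_right_mono) simp
    then show "exp (- a * B + (LINT x|G. exp (- a * x) - 1 + a * x) - \<epsilon>) \<le> (LINT x|\<nu>. exp (- a * x))"
      unfolding La eq[OF ia] by (simp add: exp_add[symmetric] algebra_simps)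
    have "(1 + y a' / m) ^ m * exp (- a' * \<beta>) \<le> exp (y a') * exp (- a' * \<beta>)"
      using m1 by (intro mult_right_mono exp_power_approx_real) auto
    then show "(\<integral>\<^sup>+x. ennreal (exp (- a' * x)) \<partial>\<nu>) \<le> ennreal (exp (- a' * B + (LINT x|G. exp (- a' * x) - 1 + a' * x)))"
      using L[OF ia'] m1 unfolding eq[OF ia'] by (simp add: exp_add[symmetric] ennreal_leI)
  qed
qed

section \<open>Exponential moments under weak convergence\<close>

text \<open>Weak convergence tests only bounded continuous functions. The exponential is therefore
  cut at height \<open>exp (a * real k)\<close>; the moment of order \<open>a'\<close> makes the
  cutting error at most \<open>C * exp (- (a' - a) * real k)\<close> for all \<open>n\<close> at
  once, so the limits in \<open>n\<close> and \<open>k\<close> may be exchanged.\<close>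

lemma weak_conv_exp_moment:
  fixes \<nu> :: "nat \<Rightarrow> real measure"
  assumes \<nu>: "\<And>n. real_distribution (\<nu> n)" and \<mu>: "real_distribution \<mu>"
    and w: "weak_conv_m \<nu> \<mu>" and a: "0 < a" "a < a'" and C0: "0 \<le> C"
    and bound: "\<And>n. (\<integral>\<^sup>+x. ennreal (exp (- a' * x)) \<partial>\<nu> n) \<le> ennreal C"
    and lim: "(\<lambda>n. LINT x|\<nu> n. exp (- a * x)) \<longlonglongrightarrow> L"
  shows "integrable \<mu> (\<lambda>x. exp (- a * x))" "(LINT x|\<mu>. exp (- a * x)) = L"
proof -
  interpret \<mu>: real_distribution \<mu> by fact
  define h where "h = (\<lambda>k x. min (exp (- a * x)) (exp (a * real k)))"
  have h_cont: "isCont (h k) x" for k x unfolding h_def by (intro continuous_intros)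
  have [measurable]: "h k \<in> borel_measurable borel" for k unfolding h_def by simp
  have conv: "(\<lambda>n. LINT x|\<nu> n. h k x) \<longlonglongrightarrow> (LINT x|\<mu>. h k x)" for k
    by (rule weak_conv_imp_integral_bdd_continuous_conv[OF \<nu> \<mu> w h_cont, where B="exp (a * real k)"])
       (auto simp: h_def)
  have ih: "integrable N (h k)" if "real_distribution N" for N k
  proof -
    interpret N: real_distribution N by fact
    show ?thesis by (rule N.integrable_const_bound[where B="exp (a * real k)"]) (auto simp: h_def)
  qed
  have ia: "integrable (\<nu> n) (\<lambda>x. exp (- a * x))" for n
  proof -
    interpret N: real_distribution "\<nu> n" by (rule \<nu>)
    have "integrable (\<nu> n) (\<lambda>x. exp (- a' * x))"
      using le_less_trans[OF bound[of n]] by (auto simp: integrable_iff_bounded)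
    then have "integrable (\<nu> n) (\<lambda>x. 1 + exp (- a' * x))" by simp
    then show ?thesis
    proof (rule Bochner_Integration.integrable_bound)
      show "AE x in \<nu> n. norm (exp (- a * x)) \<le> norm (1 + exp (- a' * x))"
      proof (intro AE_I2)
        fix x :: real
        show "norm (exp (- a * x)) \<le> norm (1 + exp (- a' * x))"
        proof (cases "x \<ge> 0")
          case True
          then have "exp (- a * x) \<le> 1" using a by simp
          then show ?thesis by (simp add: add_increasing2)
        next
          case False
          then have "exp (- a * x) \<le> exp (- a' * x)" using a by (simp add: mult_right_mono_neg)
          then show ?thesis by (simp add: add_increasing)
        qed
      qed
    qed simp
  qed
  have tail: "\<bar>(LINT x|\<nu> n. exp (- a * x)) - (LINT x|\<nu> n. h k x)\<bar> \<le> C * exp (- (a' - a) * real k)" for n k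
  proof -
    interpret N: real_distribution "\<nu> n" by (rule \<nu>)
    have i': "integrable (\<nu> n) (\<lambda>x. exp (- a' * x))"
      using le_less_trans[OF bound[of n]] by (auto simp: integrable_iff_bounded)
    have "ennreal (LINT x|\<nu> n. exp (- a' * x)) \<le> ennreal C"
      using bound[of n] i' by (subst (asm) nn_integral_eq_integral) auto
    then have b: "(LINT x|\<nu> n. exp (- a' * x)) \<le> C"
      using C0 by (simp add: ennreal_le_iff)
    \<comment> \<open>The truncation acts only on x < -k, where exp (- a x) = exp (- a' x) exp ((a'
      - a) x) and the last factor is at most exp (- (a' - a) k).\<close>
    have pt: "exp (- a * x) - h k x \<le> exp (- a' * x) * exp (- (a' - a) * real k)" for x
    proof (cases "x \<ge> - real k")
      case True
      then have "exp (- a * x) \<le> exp (a * real k)" using a mult_left_mono[of "- x" "real k" a] by simp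
      then show ?thesis by (simp add: h_def)
    next
      case False
      have "exp (- a * x) - h k x \<le> exp (- a * x)" by (simp add: h_def)
      also have "\<dots> \<le> exp (- a' * x + - (a' - a) * real k)"
      proof -
        have "(a' - a) * real k \<le> (a' - a) * (- x)" using False a by (intro mult_left_mono) auto
        then show ?thesis by (simp add: algebra_simps)
      qed
      finally show ?thesis by (simp only: exp_add)
    qed
    have "(LINT x|\<nu> n. exp (- a * x)) - (LINT x|\<nu> n. h k x) = (LINT x|\<nu> n. exp (- a * x) - h k x)"
      using ia[of n] ih[OF \<nu>] by simp
    also have "\<dots> \<le> (LINT x|\<nu> n. exp (- a' * x) * exp (- (a' - a) * real k))"
      using ia[of n] ih[OF \<nu>] i' pt by (intro integral_mono) auto
    also have "\<dots> \<le> C * exp (- (a' - a) * real k)" using b by simp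
    finally have "(LINT x|\<nu> n. exp (- a * x)) - (LINT x|\<nu> n. h k x) \<le> C * exp (- (a' - a) * real k)" .
    moreover have "(LINT x|\<nu> n. h k x) \<le> (LINT x|\<nu> n. exp (- a * x))"
      using ia[of n] ih[OF \<nu>] by (intro integral_mono) (auto simp: h_def)
    ultimately show ?thesis by simp
  qed
  \<comment> \<open>The error bound survives the limit in \<open>n\<close> at fixed
    \<open>k\<close>, as both integrals converge.\<close>
  have tail': "\<bar>L - (LINT x|\<mu>. h k x)\<bar> \<le> C * exp (- (a' - a) * real k)" for k
    by (rule tendsto_upperbound[OF tendsto_rabs[OF tendsto_diff[OF lim conv[of k]]]])
       (use tail in auto)
  have "(\<lambda>k. C * exp (- (a' - a) * real k)) \<longlonglongrightarrow> 0"
    using a by real_asymp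
  then have "(\<lambda>k. L - (LINT x|\<mu>. h k x)) \<longlonglongrightarrow> 0"
    by (rule Lim_null_comparison[rotated]) (use tail' in auto)
  then have hL: "(\<lambda>k. LINT x|\<mu>. h k x) \<longlonglongrightarrow> L"
    using tendsto_diff[OF tendsto_const[of L], of "\<lambda>k. L - (LINT x|\<mu>. h k x)"] by fastforce
  have mono: "AE x in \<mu>. mono (\<lambda>k. h k x)"
    using a by (auto simp: mono_def h_def intro!: min.coboundedI2 min.mono)
  have pt: "AE x in \<mu>. (\<lambda>k. h k x) \<longlonglongrightarrow> exp (- a * x)"
  proof (intro AE_I2)
    fix x
    have "eventually (\<lambda>k. real k \<ge> - x) sequentially"
      using eventually_ge_at_top[of "nat \<lceil>- x\<rceil>"] by eventually_elim linarith
    then have "eventually (\<lambda>k. h k x = exp (- a * x)) sequentially"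
    proof eventually_elim
      case (elim k)
      then have "- a * x \<le> a * real k" using a mult_left_mono[of "- x" "real k" a] by simp
      then show ?case by (simp add: h_def)
    qed
    then show "(\<lambda>k. h k x) \<longlonglongrightarrow> exp (- a * x)" by (rule tendsto_eventually)
  qed
  \<comment> \<open>\<open>h k\<close> increases to the exponential and its integrals converge to
    \<open>L\<close>; monotone convergence yields integrability as well as the value.\<close>
  note mc = integral_monotone_convergence_nonneg[OF ih[OF \<mu>] mono _ pt hL]
  show "integrable \<mu> (\<lambda>x. exp (- a * x))" by (rule mc) (auto simp: h_def)
  show "(LINT x|\<mu>. exp (- a * x)) = L" by (rule mc) (auto simp: h_def)
qed

section \<open>Laplace transforms of infinitely divisible laws\<close>

text \<open>The second-order Taylor bound is good near 0, the first-order bound far away; adding the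
  two constants covers either branch of the minimum.\<close>

lemma norm_iexp_remainder_le:
  "norm (iexp (l * x) - 1 - \<i> * complex_of_real (l * x)) \<le> (l\<^sup>2 / 2 + 2 * \<bar>l\<bar>) * min (x\<^sup>2) \<bar>x\<bar>"
proof -
  have "norm (iexp (l * x) - 1 - \<i> * complex_of_real (l * x)) \<le> \<bar>l * x\<bar>\<^sup>2 / 2"
    using iexp_approx1[of "l * x" 1] by (simp add: numeral_2_eq_2 diff_diff_eq)
  then have 1: "norm (iexp (l * x) - 1 - \<i> * complex_of_real (l * x)) \<le> l\<^sup>2 / 2 * x\<^sup>2"
    by (simp add: power_mult_distrib)
  have "norm (iexp (l * x) - 1 - \<i> * complex_of_real (l * x)) \<le> 2 * \<bar>l * x\<bar>"
    using iexp_approx2[of "l * x" 1] by (simp add: diff_diff_eq)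
  then have 2: "norm (iexp (l * x) - 1 - \<i> * complex_of_real (l * x)) \<le> 2 * \<bar>l\<bar> * \<bar>x\<bar>"
    by (simp add: abs_mult)
  have "l\<^sup>2 / 2 * x\<^sup>2 \<le> (l\<^sup>2 / 2 + 2 * \<bar>l\<bar>) * x\<^sup>2" "2 * \<bar>l\<bar> * \<bar>x\<bar> \<le> (l\<^sup>2 / 2 + 2 * \<bar>l\<bar>) * \<bar>x\<bar>"
    by (intro mult_right_mono; simp)+
  with 1 2 show ?thesis by (auto simp: min_def)
qed

lemma exp_remainder_nonneg: "0 \<le> exp (- \<theta> * x) - 1 + \<theta> * (x::real)"
  using exp_ge_add_one_self[of "- \<theta> * x"] by simp

text \<open>Three regimes: a second-order Taylor bound on |x| <= 1, linear growth for x > 1, and for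
  x < -1 the exponential of the larger order \<open>a'\<close>. The constant is the sum of the three
  factors.\<close>

lemma exp_remainder_le:
  fixes x \<theta> :: real
  assumes "0 \<le> \<theta>" "\<theta> \<le> a'"
  shows "exp (- \<theta> * x) - 1 + \<theta> * x \<le>
    (exp \<theta> * \<theta>\<^sup>2 + \<theta> + 1) * (min (x\<^sup>2) \<bar>x\<bar> + indicator {..<-1} x * exp (- a' * x))"
proof -
  let ?K = "exp \<theta> * \<theta>\<^sup>2 + \<theta> + 1"
  have K: "?K \<ge> 1" "?K \<ge> exp \<theta> * \<theta>\<^sup>2" "?K \<ge> \<theta>" using assms by auto
  consider "\<bar>x\<bar> \<le> 1" | "x > 1" | "x < -1" by linarith
  then show ?thesis
  proof cases
    case 1
    let ?u = "- \<theta> * x"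
    have "norm (exp (complex_of_real ?u) - (1 + complex_of_real ?u)) \<le> exp \<bar>?u\<bar> * (norm (complex_of_real ?u))\<^sup>2"
      using Taylor_exp[of "complex_of_real ?u" 1] by (simp add: numeral_2_eq_2)
    also have "exp (complex_of_real ?u) - (1 + complex_of_real ?u) = complex_of_real (exp ?u - 1 - ?u)"
      by (simp add: exp_of_real[symmetric])
    finally have "\<bar>exp ?u - 1 - ?u\<bar> \<le> exp \<bar>?u\<bar> * ?u\<^sup>2" unfolding norm_of_real by simp
    also have "\<bar>?u\<bar> \<le> \<theta>" using 1 assms by (simp add: abs_mult mult_left_le)
    then have "exp \<bar>?u\<bar> * ?u\<^sup>2 \<le> exp \<theta> * ?u\<^sup>2" by (intro mult_right_mono) auto
    also have "\<dots> = exp \<theta> * \<theta>\<^sup>2 * x\<^sup>2" by (simp add: power_mult_distrib)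
    also have "\<dots> \<le> ?K * x\<^sup>2" using K by (intro mult_right_mono) auto
    also have "x\<^sup>2 = min (x\<^sup>2) \<bar>x\<bar>"
    proof -
      have "\<bar>x\<bar> * \<bar>x\<bar> \<le> \<bar>x\<bar>" using 1 by (intro mult_left_le) auto
      then show ?thesis by (simp add: power2_eq_square)
    qed
    finally have "exp ?u - 1 - ?u \<le> ?K * min (x\<^sup>2) \<bar>x\<bar>" by linarith
    with 1 show ?thesis by (auto simp: indicator_def)
  next
    case 2
    have "exp (- \<theta> * x) \<le> 1" using 2 assms by simp
    then have "exp (- \<theta> * x) - 1 + \<theta> * x \<le> \<theta> * x" by simp
    also have "\<dots> \<le> ?K * x" using K 2 by (intro mult_right_mono) auto
    finally have "exp (- \<theta> * x) - 1 + \<theta> * x \<le> ?K * x" .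
    moreover have "min (x\<^sup>2) \<bar>x\<bar> = x" using 2 by (simp add: power2_eq_square min_def)
    ultimately show ?thesis using 2 by (simp add: indicator_def)
  next
    case 3
    have "\<theta> * x \<le> 0" using 3 assms by (intro mult_nonneg_nonpos) auto
    then have "exp (- \<theta> * x) - 1 + \<theta> * x \<le> exp (- \<theta> * x)" by simp
    also have "\<dots> \<le> exp (- a' * x)" using 3 assms by (simp add: mult_right_mono_neg)
    also have "\<dots> \<le> ?K * exp (- a' * x)" using K by simp
    also have "\<dots> \<le> ?K * (min (x\<^sup>2) \<bar>x\<bar> + exp (- a' * x))" using K by (intro mult_left_mono) auto
    finally show ?thesis using 3 by (simp add: indicator_def)
  qed
qed

text \<open>The second-order Taylor term at 1/r has size l^2 / (2 r^2), which the mass C r^2 brings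
  to a constant; the third-order remainder leaves an error of order 1/r.\<close>

lemma char_remainder_limit:
  "(\<lambda>n. (C * (real (Suc n))\<^sup>2) *\<^sub>R (iexp (l * (1 / real (Suc n))) - 1 - \<i> * complex_of_real (l * (1 / real (Suc n)))))
     \<longlonglongrightarrow> - complex_of_real (l\<^sup>2 / 2 * C)"
proof (rule LIM_zero_cancel, rule Lim_null_comparison)
  show "(\<lambda>n. \<bar>C\<bar> * (\<bar>l\<bar> ^ 3 / (6 * real (Suc n)))) \<longlonglongrightarrow> 0"
    by real_asymp
  show "\<forall>\<^sub>F n in sequentially. norm ((C * (real (Suc n))\<^sup>2) *\<^sub>R (iexp (l * (1 / real (Suc n))) - 1 - \<i> * complex_of_real (l * (1 / real (Suc n))))
    - - complex_of_real (l\<^sup>2 / 2 * C)) \<le> \<bar>C\<bar> * (\<bar>l\<bar> ^ 3 / (6 * real (Suc n)))"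
  proof (intro always_eventually allI)
    fix n
    define r where "r = real (Suc n)"
    have r: "r > 0" by (simp add: r_def)
    let ?x = "l * (1 / r)"
    have "(\<Sum>k\<le>2. (\<i> * complex_of_real ?x) ^ k / fact k) = 1 + \<i> * ?x - complex_of_real (?x\<^sup>2 / 2)"
      by (simp add: numeral_2_eq_2 algebra_simps)
    then have "norm (iexp ?x - (1 + \<i> * ?x - complex_of_real (?x\<^sup>2 / 2))) \<le> \<bar>?x\<bar> ^ 3 / 6"
      using iexp_approx1[of ?x 2] by (simp add: fact_numeral)
    then have "\<bar>C * r\<^sup>2\<bar> * norm (iexp ?x - (1 + \<i> * ?x - complex_of_real (?x\<^sup>2 / 2))) \<le> \<bar>C * r\<^sup>2\<bar> * (\<bar>?x\<bar> ^ 3 / 6)"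
      by (intro mult_left_mono) auto
    also have "\<dots> = \<bar>C\<bar> * (\<bar>l\<bar> ^ 3 / (6 * r))"
      using r by (simp add: abs_mult power_mult_distrib power_divide field_simps power2_eq_square power3_eq_cube)
    also have "\<bar>C * r\<^sup>2\<bar> * norm (iexp ?x - (1 + \<i> * ?x - complex_of_real (?x\<^sup>2 / 2)))
      = norm ((C * r\<^sup>2) *\<^sub>R (iexp ?x - (1 + \<i> * ?x - complex_of_real (?x\<^sup>2 / 2))))"
      by (simp only: norm_scaleR)
    also have "(C * r\<^sup>2) *\<^sub>R (iexp ?x - (1 + \<i> * ?x - complex_of_real (?x\<^sup>2 / 2)))
      = (C * r\<^sup>2) *\<^sub>R (iexp ?x - 1 - \<i> * complex_of_real ?x) + complex_of_real (C * r\<^sup>2 * (?x\<^sup>2 / 2))"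
      by (simp add: scaleR_conv_of_real algebra_simps)
    also have "C * r\<^sup>2 * (?x\<^sup>2 / 2) = l\<^sup>2 / 2 * C"
      using r by (simp add: power_divide)
    finally show "norm ((C * (real (Suc n))\<^sup>2) *\<^sub>R (iexp (l * (1 / real (Suc n))) - 1 - \<i> * complex_of_real (l * (1 / real (Suc n))))
      - - complex_of_real (l\<^sup>2 / 2 * C)) \<le> \<bar>C\<bar> * (\<bar>l\<bar> ^ 3 / (6 * real (Suc n)))"
      unfolding r_def[symmetric] by simp
  qed
qed

text \<open>Real counterpart of the preceding limit: with a real exponent the Gaussian contribution
  enters with a positive sign.\<close>

lemma laplace_remainder_limit:
  assumes "\<theta> > (0::real)"
  shows "(\<lambda>n. (C * (real (Suc n))\<^sup>2) *\<^sub>R (exp (- \<theta> * (1 / real (Suc n))) - 1 + \<theta> * (1 / real (Suc n))))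
     \<longlonglongrightarrow> \<theta>\<^sup>2 / 2 * C"
proof -
  have "(\<lambda>n. (real (Suc n))\<^sup>2 * (exp (- \<theta> * (1 / real (Suc n))) - 1 + \<theta> * (1 / real (Suc n)))) \<longlonglongrightarrow> \<theta>\<^sup>2 / 2"
    using assms by (real_asymp simp: power2_eq_square)
  from tendsto_mult_left[OF this, of C] show ?thesis by (simp add: mult.assoc mult.commute[of C])
qed

text \<open>
  The approximating jump measures \<open>G n\<close> keep the jumps larger than \<open>1 / (n + 1)\<close>. The atom of mass
  \<open>C (n + 1)\<^sup>2\<close> at \<open>1 / (n + 1)\<close> produces the Gaussian part in the limit.
\<close>

theorem laplace_transform_of_char:
  fixes F \<mu> :: "real measure" and a a' B C :: real
  assumes sF [measurable_cong]: "sets F = sets borel"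
    and small: "(\<integral>\<^sup>+x. ennreal (min (x\<^sup>2) \<bar>x\<bar>) \<partial>F) < \<infinity>"
    and large: "(\<integral>\<^sup>+x. ennreal (indicator {..<-1} x * exp (- a' * x)) \<partial>F) < \<infinity>"
    and a: "0 < a" "a < a'" and C: "C \<ge> 0"
    and \<mu>: "real_distribution \<mu>"
    and char: "\<And>l. char \<mu> l = exp (\<i> * of_real (l * B) - of_real (l\<^sup>2 / 2 * C)
      + (CLINT x|F. iexp (l * x) - 1 - \<i> * of_real (l * x)))"
  shows "integrable \<mu> (\<lambda>x. exp (- a * x))"
    and "(LINT x|\<mu>. exp (- a * x)) = exp (- a * B + a\<^sup>2 / 2 * C + (LINT x|F. exp (- a * x) - 1 + a * x))"
proof -
  have sp [simp]: "space F = UNIV" using sets_eq_imp_space_eq[OF sF] by simp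
  define w0 where "w0 = (\<lambda>x::real. min (x\<^sup>2) \<bar>x\<bar>)"
  \<comment> \<open>Up to constants, \<open>w\<close> dominates the remainders of
    \<open>iexp\<close> and of all real exponentials of order between 0 and \<open>a'\<close>. Its
    second summand is integrable by the assumption on large negative jumps.\<close>
  define w where "w = (\<lambda>x. w0 x + indicator {..<-1} x * exp (- a' * x))"
  have w0_nn: "0 \<le> w0 x" for x by (simp add: w0_def)
  have [measurable]: "w0 \<in> borel_measurable borel" unfolding w0_def by measurable
  have iw0: "integrable F w0"
    using small by (intro integrableI_nonneg) (auto simp: w0_def)
  have "integrable F (\<lambda>x. indicator {..<-1} x * exp (- a' * x))"
    using large by (intro integrableI_nonneg) auto
  with iw0 have iw: "integrable F w" unfolding w_def by simp
  have w0w: "w0 x \<le> w x" for x by (simp add: w_def)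
  define S where "S = (\<lambda>n. {x::real. 1 / real (Suc n) < \<bar>x\<bar>})"
  have [measurable]: "S n \<in> sets borel" for n unfolding S_def by measurable
  define G where "G = (\<lambda>n. add_measure (density F (\<lambda>x. ennreal (indicator (S n) x)))
     (density (return borel (1 / real (Suc n))) (\<lambda>_. ennreal (C * (real (Suc n))\<^sup>2))))"
  have sG [measurable_cong, simp]: "sets (G n) = sets borel" for n by (simp add: G_def sF)
  have spG [simp]: "space (G n) = UNIV" for n using sets_eq_imp_space_eq[OF sG] by simp
  have bG: "has_bochner_integral (G n) f
      ((LINT x|F. indicator (S n) x *\<^sub>R f x) + (C * (real (Suc n))\<^sup>2) *\<^sub>R f (1 / real (Suc n)))"
    if f [measurable]: "f \<in> borel_measurable borel" and i: "integrable F (\<lambda>x. indicator (S n) x *\<^sub>R f x)"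
    for f :: "real \<Rightarrow> 'b :: {banach, second_countable_topology}" and n
  proof -
    have "integrable (return borel (1 / real (Suc n))) f"
      by (simp add: integrable_iff_bounded nn_integral_return)
    then have "has_bochner_integral (G n) f
        (integral\<^sup>L (density F (\<lambda>x. ennreal (indicator (S n) x))) f
         + integral\<^sup>L (density (return borel (1 / real (Suc n))) (\<lambda>_. ennreal (C * (real (Suc n))\<^sup>2))) f)"
      unfolding G_def using i C
      by (intro has_bochner_integral_add_measure) (auto simp: sF integrable_density)
    then show ?thesis using C by (simp add: integral_density integral_return)
  qed
  have dom_S: "integrable F (\<lambda>x. indicator (S n) x *\<^sub>R f x)"
    if "f \<in> borel_measurable borel" "\<And>x. x \<in> S n \<Longrightarrow> norm (f x) \<le> k * w x"
    for f :: "real \<Rightarrow> 'b :: {banach, second_countable_topology}" and n k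
    by (rule Bochner_Integration.integrable_bound[of F "\<lambda>x. k * w x"])
       (use that iw in \<open>auto simp: indicator_def intro!: AE_I2 intro: order.trans[OF _ abs_ge_self]\<close>)
  \<comment> \<open>Cutting away |x| <= 1/(n+1) makes \<open>G n\<close> finite and gives it a mean:
    on \<open>S n\<close> both 1 and |x| are bounded by multiples of \<open>w0\<close>, although
    \<open>F\<close> may have infinite mass near 0.\<close>
  have S_w0: "1 \<le> (real (Suc n))\<^sup>2 * w0 x" "\<bar>x\<bar> \<le> real (Suc n) * w0 x" if "x \<in> S n" for x n
  proof -
    define r where "r = real (Suc n)"
    have r: "r \<ge> 1" by (simp add: r_def)
    have x: "1 < r * \<bar>x\<bar>" using that r unfolding S_def r_def[symmetric] by (simp add: field_simps)
    have "1 * 1 \<le> (r * \<bar>x\<bar>) * (r * \<bar>x\<bar>)" using x by (intro mult_mono) auto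
    moreover have "1 * 1 \<le> r * (r * \<bar>x\<bar>)" using x r by (intro mult_mono) auto
    moreover have "1 * \<bar>x\<bar> \<le> (r * \<bar>x\<bar>) * \<bar>x\<bar>" "1 * \<bar>x\<bar> \<le> r * \<bar>x\<bar>"
      using x r by (intro mult_right_mono; simp)+
    ultimately have "1 \<le> r\<^sup>2 * w0 x" "\<bar>x\<bar> \<le> r * w0 x"
      by (auto simp: w0_def min_def power2_eq_square algebra_simps)
    then show "1 \<le> (real (Suc n))\<^sup>2 * w0 x" "\<bar>x\<bar> \<le> real (Suc n) * w0 x" by (auto simp: r_def)
  qed
  have G1: "integrable (G n) (\<lambda>x. 1::real)" for n
  proof (rule integrable.intros[OF bG[OF _ dom_S]])
    fix x assume "x \<in> S n"
    then show "norm (1::real) \<le> (real (Suc n))\<^sup>2 * w x"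
      using order.trans[OF S_w0(1)[of x n] mult_left_mono[OF w0w[of x], of "(real (Suc n))\<^sup>2"]] by simp
  qed simp_all
  have fin: "finite_measure (G n)" for n
  proof -
    have "emeasure (G n) UNIV < \<infinity>"
      using G1[of n] by (simp add: integrable_iff_bounded)
    then show ?thesis by (intro finite_measureI) simp
  qed
  have Gx: "integrable (G n) (\<lambda>x. x)" for n
  proof (rule integrable.intros[OF bG[OF _ dom_S]])
    fix x assume "x \<in> S n"
    then show "norm x \<le> real (Suc n) * w x"
      using order.trans[OF S_w0(2)[of x n] mult_left_mono[OF w0w[of x], of "real (Suc n)"]] by simp
  qed simp_all
  have f_le: "norm (exp (- \<theta> * x) - 1 + \<theta> * x) \<le> (exp \<theta> * \<theta>\<^sup>2 + \<theta> + 1) * w x"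
    if "0 \<le> \<theta>" "\<theta> \<le> a'" for \<theta> x
    using exp_remainder_le[OF that, of x] exp_remainder_nonneg[of \<theta> x] by (simp add: w_def w0_def)
  have bf: "has_bochner_integral (G n) (\<lambda>x. exp (- \<theta> * x) - 1 + \<theta> * x)
      ((LINT x|F. indicator (S n) x *\<^sub>R (exp (- \<theta> * x) - 1 + \<theta> * x))
       + (C * (real (Suc n))\<^sup>2) *\<^sub>R (exp (- \<theta> * (1 / real (Suc n))) - 1 + \<theta> * (1 / real (Suc n))))"
    if "0 \<le> \<theta>" "\<theta> \<le> a'" for \<theta> n
    by (rule bG[OF _ dom_S[OF _ f_le[OF that]]]) auto
  have Gexp: "integrable (G n) (\<lambda>x. exp (- \<theta> * x))" if "0 \<le> \<theta>" "\<theta> \<le> a'" for \<theta> n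
  proof -
    have "integrable (G n) (\<lambda>x. (exp (- \<theta> * x) - 1 + \<theta> * x) + 1 - \<theta> * x)"
      by (rule Bochner_Integration.integrable_diff[OF Bochner_Integration.integrable_add[OF
          integrable.intros[OF bf[OF that]] G1] integrable_mult_right[OF Gx]])
    then show ?thesis by simp
  qed
  \<comment> \<open>Dominated convergence; the point 0 belongs to no \<open>S n\<close>, hence the
    condition \<open>f 0 = 0\<close>.\<close>
  have lim_S: "(\<lambda>n. LINT x|F. indicator (S n) x *\<^sub>R f x) \<longlonglongrightarrow> (LINT x|F. f x)"
    if [measurable]: "f \<in> borel_measurable borel" and le: "\<And>x. norm (f x) \<le> k * w x" and 0: "f 0 = 0"
    for f :: "real \<Rightarrow> 'b :: {banach, second_countable_topology}" and k
  proof (rule integral_dominated_convergence[where w="\<lambda>x. k * w x"])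
    show "AE x in F. (\<lambda>n. indicator (S n) x *\<^sub>R f x) \<longlonglongrightarrow> f x"
    proof (intro AE_I2)
      fix x
      show "(\<lambda>n. indicator (S n) x *\<^sub>R f x) \<longlonglongrightarrow> f x"
      proof (cases "x = 0")
        case False
        then have "eventually (\<lambda>n. 1 / real (Suc n) < \<bar>x\<bar>) sequentially"
          by real_asymp
        then show ?thesis
          by (intro tendsto_eventually) (auto simp: S_def elim!: eventually_mono)
      qed (simp add: 0)
    qed
  qed (use le iw order.trans[OF norm_ge_zero le] in \<open>auto simp: indicator_def\<close>)
  \<comment> \<open>The conclusions are bundled into one predicate so that a single choice selects a
    law for every \<open>n\<close>; the tolerance is 1/(n+1).\<close>
  define Q where "Q = (\<lambda>n \<nu>. real_distribution \<nu> \<and>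
    (\<forall>l. norm (char \<nu> l - exp (\<i> * of_real (l * B) + (CLINT x|G n. iexp (l * x) - 1 - \<i> * of_real (l * x)))) \<le> 1 / real (Suc n)) \<and>
    exp (- a * B + (LINT x|G n. exp (- a * x) - 1 + a * x) - 1 / real (Suc n)) \<le> (LINT x|\<nu>. exp (- a * x)) \<and>
    (LINT x|\<nu>. exp (- a * x)) \<le> exp (- a * B + (LINT x|G n. exp (- a * x) - 1 + a * x)) \<and>
    (\<integral>\<^sup>+x. ennreal (exp (- a' * x)) \<partial>\<nu>) \<le> ennreal (exp (- a' * B + (LINT x|G n. exp (- a' * x) - 1 + a' * x))))"
  have "\<exists>\<nu>. Q n \<nu>" for n
  proof -
    obtain \<nu> where "real_distribution \<nu>"
      "\<And>l. norm (char \<nu> l - exp (\<i> * of_real (l * B) + (CLINT x|G n. iexp (l * x) - 1 - \<i> * of_real (l * x)))) \<le> 1 / real (Suc n)"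
      "exp (- a * B + (LINT x|G n. exp (- a * x) - 1 + a * x) - 1 / real (Suc n)) \<le> (LINT x|\<nu>. exp (- a * x))"
      "(LINT x|\<nu>. exp (- a * x)) \<le> exp (- a * B + (LINT x|G n. exp (- a * x) - 1 + a * x))"
      "(\<integral>\<^sup>+x. ennreal (exp (- a' * x)) \<partial>\<nu>) \<le> ennreal (exp (- a' * B + (LINT x|G n. exp (- a' * x) - 1 + a' * x)))"
      by (rule poisson_approximation[OF sG fin Gx Gexp[of a] Gexp[of a'], where \<epsilon>="1 / real (Suc n)" and B=B])
         (use a in auto)
    then show ?thesis unfolding Q_def by blast
  qed
  then obtain \<nu> where Q: "\<And>n. Q n (\<nu> n)" by metis
  then have \<nu>: "real_distribution (\<nu> n)"
    and \<nu>_char: "norm (char (\<nu> n) l - exp (\<i> * of_real (l * B) + (CLINT x|G n. iexp (l * x) - 1 - \<i> * of_real (l * x)))) \<le> 1 / real (Suc n)"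
    and \<nu>_lower: "exp (- a * B + (LINT x|G n. exp (- a * x) - 1 + a * x) - 1 / real (Suc n)) \<le> (LINT x|\<nu> n. exp (- a * x))"
    and \<nu>_upper: "(LINT x|\<nu> n. exp (- a * x)) \<le> exp (- a * B + (LINT x|G n. exp (- a * x) - 1 + a * x))"
    and \<nu>_a': "(\<integral>\<^sup>+x. ennreal (exp (- a' * x)) \<partial>\<nu> n) \<le> ennreal (exp (- a' * B + (LINT x|G n. exp (- a' * x) - 1 + a' * x)))" for n l
    unfolding Q_def by blast+
  have f_lim: "(\<lambda>n. LINT x|G n. exp (- \<theta> * x) - 1 + \<theta> * x) \<longlonglongrightarrow>
      (LINT x|F. exp (- \<theta> * x) - 1 + \<theta> * x) + \<theta>\<^sup>2 / 2 * C" if "0 < \<theta>" "\<theta> \<le> a'" for \<theta>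
  proof -
    have "0 \<le> \<theta>" using that by simp
    show ?thesis
      unfolding has_bochner_integral_integral_eq[OF bf[OF \<open>0 \<le> \<theta>\<close> that(2)]]
      by (intro tendsto_add laplace_remainder_limit[OF that(1)]
          lim_S[OF _ f_le[OF \<open>0 \<le> \<theta>\<close> that(2)]]) auto
  qed
  have e_le: "norm (iexp (l * x) - 1 - \<i> * complex_of_real (l * x)) \<le> (l\<^sup>2 / 2 + 2 * \<bar>l\<bar>) * w x" for l x
    using norm_iexp_remainder_le[of l x] mult_left_mono[OF w0w[of x], of "l\<^sup>2 / 2 + 2 * \<bar>l\<bar>"]
    by (simp add: w0_def)
  have e_lim: "(\<lambda>n. CLINT x|G n. iexp (l * x) - 1 - \<i> * of_real (l * x)) \<longlonglongrightarrow>
      (CLINT x|F. iexp (l * x) - 1 - \<i> * of_real (l * x)) + - complex_of_real (l\<^sup>2 / 2 * C)" for l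
  proof -
    have be: "has_bochner_integral (G n) (\<lambda>x. iexp (l * x) - 1 - \<i> * complex_of_real (l * x))
      ((CLINT x|F. indicator (S n) x *\<^sub>R (iexp (l * x) - 1 - \<i> * complex_of_real (l * x)))
       + (C * (real (Suc n))\<^sup>2) *\<^sub>R (iexp (l * (1 / real (Suc n))) - 1 - \<i> * complex_of_real (l * (1 / real (Suc n)))))" for n
      by (rule bG[OF _ dom_S[OF _ e_le]]) auto
    show ?thesis
      unfolding has_bochner_integral_integral_eq[OF be]
      by (intro tendsto_add char_remainder_limit lim_S[OF _ e_le]) auto
  qed
  have inv0: "(\<lambda>n. 1 / real (Suc n)) \<longlonglongrightarrow> 0" by real_asymp
  have "(\<lambda>n. char (\<nu> n) l) \<longlonglongrightarrow> char \<mu> l" for l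
  proof -
    have "(\<lambda>n. exp (\<i> * of_real (l * B) + (CLINT x|G n. iexp (l * x) - 1 - \<i> * of_real (l * x)))) \<longlonglongrightarrow> char \<mu> l"
      unfolding char using tendsto_exp[OF tendsto_add[OF tendsto_const e_lim[of l]], of "\<i> * of_real (l * B)"]
      by (simp add: algebra_simps)
    moreover have "(\<lambda>n. char (\<nu> n) l - exp (\<i> * of_real (l * B) + (CLINT x|G n. iexp (l * x) - 1 - \<i> * of_real (l * x)))) \<longlonglongrightarrow> 0"
      by (rule Lim_null_comparison[OF _ inv0]) (use \<nu>_char in auto)
    ultimately show ?thesis using tendsto_add by fastforce
  qed
  then have wc: "weak_conv_m \<nu> \<mu>" by (intro levy_continuity \<nu> \<mu>)
  let ?L = "exp (- a * B + a\<^sup>2 / 2 * C + (LINT x|F. exp (- a * x) - 1 + a * x))"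
  \<comment> \<open>Both bounds on the moment of order \<open>a\<close> carry the exponent of
    \<open>G n\<close>, which converges by \<open>f_lim\<close>, and the gap 1/(n+1)
    vanishes.\<close>
  have L_lim: "(\<lambda>n. LINT x|\<nu> n. exp (- a * x)) \<longlonglongrightarrow> ?L"
  proof (rule tendsto_sandwich[OF always_eventually always_eventually])
    have e: "(\<lambda>n. - a * B + (LINT x|G n. exp (- a * x) - 1 + a * x)) \<longlonglongrightarrow>
        - a * B + ((LINT x|F. exp (- a * x) - 1 + a * x) + a\<^sup>2 / 2 * C)"
      using a by (intro tendsto_add tendsto_const f_lim) auto
    show "(\<lambda>n. exp (- a * B + (LINT x|G n. exp (- a * x) - 1 + a * x) - 1 / real (Suc n))) \<longlonglongrightarrow> ?L"
      using tendsto_exp[OF tendsto_diff[OF e inv0]] by (simp add: algebra_simps)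
    show "(\<lambda>n. exp (- a * B + (LINT x|G n. exp (- a * x) - 1 + a * x))) \<longlonglongrightarrow> ?L"
      using tendsto_exp[OF e] by (simp add: algebra_simps)
  qed (use \<nu>_lower \<nu>_upper in auto)
  \<comment> \<open>The bounds on the moments of order \<open>a'\<close> converge, so a single
    constant \<open>D\<close> bounds them all.\<close>
  have "convergent (\<lambda>n. exp (- a' * B + (LINT x|G n. exp (- a' * x) - 1 + a' * x)))"
    unfolding convergent_def
    using tendsto_exp[OF tendsto_add[OF tendsto_const f_lim[of a']], of "- a' * B"] a by auto
  then have "Bseq (\<lambda>n. exp (- a' * B + (LINT x|G n. exp (- a' * x) - 1 + a' * x)))"
    by (rule convergent_imp_Bseq)
  then obtain D where D: "\<And>n. norm (exp (- a' * B + (LINT x|G n. exp (- a' * x) - 1 + a' * x))) \<le> D" "D > 0"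
    unfolding Bseq_def by blast
  have "(\<integral>\<^sup>+x. ennreal (exp (- a' * x)) \<partial>\<nu> n) \<le> ennreal D" for n
    using \<nu>_a'[of n] D(1)[of n] by (auto intro: order.trans ennreal_leI)
  note wm = weak_conv_exp_moment[OF \<nu> \<mu> wc a _ this L_lim]
  show "integrable \<mu> (\<lambda>x. exp (- a * x))" using D(2) by (intro wm) simp
  show "(LINT x|\<mu>. exp (- a * x)) = ?L" using D(2) by (intro wm) simp
qed

section \<open>The jump measure integrated over time\<close>

context pii_semimartingale
begin

abbreviation punctured :: "real measure" where
  "punctured \<equiv> restrict_space borel (- {0})"

abbreviation timeline :: "real \<Rightarrow> real measure" where
  "timeline t \<equiv> restrict_space lborel {0..t}"

text \<open>Projection to the jump size of the compensator restricted to times up to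
  \<open>t\<close>. Each \<open>K s\<close> lives on the punctured line; testing it on
  \<open>A - {0}\<close> gives a measure on all Borel sets, as
  \<open>laplace_transform_of_char\<close> expects.\<close>

definition jump_mixture :: "real \<Rightarrow> real measure" where
  "jump_mixture t = measure_of UNIV (sets borel) (\<lambda>A. \<integral>\<^sup>+s. emeasure (K s) (A - {0}) \<partial>timeline t)"

lemma sets_jump_mixture [simp, measurable_cong]: "sets (jump_mixture t) = sets borel"
  unfolding jump_mixture_def by (simp add: sets.sigma_sets_eq[of borel, simplified])

lemma space_jump_mixture [simp]: "space (jump_mixture t) = UNIV"
  using sets_eq_imp_space_eq[OF sets_jump_mixture[of t]] by simp

lemma space_K: "s \<ge> 0 \<Longrightarrow> space (K s) = - {0}"
  using sets_eq_imp_space_eq[OF sets_K[of s]] by (simp add: space_restrict_space)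

lemma borel_measurable_K: "s \<ge> 0 \<Longrightarrow> f \<in> borel_measurable borel \<Longrightarrow> f \<in> borel_measurable (K s)"
  unfolding measurable_cong_sets[OF sets_K refl] by (rule measurable_restrict_space1)

lemma Diff_zero_in_punctured: "A \<in> sets borel \<Longrightarrow> A - {0} \<in> sets punctured"
  by (auto simp: sets_restrict_space image_iff intro!: bexI[of _ A])

lemma timeline_measurable:
  assumes "f \<in> borel_measurable (restrict_space borel {0..})"
  shows "f \<in> borel_measurable (timeline t)"
proof -
  have "f \<in> borel_measurable (restrict_space borel {0..t})"
    using assms by (rule measurable_restrict_mono) auto
  moreover have "sets (timeline t) = sets (restrict_space borel {0..t})"
    by (simp add: sets_restrict_space)
  ultimately show ?thesis unfolding measurable_cong_sets[OF \<open>sets (timeline t) = _\<close> refl] by simp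
qed

lemma emeasure_K_measurable:
  "A \<in> sets borel \<Longrightarrow> (\<lambda>s. emeasure (K s) (A - {0})) \<in> borel_measurable (timeline t)"
  by (intro timeline_measurable kernel_K Diff_zero_in_punctured)

lemma space_timeline [simp]: "space (timeline t) = {0..t}"
  by (simp add: space_restrict_space)

lemma emeasure_jump_mixture:
  assumes "A \<in> sets borel"
  shows "emeasure (jump_mixture t) A = (\<integral>\<^sup>+s. emeasure (K s) (A - {0}) \<partial>timeline t)"
proof (rule emeasure_measure_of[OF jump_mixture_def])
  show "countably_additive (sets (jump_mixture t)) (\<lambda>A. \<integral>\<^sup>+s. emeasure (K s) (A - {0}) \<partial>timeline t)"
  proof (rule countably_additiveI)
    fix A :: "nat \<Rightarrow> real set"
    assume A: "range A \<subseteq> sets (jump_mixture t)" "disjoint_family A"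
    then have A': "A i \<in> sets borel" for i by auto
    have "(\<Sum>i. \<integral>\<^sup>+s. emeasure (K s) (A i - {0}) \<partial>timeline t) = (\<integral>\<^sup>+s. (\<Sum>i. emeasure (K s) (A i - {0})) \<partial>timeline t)"
      by (intro nn_integral_suminf[symmetric] emeasure_K_measurable A')
    also have "\<dots> = (\<integral>\<^sup>+s. emeasure (K s) (\<Union>(range A) - {0}) \<partial>timeline t)"
    proof (intro nn_integral_cong)
      fix s assume "s \<in> space (timeline t)"
      then have s: "0 \<le> s" by simp
      have "(\<Sum>i. emeasure (K s) (A i - {0})) = emeasure (K s) (\<Union>i. A i - {0})"
        using A s Diff_zero_in_punctured[OF A']
        by (intro suminf_emeasure) (auto simp: sets_K disjoint_family_on_def)
      then show "(\<Sum>i. emeasure (K s) (A i - {0})) = emeasure (K s) (\<Union>(range A) - {0})"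
        by (simp only: UN_extend_simps)
    qed
    finally show "(\<Sum>i. \<integral>\<^sup>+s. emeasure (K s) (A i - {0}) \<partial>timeline t) = (\<integral>\<^sup>+s. emeasure (K s) (\<Union>(range A) - {0}) \<partial>timeline t)" .
  qed
qed (use assms in \<open>auto simp: positive_def\<close>)

text \<open>Measurability in \<open>s\<close> and the value are proved in one induction on
  \<open>f\<close>, because the steps for the value use the measurability.\<close>

lemma nn_integral_jump_mixture:
  assumes f: "f \<in> borel_measurable borel"
  shows "(\<lambda>s. \<integral>\<^sup>+x. f x \<partial>K s) \<in> borel_measurable (timeline t)"
    and "(\<integral>\<^sup>+x. f x \<partial>jump_mixture t) = (\<integral>\<^sup>+s. \<integral>\<^sup>+x. f x \<partial>K s \<partial>timeline t)"
proof -
  \<comment> \<open>The formulas for \<open>K s\<close> hold only for \<open>s\<close> in the time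
    interval, so \<open>core\<close> transports measurability and integral from a function that
    agrees there.\<close>
  have core: "F \<in> borel_measurable (timeline t) \<and> I = integral\<^sup>N (timeline t) F"
    if "\<And>s. s \<in> space (timeline t) \<Longrightarrow> F s = G s" "G \<in> borel_measurable (timeline t)" "I = integral\<^sup>N (timeline t) G"
    for F G :: "real \<Rightarrow> ennreal" and I
    using measurable_cong[of "timeline t" F G borel] nn_integral_cong[of "timeline t" F G] that by auto
  have "(\<lambda>s. \<integral>\<^sup>+x. f x \<partial>K s) \<in> borel_measurable (timeline t) \<and>
    (\<integral>\<^sup>+x. f x \<partial>jump_mixture t) = (\<integral>\<^sup>+s. \<integral>\<^sup>+x. f x \<partial>K s \<partial>timeline t)"
    using f
  proof (induction rule: borel_measurable_induct)
    case (cong f g)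
    then have "f = g" by auto
    with cong show ?case by simp
  next
    case (set A)
    have "(\<integral>\<^sup>+x. indicator A x \<partial>K s) = emeasure (K s) (A - {0})" if "s \<in> space (timeline t)" for s
    proof -
      have s: "s \<ge> 0" using that by simp
      have "(\<integral>\<^sup>+x. indicator A x \<partial>K s) = (\<integral>\<^sup>+x. indicator (A - {0}) x \<partial>K s)"
        by (intro nn_integral_cong) (auto simp: space_K[OF s] indicator_def)
      then show ?thesis using Diff_zero_in_punctured[OF set] sets_K[OF s] by simp
    qed
    then show ?case
      using set emeasure_K_measurable[OF set]
      by (intro core[OF _ emeasure_K_measurable[OF set]]) (auto simp: emeasure_jump_mixture)
  next
    case (mult u c)
    then have *: "(\<integral>\<^sup>+x. c * u x \<partial>K s) = c * (\<integral>\<^sup>+x. u x \<partial>K s)" if "s \<in> space (timeline t)" for s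
      using that by (intro nn_integral_cmult borel_measurable_K) auto
    from mult show ?case
      by (intro core[OF *]) (auto simp: nn_integral_cmult)
  next
    case (add u v)
    then have *: "(\<integral>\<^sup>+x. u x + v x \<partial>K s) = (\<integral>\<^sup>+x. u x \<partial>K s) + (\<integral>\<^sup>+x. v x \<partial>K s)" if "s \<in> space (timeline t)" for s
      using that by (intro nn_integral_add borel_measurable_K) auto
    from add show ?case
      by (intro core) (auto simp: * nn_integral_add add.commute)
  next
    case (seq U)
    have *: "(\<integral>\<^sup>+x. (SUP i. U i) x \<partial>K s) = (SUP i. \<integral>\<^sup>+x. U i x \<partial>K s)" if "s \<in> space (timeline t)" for s
      unfolding SUP_apply using that seq
      by (intro nn_integral_monotone_convergence_SUP borel_measurable_K) auto
    have inc: "incseq (\<lambda>i s. \<integral>\<^sup>+x. U i x \<partial>K s)"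
      using seq by (auto simp: incseq_def le_fun_def intro!: nn_integral_mono)
    have "(\<integral>\<^sup>+x. (SUP i. U i) x \<partial>jump_mixture t) = (SUP i. \<integral>\<^sup>+x. U i x \<partial>jump_mixture t)"
      unfolding SUP_apply using seq by (intro nn_integral_monotone_convergence_SUP) auto
    also have "\<dots> = (SUP i. \<integral>\<^sup>+s. \<integral>\<^sup>+x. U i x \<partial>K s \<partial>timeline t)"
      using seq by simp
    also have "\<dots> = (\<integral>\<^sup>+s. (SUP i. \<integral>\<^sup>+x. U i x \<partial>K s) \<partial>timeline t)"
      using seq by (intro nn_integral_monotone_convergence_SUP[symmetric] inc) auto
    finally have 1: "(\<integral>\<^sup>+x. (SUP i. U i) x \<partial>jump_mixture t) = (\<integral>\<^sup>+s. (SUP i. \<integral>\<^sup>+x. U i x \<partial>K s) \<partial>timeline t)" .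
    have "(\<lambda>s. SUP i. \<integral>\<^sup>+x. U i x \<partial>K s) \<in> borel_measurable (timeline t)"
      using seq by (intro borel_measurable_SUP) auto
    then show ?case unfolding \<open>f = _\<close> by (intro core[OF * _ 1])
  qed
  then show "(\<lambda>s. \<integral>\<^sup>+x. f x \<partial>K s) \<in> borel_measurable (timeline t)"
    and "(\<integral>\<^sup>+x. f x \<partial>jump_mixture t) = (\<integral>\<^sup>+s. \<integral>\<^sup>+x. f x \<partial>K s \<partial>timeline t)" by auto
qed

text \<open>Positive and negative parts have finite integrals under the mixture, so each is covered
  by the nonnegative version and is finite under \<open>K s\<close> for almost every
  \<open>s\<close>.\<close>

lemma has_bochner_integral_jump_mixture_real:
  fixes f :: "real \<Rightarrow> real"
  assumes f [measurable]: "f \<in> borel_measurable borel" and i: "integrable (jump_mixture t) f"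
  shows "has_bochner_integral (timeline t) (\<lambda>s. LINT x|K s. f x) (LINT x|jump_mixture t. f x)"
proof -
  define p where "p = (\<lambda>s. \<integral>\<^sup>+x. ennreal (f x) \<partial>K s)"
  define n where "n = (\<lambda>s. \<integral>\<^sup>+x. ennreal (- f x) \<partial>K s)"
  have [measurable]: "p \<in> borel_measurable (timeline t)" "n \<in> borel_measurable (timeline t)"
    unfolding p_def n_def by (intro nn_integral_jump_mixture; simp)+
  have ip: "integral\<^sup>N (timeline t) p = (\<integral>\<^sup>+x. ennreal (f x) \<partial>jump_mixture t)"
    and "in": "integral\<^sup>N (timeline t) n = (\<integral>\<^sup>+x. ennreal (- f x) \<partial>jump_mixture t)"
    unfolding p_def n_def by (subst nn_integral_jump_mixture(2); simp)+
  have fp: "integral\<^sup>N (timeline t) p \<noteq> \<infinity>" and fn: "integral\<^sup>N (timeline t) n \<noteq> \<infinity>"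
    using i unfolding real_integrable_def ip "in" by auto
  have ap: "AE s in timeline t. p s \<noteq> \<infinity>" and an: "AE s in timeline t. n s \<noteq> \<infinity>"
    using fp fn by (intro nn_integral_PInf_AE; simp)+
  \<comment> \<open>The Bochner integral is 0 when \<open>f\<close> is not integrable under
    \<open>K s\<close>; this case is spelled out to get measurability in \<open>s\<close>. It occurs
    only on a null set of times.\<close>
  have eq: "(LINT x|K s. f x) = (if p s \<noteq> \<infinity> \<and> n s \<noteq> \<infinity> then enn2real (p s) - enn2real (n s) else 0)"
    if "s \<in> space (timeline t)" for s
  proof (cases "integrable (K s) f")
    case True
    then show ?thesis by (auto simp: real_lebesgue_integral_def real_integrable_def p_def n_def)
  next
    case False
    have "f \<in> borel_measurable (K s)" using that by (intro borel_measurable_K) auto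
    with False have "\<not> (p s \<noteq> \<infinity> \<and> n s \<noteq> \<infinity>)"
      by (auto simp: real_integrable_def p_def n_def)
    with False show ?thesis by (auto simp: not_integrable_integral_eq)
  qed
  have m: "(\<lambda>s. LINT x|K s. f x) \<in> borel_measurable (timeline t)"
    by (subst measurable_cong[OF eq]) (auto simp del: infinity_ennreal_def)
  have h: "has_bochner_integral (timeline t) (\<lambda>s. enn2real (q s)) (enn2real (integral\<^sup>N (timeline t) q))"
    if [measurable]: "q \<in> borel_measurable (timeline t)" and "integral\<^sup>N (timeline t) q \<noteq> \<infinity>" "AE s in timeline t. q s \<noteq> \<infinity>" for q
  proof (rule has_bochner_integral_nn_integral)
    show "(\<integral>\<^sup>+s. ennreal (enn2real (q s)) \<partial>timeline t) = ennreal (enn2real (integral\<^sup>N (timeline t) q))"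
      using that(2,3) by (auto intro!: nn_integral_cong_AE simp: less_top)
  qed auto
  have "has_bochner_integral (timeline t) (\<lambda>s. enn2real (p s) - enn2real (n s))
      (enn2real (integral\<^sup>N (timeline t) p) - enn2real (integral\<^sup>N (timeline t) n))"
    by (intro has_bochner_integral_diff h fp fn ap an) auto
  also have "enn2real (integral\<^sup>N (timeline t) p) - enn2real (integral\<^sup>N (timeline t) n) = (LINT x|jump_mixture t. f x)"
    using i by (simp add: real_lebesgue_integral_def ip "in")
  finally show ?thesis
  proof (subst has_bochner_integral_cong_AE)
    show "AE s in timeline t. (LINT x|K s. f x) = enn2real (p s) - enn2real (n s)"
      using ap an AE_space by eventually_elim (simp add: eq)
  qed (use m in auto)
qed

lemma has_bochner_integral_jump_mixture_complex:
  fixes f :: "real \<Rightarrow> complex"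
  assumes f [measurable]: "f \<in> borel_measurable borel" and i: "integrable (jump_mixture t) f"
  shows "has_bochner_integral (timeline t) (\<lambda>s. CLINT x|K s. f x) (CLINT x|jump_mixture t. f x)"
proof -
  define N where "N = (\<lambda>s. \<integral>\<^sup>+x. ennreal (norm (f x)) \<partial>K s)"
  have [measurable]: "N \<in> borel_measurable (timeline t)"
    unfolding N_def by (intro nn_integral_jump_mixture) simp
  have "integral\<^sup>N (timeline t) N = (\<integral>\<^sup>+x. ennreal (norm (f x)) \<partial>jump_mixture t)"
    unfolding N_def by (subst nn_integral_jump_mixture(2)) simp_all
  then have "integral\<^sup>N (timeline t) N \<noteq> \<infinity>" using i by (auto simp: integrable_iff_bounded)
  then have aN: "AE s in timeline t. N s \<noteq> \<infinity>" by (intro nn_integral_PInf_AE) simp_all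
  note re = has_bochner_integral_jump_mixture_real[of "\<lambda>x. Re (f x)", OF _ integrable_Re[OF i]]
  note im = has_bochner_integral_jump_mixture_real[of "\<lambda>x. Im (f x)", OF _ integrable_Im[OF i]]
  \<comment> \<open>As in the real case, the default value 0 covers the times at which the norm has
    infinite integral.\<close>
  have eq: "(CLINT x|K s. f x) = (if N s \<noteq> \<infinity> then of_real (LINT x|K s. Re (f x)) + \<i> * of_real (LINT x|K s. Im (f x)) else 0)"
    if "s \<in> space (timeline t)" for s
  proof -
    have "f \<in> borel_measurable (K s)" using that by (intro borel_measurable_K) auto
    then have "integrable (K s) f \<longleftrightarrow> N s \<noteq> \<infinity>"
      by (auto simp: integrable_iff_bounded N_def less_top)
    then show ?thesis
      by (auto simp: complex_eq_iff integral_Re integral_Im not_integrable_integral_eq)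
  qed
  have [measurable]: "(\<lambda>s. LINT x|K s. Re (f x)) \<in> borel_measurable (timeline t)"
     "(\<lambda>s. LINT x|K s. Im (f x)) \<in> borel_measurable (timeline t)"
    using re im by (auto simp: has_bochner_integral_iff)
  have m: "(\<lambda>s. CLINT x|K s. f x) \<in> borel_measurable (timeline t)"
    by (subst measurable_cong[OF eq]) (auto simp del: infinity_ennreal_def)
  have "has_bochner_integral (timeline t) (\<lambda>s. of_real (LINT x|K s. Re (f x)) + \<i> * of_real (LINT x|K s. Im (f x)))
     (of_real (LINT x|jump_mixture t. Re (f x)) + \<i> * of_real (LINT x|jump_mixture t. Im (f x)))"
    using re im by (intro has_bochner_integral_add has_bochner_integral_mult_right has_bochner_integral_of_real) auto
  also have "of_real (LINT x|jump_mixture t. Re (f x)) + \<i> * of_real (LINT x|jump_mixture t. Im (f x)) = (CLINT x|jump_mixture t. f x)"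
    using i by (simp add: complex_eq_iff integral_Re integral_Im)
  finally show ?thesis
  proof (subst has_bochner_integral_cong_AE)
    show "AE s in timeline t. (CLINT x|K s. f x) = of_real (LINT x|K s. Re (f x)) + \<i> * of_real (LINT x|K s. Im (f x))"
      using aN AE_space by eventually_elim (simp add: eq)
  qed (use m in auto)
qed

end

section \<open>Right-continuous paths with left limits\<close>

text \<open>One-sided limits bound \<open>f\<close> near each point; Bolzano's bisection makes this
  global.\<close>

lemma cadlag_bounded:
  assumes f: "cadlag f" and t: "t \<ge> 0"
  shows "\<exists>B. \<forall>x\<in>{0..t}. \<bar>f x\<bar> \<le> B"
proof -
  define P where "P = (\<lambda>u v. 0 \<le> u \<longrightarrow> v \<le> t \<longrightarrow> (\<exists>B. \<forall>x\<in>{u..v}. \<bar>f x\<bar> \<le> B))"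
  have "P 0 t"
    using t
  proof (induction rule: Bolzano)
    case (trans a b c)
    show ?case
      unfolding P_def
    proof (intro impI)
      assume "0 \<le> a" "c \<le> t"
      with trans obtain B C where "\<forall>x\<in>{a..b}. \<bar>f x\<bar> \<le> B" "\<forall>x\<in>{b..c}. \<bar>f x\<bar> \<le> C" unfolding P_def by auto
      then show "\<exists>B. \<forall>x\<in>{a..c}. \<bar>f x\<bar> \<le> B"
        by (intro exI[of _ "max B C"]) (metis atLeastAtMost_iff le_max_iff_disj linear)
    qed
  next
    case (local x)
    have bdd: "\<exists>B. eventually (\<lambda>y. \<bar>f y\<bar> \<le> B) F" if "(f \<longlongrightarrow> l) F" for l and F :: "real filter"
      using tendstoD[OF that, of 1] by (intro exI[of _ "\<bar>l\<bar> + 1"]) (auto elim!: eventually_mono simp: dist_real_def)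
    obtain B1 where B1: "eventually (\<lambda>y. \<bar>f y\<bar> \<le> B1) (at_right x)"
      using f local bdd unfolding cadlag_def by blast
    then obtain d1 where d1: "d1 > x" "\<And>y. x < y \<Longrightarrow> y < d1 \<Longrightarrow> \<bar>f y\<bar> \<le> B1"
      unfolding eventually_at_right_field by blast
    \<comment> \<open>At x = 0 the definition provides no left limit; the condition
      \<open>0 \<le> y\<close> leaves the left neighbourhood empty there.\<close>
    obtain d2 B2 where d2: "d2 < x" "\<And>y. 0 \<le> y \<Longrightarrow> d2 < y \<Longrightarrow> y < x \<Longrightarrow> \<bar>f y\<bar> \<le> B2"
    proof (cases "x = 0")
      case True
      then show ?thesis by (intro that[of "-1" 0]) auto
    next
      case False
      then obtain B2 where "eventually (\<lambda>y. \<bar>f y\<bar> \<le> B2) (at_left x)"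
        using f local bdd unfolding cadlag_def by (metis less_eq_real_def)
      then show ?thesis using that unfolding eventually_at_left_field by blast
    qed
    show ?case
      unfolding P_def
    proof (rule exI[of _ "min (d1 - x) (x - d2)"], intro conjI allI impI)
      show "0 < min (d1 - x) (x - d2)" using d1 d2 by simp
      fix a b assume ab: "a \<le> x \<and> x \<le> b \<and> b - a < min (d1 - x) (x - d2)" "0 \<le> a" "b \<le> t"
      show "\<exists>B. \<forall>x\<in>{a..b}. \<bar>f x\<bar> \<le> B"
      proof (intro exI[of _ "\<bar>f x\<bar> + \<bar>B1\<bar> + \<bar>B2\<bar>"] ballI)
        fix y assume "y \<in> {a..b}"
        then consider "y = x" | "x < y" "y < d1" | "0 \<le> y" "d2 < y" "y < x" using ab by fastforce
        then show "\<bar>f y\<bar> \<le> \<bar>f x\<bar> + \<bar>B1\<bar> + \<bar>B2\<bar>"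
        proof cases
          case 2
          then show ?thesis using d1(2)[of y] by linarith
        next
          case 3
          then show ?thesis using d2(2)[of y] by linarith
        qed simp
      qed
    qed
  qed
  then show ?thesis by (simp add: P_def)
qed

section \<open>Grid approximation of paths and Riemann sums\<close>

text \<open>The first point of the grid u + \<Delta> Z strictly to the right of \<open>s\<close>,
  also when \<open>s\<close> is itself on the grid. Strictness lets right limits, which exclude the
  point itself, be applied.\<close>

definition grid_right :: "real \<Rightarrow> real \<Rightarrow> real \<Rightarrow> real" where
  "grid_right u \<Delta> s = u + (of_int \<lfloor>(s - u) / \<Delta>\<rfloor> + 1) * \<Delta>"

lemma grid_right_bounds:
  assumes "\<Delta> > 0"
  shows "s < grid_right u \<Delta> s" "grid_right u \<Delta> s \<le> s + \<Delta>"
proof -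
  have "(s - u) / \<Delta> < of_int \<lfloor>(s - u) / \<Delta>\<rfloor> + 1" "of_int \<lfloor>(s - u) / \<Delta>\<rfloor> \<le> (s - u) / \<Delta>" by linarith+
  then have "s - u < (of_int \<lfloor>(s - u) / \<Delta>\<rfloor> + 1) * \<Delta>" "of_int \<lfloor>(s - u) / \<Delta>\<rfloor> * \<Delta> \<le> s - u"
    using assms by (simp_all only: pos_divide_less_eq pos_le_divide_eq)
  then show "s < grid_right u \<Delta> s" "grid_right u \<Delta> s \<le> s + \<Delta>"
    by (simp_all add: grid_right_def algebra_simps)
qed

lemma grid_right_eq:
  assumes "\<Delta> > 0" "u + real i * \<Delta> \<le> s" "s < u + real (Suc i) * \<Delta>"
  shows "grid_right u \<Delta> s = u + real (Suc i) * \<Delta>"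
proof -
  have "\<lfloor>(s - u) / \<Delta>\<rfloor> = int i"
    using assms by (intro floor_unique) (auto simp: field_simps)
  then show ?thesis by (simp add: grid_right_def)
qed

lemma cadlag_grid_right:
  assumes f: "cadlag f" and s: "0 \<le> s" and \<Delta>: "\<And>n. \<Delta> n > 0" "\<Delta> \<longlonglongrightarrow> 0"
  shows "(\<lambda>n. f (grid_right u (\<Delta> n) s)) \<longlonglongrightarrow> f s"
proof -
  have "(\<lambda>n. grid_right u (\<Delta> n) s) \<longlonglongrightarrow> s"
  proof (rule tendsto_sandwich[OF always_eventually always_eventually])
    show "(\<lambda>n. s) \<longlonglongrightarrow> s" by simp
    show "(\<lambda>n. s + \<Delta> n) \<longlonglongrightarrow> s" using tendsto_add[OF tendsto_const \<Delta>(2), of s] by simp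
  qed (use grid_right_bounds[OF \<Delta>(1)] in \<open>auto intro: less_imp_le\<close>)
  then have "filterlim (\<lambda>n. grid_right u (\<Delta> n) s) (at_right s) sequentially"
    using grid_right_bounds(1)[OF \<Delta>(1), of s u] unfolding filterlim_at
    by (auto intro!: always_eventually simp: less_imp_neq[symmetric] less_le)
  moreover have "(f \<longlongrightarrow> f s) (at_right s)" using f s by (simp add: cadlag_def)
  ultimately show ?thesis by (rule filterlim_compose[rotated])
qed

lemma borel_measurable_comp_grid_right: "(\<lambda>s. f (grid_right u \<Delta> s)) \<in> borel_measurable borel"
  unfolding grid_right_def
  by (rule measurable_compose_countable[where f="\<lambda>i _. f (u + (of_int i + 1) * \<Delta>)" and g="\<lambda>s. \<lfloor>(s - u) / \<Delta>\<rfloor>"])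
     simp_all

text \<open>Limit of the path along ever finer grids, each approximation taking countably many
  values. \<open>max 0 s\<close> freezes the path at negative times, which lie outside the
  definition of \<open>cadlag\<close>.\<close>

lemma borel_measurable_cadlag:
  assumes f: "cadlag f"
  shows "(\<lambda>s. f (max 0 s)) \<in> borel_measurable borel"
proof (rule borel_measurable_LIMSEQ_real)
  show "(\<lambda>n. f (grid_right 0 (1 / real (Suc n)) (max 0 s))) \<longlonglongrightarrow> f (max 0 s)" for s
    by (rule cadlag_grid_right[OF f]) (simp, simp, real_asymp)
  show "(\<lambda>s. f (grid_right 0 (1 / real (Suc n)) (max 0 s))) \<in> borel_measurable borel" for n
    using measurable_compose[OF _ borel_measurable_comp_grid_right[of f 0 "1 / real (Suc n)"], of "\<lambda>s. max 0 s"] by simp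
qed

lemma set_integrable_cadlag:
  assumes f: "cadlag f" and "0 \<le> u"
  shows "set_integrable lborel {u..t} f"
proof (cases "u \<le> t")
  case True
  obtain B where B: "\<forall>x\<in>{0..t}. \<bar>f x\<bar> \<le> B" using cadlag_bounded[OF f, of t] True assms by auto
  have [measurable]: "(\<lambda>s. f (max 0 s)) \<in> borel_measurable borel" by (rule borel_measurable_cadlag[OF f])
  have "set_integrable lborel {u..t} (\<lambda>s. f (max 0 s))"
    unfolding set_integrable_def
    by (rule integrableI_bounded_set_indicator[where B=B]) (use B assms in \<open>auto intro!: AE_I2 simp: emeasure_lborel_Icc_eq\<close>)
  moreover have "set_integrable lborel {u..t} (\<lambda>s. f (max 0 s)) = set_integrable lborel {u..t} f"
    using assms by (intro set_integrable_cong) auto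
  ultimately show ?thesis by simp
qed (simp add: set_integrable_def)

text \<open>Half-open intervals, since \<open>grid_right\<close> is constant on cells closed on the
  left and moves to the next point at the right end of a cell.\<close>

lemma grid_sum_eq_integral:
  assumes \<Delta>: "\<Delta> > 0"
  shows "set_integrable lborel {u..<u + real n * \<Delta>} (\<lambda>s. f (grid_right u \<Delta> s)) \<and>
    (LINT s:{u..<u + real n * \<Delta>}|lborel. f (grid_right u \<Delta> s)) = (\<Sum>i<n. \<Delta> * (f (u + real (Suc i) * \<Delta>) :: real))"
proof (induction n)
  case 0
  show ?case by (simp add: set_integrable_def set_lebesgue_integral_def)
next
  case (Suc n)
  let ?A = "{u..<u + real n * \<Delta>}" and ?B = "{u + real n * \<Delta>..<u + real (Suc n) * \<Delta>}"
  let ?c = "f (u + real (Suc n) * \<Delta>)"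
  have AB: "{u..<u + real (Suc n) * \<Delta>} = ?A \<union> ?B" "?A \<inter> ?B = {}"
  proof -
    define k where "k = real n * \<Delta>"
    have "0 \<le> k" using \<Delta> by (simp add: k_def)
    moreover have "real (Suc n) * \<Delta> = k + \<Delta>" by (simp add: k_def algebra_simps)
    ultimately show "{u..<u + real (Suc n) * \<Delta>} = ?A \<union> ?B" "?A \<inter> ?B = {}"
      unfolding k_def[symmetric] using \<Delta> by auto
  qed
  have "set_integrable lborel ?B (\<lambda>s. f (grid_right u \<Delta> s)) = set_integrable lborel ?B (\<lambda>s. ?c)"
    using grid_right_eq[OF \<Delta>] by (intro set_integrable_cong) auto
  moreover have "integrable lborel (indicat_real ?B)"
    using \<Delta> by (simp add: integrable_indicator_iff)
  ultimately have iB: "set_integrable lborel ?B (\<lambda>s. f (grid_right u \<Delta> s))"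
    by (simp add: set_integrable_def)
  have "(LINT s:?B|lborel. f (grid_right u \<Delta> s)) = (LINT s:?B|lborel. ?c)"
    using grid_right_eq[OF \<Delta>] by (intro set_lebesgue_integral_cong) auto
  also have "\<dots> = \<Delta> * ?c"
    using \<Delta> by (simp add: set_lebesgue_integral_def algebra_simps)
  finally have "(LINT s:?B|lborel. f (grid_right u \<Delta> s)) = \<Delta> * ?c" .
  with Suc iB show ?case
    unfolding AB(1) set_integral_Un[OF AB(2) conjunct1[OF Suc] iB]
    by (simp add: set_integrable_Un)
qed

text \<open>The sums are integrals of \<open>f\<close> along \<open>grid_right\<close>, so right
  continuity and the bound on the path give the limit by dominated convergence.\<close>

lemma riemann_sums_cadlag:
  assumes f: "cadlag f" and u: "0 \<le> u" "u < t"
  defines "\<Delta> \<equiv> \<lambda>n. (t - u) / real (Suc n)"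
  shows "(\<lambda>n. \<Sum>i<Suc n. \<Delta> n * f (u + real (Suc i) * \<Delta> n)) \<longlonglongrightarrow> (LINT s:{u..t}|lborel. f s)"
proof -
  have \<Delta>: "\<Delta> n > 0" "u + real (Suc n) * \<Delta> n = t" for n using u by (auto simp: \<Delta>_def)
  have \<Delta>0: "\<Delta> \<longlonglongrightarrow> 0" unfolding \<Delta>_def by real_asymp
  obtain B where B: "\<forall>x\<in>{0..t}. \<bar>f x\<bar> \<le> B" using cadlag_bounded[OF f, of t] u by auto
  have [measurable]: "(\<lambda>s. f (max 0 s)) \<in> borel_measurable borel" by (rule borel_measurable_cadlag[OF f])
  \<comment> \<open>\<open>t\<close> is the grid point with index n + 1, so for s < t the next grid
    point does not pass \<open>t\<close>, and the bound \<open>B\<close> on \<open>{0..t}\<close>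
    applies.\<close>
  have le_t: "grid_right u (\<Delta> n) s \<le> t" if "u \<le> s" "s < t" for n s
  proof -
    have "(s - u) / \<Delta> n < real (Suc n)" using that \<Delta>[of n] by (simp add: field_simps)
    then have "\<lfloor>(s - u) / \<Delta> n\<rfloor> < int (Suc n)" by (simp add: floor_less_iff)
    then have "\<lfloor>(s - u) / \<Delta> n\<rfloor> + 1 \<le> int (Suc n)" by simp
    then have "real_of_int (\<lfloor>(s - u) / \<Delta> n\<rfloor> + 1) \<le> real (Suc n)" by linarith
    then have "real_of_int (\<lfloor>(s - u) / \<Delta> n\<rfloor> + 1) * \<Delta> n \<le> real (Suc n) * \<Delta> n"
      using \<Delta>(1)[of n] by (intro mult_right_mono) auto
    then show ?thesis using \<Delta>(2)[of n] by (simp add: grid_right_def)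
  qed
  have "(\<lambda>n. LINT s:{u..<t}|lborel. f (grid_right u (\<Delta> n) s)) \<longlonglongrightarrow> (LINT s:{u..<t}|lborel. f s)"
    unfolding set_lebesgue_integral_def
  proof (rule integral_dominated_convergence[where w="\<lambda>s. indicator {u..<t} s * B"])
    show "(\<lambda>s. indicator {u..<t} s *\<^sub>R f s) \<in> borel_measurable lborel"
    proof -
      have "(\<lambda>s. indicator {u..<t} s *\<^sub>R f s) = (\<lambda>s. indicator {u..<t} s *\<^sub>R f (max 0 s))"
        using u by (auto simp: indicator_def fun_eq_iff)
      then show ?thesis by simp
    qed
    show "(\<lambda>s. indicator {u..<t} s *\<^sub>R f (grid_right u (\<Delta> n) s)) \<in> borel_measurable lborel" for n
      using borel_measurable_comp_grid_right[of f u "\<Delta> n"] by simp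
    show "integrable lborel (\<lambda>s. indicator {u..<t} s * B)"
      using u by (simp add: integrable_indicator_iff)
    show "AE s in lborel. (\<lambda>n. indicator {u..<t} s *\<^sub>R f (grid_right u (\<Delta> n) s)) \<longlonglongrightarrow> indicator {u..<t} s *\<^sub>R f s"
      using u cadlag_grid_right[OF f _ \<Delta>(1) \<Delta>0] by (intro AE_I2) (auto simp: indicator_def)
    show "AE s in lborel. norm (indicator {u..<t} s *\<^sub>R f (grid_right u (\<Delta> n) s)) \<le> indicator {u..<t} s * B" for n
    proof (intro AE_I2)
      fix s
      show "norm (indicator {u..<t} s *\<^sub>R f (grid_right u (\<Delta> n) s)) \<le> indicator {u..<t} s * B"
      proof (cases "s \<in> {u..<t}")
        case True
        then have "grid_right u (\<Delta> n) s \<in> {0..t}"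
          using le_t[of s n] grid_right_bounds(1)[OF \<Delta>(1), of s u n] u by auto
        then show ?thesis using B True by auto
      qed simp
    qed
  qed
  also have "(LINT s:{u..<t}|lborel. f s) = (LINT s:{u..t}|lborel. f s)"
    unfolding set_lebesgue_integral_def
  proof (rule integral_cong_AE)
    show "AE s in lborel. indicator {u..<t} s *\<^sub>R f s = indicator {u..t} s *\<^sub>R f s"
      using AE_lborel_singleton[of t] by eventually_elim (auto simp: indicator_def)
    have *: "(\<lambda>s. indicator A s *\<^sub>R f s) = (\<lambda>s. indicator A s *\<^sub>R f (max 0 s))" if "A \<subseteq> {u..t}" for A
      using u that by (auto simp: indicator_def fun_eq_iff)
    show "(\<lambda>s. indicator {u..<t} s *\<^sub>R f s) \<in> borel_measurable lborel"
      "(\<lambda>s. indicator {u..t} s *\<^sub>R f s) \<in> borel_measurable lborel"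
      by (subst *; auto)+
  qed
  finally have lim: "(\<lambda>n. LINT s:{u..<t}|lborel. f (grid_right u (\<Delta> n) s)) \<longlonglongrightarrow> (LINT s:{u..t}|lborel. f s)" .
  have sums: "(LINT s:{u..<t}|lborel. f (grid_right u (\<Delta> n) s)) = (\<Sum>i<Suc n. \<Delta> n * f (u + real (Suc i) * \<Delta> n))" for n
    by (rule conjunct2[OF grid_sum_eq_integral[OF \<Delta>(1)[of n], of u "Suc n" f], unfolded \<Delta>(2)])
  show ?thesis using lim by (simp only: sums)
qed

section \<open>Powers of integrals of a nonnegative function\<close>

text \<open>Convexity of the power, written with the tangents at both ends. The mean value theorem
  is applied for y > 0; at y = 0 the lower bound is trivial because \<open>0 powr (a - 1)\<close> is
  0 for every exponent.\<close>

lemma powr_tangent_bounds: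
  fixes x y a :: real
  assumes a: "a \<ge> 1" and y: "0 \<le> y" "y \<le> x"
  shows "a * y powr (a - 1) * (x - y) \<le> x powr a - y powr a"
    and "x powr a - y powr a \<le> a * x powr (a - 1) * (x - y)"
proof -
  have "a * y powr (a - 1) * (x - y) \<le> x powr a - y powr a \<and>
    x powr a - y powr a \<le> a * x powr (a - 1) * (x - y)"
  proof (cases "y = 0 \<or> y = x")
    case True
    have "x powr a = x powr (a - 1) * x" if "x \<noteq> 0"
      using that y powr_mult_base[of x "a - 1"] by (simp add: mult.commute)
    then have "x powr a = x powr (a - 1) * x" by (cases "x = 0") auto
    then have "x powr a \<le> a * x powr (a - 1) * x"
      using a y mult_right_mono[of 1 a "x powr (a - 1) * x"] by simp
    with True show ?thesis by auto
  next
    case False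
    then have "y < x" "0 < y" using y by auto
    from \<open>y < x\<close> have "\<exists>z>y. z < x \<and> x powr a - y powr a = (x - y) * (a * z powr (a - 1))"
      using \<open>0 < y\<close> by (intro MVT2) (auto intro!: derivative_eq_intros)
    then obtain z where z: "y < z" "z < x" "x powr a - y powr a = (x - y) * (a * z powr (a - 1))" by blast
    have "y powr (a - 1) \<le> z powr (a - 1)" "z powr (a - 1) \<le> x powr (a - 1)"
      using assms z by (auto intro!: powr_mono2)
    then have "(x - y) * (a * y powr (a - 1)) \<le> (x - y) * (a * z powr (a - 1))"
      "(x - y) * (a * z powr (a - 1)) \<le> (x - y) * (a * x powr (a - 1))"
      using assms by (intro mult_left_mono; simp)+
    then show ?thesis using z(3) by (simp add: mult_ac)
  qed
  then show "a * y powr (a - 1) * (x - y) \<le> x powr a - y powr a"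
    and "x powr a - y powr a \<le> a * x powr (a - 1) * (x - y)"
    by blast+
qed

lemma set_integral_split:
  fixes h :: "real \<Rightarrow> real"
  assumes h: "set_integrable lborel {u..w} h" and uvw: "u \<le> v" "v \<le> w"
  shows "(LINT s:{u..w}|lborel. h s) = (LINT s:{u..v}|lborel. h s) + (LINT s:{v..w}|lborel. h s)"
proof -
  have "set_integrable lborel {u..v} h" "set_integrable lborel {v..w} h"
    using uvw by (auto intro!: set_integrable_subset[OF h])
  with h uvw show ?thesis
    using Henstock_Kurzweil_Integration.integral_combine[of u v w h]
    by (simp add: set_borel_integral_eq_integral)
qed

lemma continuous_on_tail_integral:
  fixes g :: "real \<Rightarrow> real"
  assumes g: "set_integrable lborel {u..t} g"
  shows "continuous_on {u..t} (\<lambda>v. LINT s:{v..t}|lborel. g s)"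
proof -
  have "continuous_on {u..t} (\<lambda>v. (LINT s:{u..t}|lborel. g s) - integral {u..v} g)"
    using set_borel_integral_eq_integral(1)[OF g]
    by (intro continuous_intros indefinite_integral_continuous_1)
  moreover have "(LINT s:{u..t}|lborel. g s) - integral {u..v} g = (LINT s:{v..t}|lborel. g s)" if "v \<in> {u..t}" for v
    using that set_integral_split[OF g, of v] set_integrable_subset[OF g, of "{u..v}"]
    by (simp add: set_borel_integral_eq_integral)
  ultimately show ?thesis by (rule continuous_on_eq)
qed

text \<open>
  As \<open>g\<close> need not be continuous, the fundamental theorem of calculus is replaced by Bolzano's
  bisection, applied to the property that both sides agree on \<open>[u, v]\<close> up to \<open>\<epsilon> * (T u - T v)\<close>.
\<close>

lemma powr_tail_integral_strict:
  fixes g :: "real \<Rightarrow> real"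
  assumes g: "set_integrable lborel {0..t} g" and g_nn: "\<And>s. s \<in> {0..t} \<Longrightarrow> 0 \<le> g s"
    and a: "a > 1" and t: "t \<ge> 0"
  defines "T \<equiv> \<lambda>u. LINT s:{u..t}|lborel. g s"
  shows "set_integrable lborel {0..t} (\<lambda>u. a * T u powr (a - 1) * g u)"
    and "(LINT u:{0..t}|lborel. a * T u powr (a - 1) * g u) = T 0 powr a"
proof -
  define q where "q = (\<lambda>u. a * T u powr (a - 1))"
  have gi: "set_integrable lborel {u..v} g" if "0 \<le> u" "v \<le> t" for u v
    using that by (intro set_integrable_subset[OF g]) auto
  have diff: "(LINT s:{u..v}|lborel. g s) = T u - T v" if "0 \<le> u" "u \<le> v" "v \<le> t" for u v
    unfolding T_def using set_integral_split[OF gi, of u t v] that by simp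
  have nn: "0 \<le> (LINT s:{u..v}|lborel. g s)" if "0 \<le> u" "v \<le> t" for u v
    unfolding set_lebesgue_integral_def using that g_nn
    by (intro integral_nonneg_AE AE_I2) (auto simp: indicator_def)
  have T_nn: "0 \<le> T u" if "0 \<le> u" for u unfolding T_def using that by (intro nn) auto
  have T_anti: "T v \<le> T u" if "0 \<le> u" "u \<le> v" "v \<le> t" for u v
    using nn[of u v] diff[of u v] that by simp
  have T_cont: "continuous_on {0..t} T"
    unfolding T_def by (rule continuous_on_tail_integral[OF g])
  \<comment> \<open>\<open>T\<close> vanishes at \<open>t\<close>, so continuity of \<open>q\<close>
    up to the right end uses a > 1: exponent 0 would make \<open>q\<close> jump there.\<close>
  have q_cont: "continuous_on {0..t} q"
    unfolding q_def
    by (intro continuous_on_mult continuous_on_const continuous_on_powr' T_cont ballI) (use a T_nn in auto)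
  have q_anti: "q v \<le> q u" if "0 \<le> u" "u \<le> v" "v \<le> t" for u v
    unfolding q_def using T_anti[OF that] T_nn[of v] that a by (intro mult_left_mono powr_mono2) auto
  have q_nn: "0 \<le> q u" for u unfolding q_def using a by simp
  have qg: "set_integrable lborel {0..t} (\<lambda>u. q u * g u)"
    unfolding set_integrable_def
  proof (rule Bochner_Integration.integrable_bound)
    show "integrable lborel (\<lambda>u. q 0 * (indicator {0..t} u *\<^sub>R g u))"
      using g unfolding set_integrable_def by simp
    have "(\<lambda>u. (indicator {0..t} u *\<^sub>R q u) * (indicator {0..t} u *\<^sub>R g u)) \<in> borel_measurable lborel"
      using borel_measurable_continuous_on_indicator[OF _ q_cont] g
      unfolding set_integrable_def by (intro borel_measurable_times) auto
    also have "(\<lambda>u. (indicator {0..t} u *\<^sub>R q u) * (indicator {0..t} u *\<^sub>R g u)) = (\<lambda>u. indicator {0..t} u *\<^sub>R (q u * g u))"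
      by (auto simp: indicator_def fun_eq_iff)
    finally show "(\<lambda>u. indicator {0..t} u *\<^sub>R (q u * g u)) \<in> borel_measurable lborel" .
    show "AE u in lborel. norm (indicator {0..t} u *\<^sub>R (q u * g u)) \<le> norm (q 0 * (indicator {0..t} u *\<^sub>R g u))"
      using q_nn q_anti[of 0] g_nn
      by (intro AE_I2) (auto simp: indicator_def abs_mult intro!: mult_right_mono)
  qed
  then show "set_integrable lborel {0..t} (\<lambda>u. a * T u powr (a - 1) * g u)" by (simp add: q_def)
  have qgi: "set_integrable lborel {u..v} (\<lambda>u. q u * g u)" if "0 \<le> u" "v \<le> t" for u v
    using that by (intro set_integrable_subset[OF qg]) auto
  have key: "\<bar>(T 0 powr a - T t powr a) - (LINT s:{0..t}|lborel. q s * g s)\<bar> \<le> \<epsilon> * (T 0 - T t)" if \<epsilon>: "\<epsilon> > 0" for \<epsilon>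
  proof -
    define P where "P = (\<lambda>u v. 0 \<le> u \<longrightarrow> u \<le> v \<longrightarrow> v \<le> t \<longrightarrow>
      \<bar>(T u powr a - T v powr a) - (LINT s:{u..v}|lborel. q s * g s)\<bar> \<le> \<epsilon> * (T u - T v))"
    have "P 0 t" using t
    proof (induction rule: Bolzano)
      case (trans u v w)
      show ?case
        unfolding P_def
      proof (intro impI)
        assume *: "0 \<le> u" "u \<le> w" "w \<le> t"
        have "(LINT s:{u..w}|lborel. q s * g s) = (LINT s:{u..v}|lborel. q s * g s) + (LINT s:{v..w}|lborel. q s * g s)"
          using trans * by (intro set_integral_split qgi) auto
        moreover have "\<epsilon> * (T u - T w) = \<epsilon> * (T u - T v) + \<epsilon> * (T v - T w)" by (simp add: algebra_simps)
        moreover have "\<bar>(T u powr a - T v powr a) - (LINT s:{u..v}|lborel. q s * g s)\<bar> \<le> \<epsilon> * (T u - T v)"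
          "\<bar>(T v powr a - T w powr a) - (LINT s:{v..w}|lborel. q s * g s)\<bar> \<le> \<epsilon> * (T v - T w)"
          using trans * unfolding P_def by auto
        ultimately show "\<bar>(T u powr a - T w powr a) - (LINT s:{u..w}|lborel. q s * g s)\<bar> \<le> \<epsilon> * (T u - T w)"
          by linarith
      qed
    next
      case (local x)
      \<comment> \<open>Half of \<epsilon> for each endpoint: \<open>u\<close> and \<open>v\<close>
        are compared through \<open>q x\<close>.\<close>
      then obtain d where d: "d > 0" "\<And>y. y \<in> {0..t} \<Longrightarrow> \<bar>y - x\<bar> < d \<Longrightarrow> \<bar>q y - q x\<bar> < \<epsilon> / 2"
        using q_cont \<epsilon> unfolding continuous_on_iff dist_real_def by (metis atLeastAtMost_iff half_gt_zero)
      show ?case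
        unfolding P_def
      proof (rule exI[of _ d], intro conjI allI impI)
        show "d > 0" by fact
        fix u v assume x: "u \<le> x \<and> x \<le> v \<and> v - u < d" and uv: "0 \<le> u" "u \<le> v" "v \<le> t"
        have "\<bar>q u - q x\<bar> < \<epsilon> / 2" "\<bar>q v - q x\<bar> < \<epsilon> / 2" using x uv by (intro d(2); simp)+
        then have osc: "q u - q v \<le> \<epsilon>" by linarith
        \<comment> \<open>On a short interval both quantities lie between
          \<open>q v * (T u - T v)\<close> and \<open>q u * (T u - T v)\<close>, one by convexity
          and the other by monotonicity of \<open>q\<close>; the gap is the oscillation of
          \<open>q\<close> times \<open>T u - T v\<close>.\<close>
        note tb = powr_tangent_bounds[of a "T v" "T u"]
        have 1: "q v * (T u - T v) \<le> T u powr a - T v powr a" "T u powr a - T v powr a \<le> q u * (T u - T v)"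
          unfolding q_def using tb a T_nn[of v] T_anti[OF uv] uv by auto
        have c: "(LINT s:{u..v}|lborel. k * g s) = k * (T u - T v)" for k
          using diff[OF uv] by simp
        have "(LINT s:{u..v}|lborel. q v * g s) \<le> (LINT s:{u..v}|lborel. q s * g s)"
          "(LINT s:{u..v}|lborel. q s * g s) \<le> (LINT s:{u..v}|lborel. q u * g s)"
          using uv gi[of u v] q_anti g_nn
          by (intro set_integral_mono qgi set_integrable_mult_right mult_right_mono; simp)+
        then have 2: "q v * (T u - T v) \<le> (LINT s:{u..v}|lborel. q s * g s)"
          "(LINT s:{u..v}|lborel. q s * g s) \<le> q u * (T u - T v)" by (simp_all only: c)
        have "(q u - q v) * (T u - T v) \<le> \<epsilon> * (T u - T v)"
          using osc T_anti[OF uv] by (intro mult_right_mono) auto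
        then have "q u * (T u - T v) - q v * (T u - T v) \<le> \<epsilon> * (T u - T v)" by (simp only: left_diff_distrib)
        with 1 2 show "\<bar>(T u powr a - T v powr a) - (LINT s:{u..v}|lborel. q s * g s)\<bar> \<le> \<epsilon> * (T u - T v)"
          by linarith
      qed
    qed
    then show ?thesis using t by (simp add: P_def)
  qed
  have "\<bar>(T 0 powr a - T t powr a) - (LINT s:{0..t}|lborel. q s * g s)\<bar> \<le> 0"
  proof (rule field_le_epsilon)
    fix e :: real assume e: "e > 0"
    have D: "0 \<le> T 0 - T t" using T_anti[of 0 t] t by simp
    \<comment> \<open>The added 1 in the denominator keeps the chosen \<epsilon> positive when
      \<open>T\<close> is constant.\<close>
    have "\<bar>(T 0 powr a - T t powr a) - (LINT s:{0..t}|lborel. q s * g s)\<bar> \<le> e / (1 + (T 0 - T t)) * (T 0 - T t)"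
      using e D by (intro key divide_pos_pos) auto
    also have "\<dots> \<le> e" using e D by (simp add: field_simps)
    finally show "\<bar>(T 0 powr a - T t powr a) - (LINT s:{0..t}|lborel. q s * g s)\<bar> \<le> 0 + e" by simp
  qed
  moreover have "T t = 0"
    using diff[of t t] t set_borel_integral_eq_integral(2)[OF gi[of t t]] by (simp add: T_def)
  ultimately show "(LINT u:{0..t}|lborel. a * T u powr (a - 1) * g u) = T 0 powr a"
    using a by (simp add: q_def)
qed

text \<open>Adds the case a = 1. There \<open>T u powr 0\<close> is 1 for u < t, since the lower
  bound \<open>m\<close> makes \<open>T u\<close> positive, and 0 at u = t; the exceptional point is
  null.\<close>

lemma powr_tail_integral:
  fixes g :: "real \<Rightarrow> real"
  assumes g: "set_integrable lborel {0..t} g" and m: "m > 0" "\<And>s. s \<in> {0..t} \<Longrightarrow> m \<le> g s"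
    and a: "a \<ge> 1" and t: "t \<ge> 0"
  defines "T \<equiv> \<lambda>u. LINT s:{u..t}|lborel. g s"
  shows "set_integrable lborel {0..t} (\<lambda>u. a * T u powr (a - 1) * g u)"
    and "(LINT u:{0..t}|lborel. a * T u powr (a - 1) * g u) = T 0 powr a"
proof -
  have g_nn: "0 \<le> g s" if "s \<in> {0..t}" for s using m(2)[OF that] m(1) by linarith
  have T_pos: "m * (t - u) \<le> T u" if "0 \<le> u" "u \<le> t" for u
  proof -
    have "(LINT s:{u..t}|lborel. m) \<le> T u"
      unfolding T_def using that m
      by (intro set_integral_mono set_integrable_subset[OF g]) (auto simp: set_integrable_def integrable_indicator_iff emeasure_lborel_Icc_eq)
    then show ?thesis using that by (simp add: set_lebesgue_integral_def mult.commute)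
  qed
  have "set_integrable lborel {0..t} (\<lambda>u. a * T u powr (a - 1) * g u) \<and>
    (LINT u:{0..t}|lborel. a * T u powr (a - 1) * g u) = T 0 powr a"
  proof (cases "a = 1")
    case False
    then show ?thesis using powr_tail_integral_strict[OF g g_nn _ t, of a] a by (auto simp: T_def)
  next
    case True
    have eq: "indicator {0..t} u *\<^sub>R (a * T u powr (a - 1) * g u) = (if u = t then 0 else indicator {0..t} u *\<^sub>R g u)" for u
    proof (cases "u \<in> {0..<t}")
      case T: True
      then have "0 < m * (t - u)" using m by simp
      also have "\<dots> \<le> T u" using T by (intro T_pos) auto
      finally show ?thesis using T True by simp
    next
      case False
      moreover have "T t = 0"
        using set_borel_integral_eq_integral(2)[OF set_integrable_subset[OF g, of "{t..t}"]] t by (simp add: T_def)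
      ultimately show ?thesis using True by (auto simp: indicator_def)
    qed
    define G where "G = (\<lambda>u. indicator {0..t} u *\<^sub>R g u)"
    have iG: "integrable lborel G" using g by (simp add: set_integrable_def G_def)
    then have [measurable]: "G \<in> borel_measurable lborel" by auto
    have ae: "AE u in lborel. (if u = t then 0 else G u) = G u"
      using AE_lborel_singleton[of t] by eventually_elim auto
    have i: "integrable lborel (\<lambda>u. if u = t then 0 else G u)"
      using iG by (subst integrable_cong_AE[OF _ _ ae]) auto
    have "(LINT u|lborel. (if u = t then 0 else G u)) = (LINT u|lborel. G u)"
      by (intro integral_cong_AE ae) auto
    also have "\<dots> = T 0" by (simp only: T_def set_lebesgue_integral_def G_def)
    finally have "(LINT u|lborel. (if u = t then 0 else G u)) = T 0" .
    moreover have "indicator {0..t} u *\<^sub>R (a * T u powr (a - 1) * g u) = (if u = t then 0 else G u)" for u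
      unfolding eq G_def ..
    moreover have "0 \<le> m * t" using m t by simp
    then have "0 \<le> T 0" using T_pos[of 0] t by simp
    ultimately show ?thesis
      using i unfolding set_integrable_def set_lebesgue_integral_def by (simp add: True)
  qed
  then show "set_integrable lborel {0..t} (\<lambda>u. a * T u powr (a - 1) * g u)"
    and "(LINT u:{0..t}|lborel. a * T u powr (a - 1) * g u) = T 0 powr a" by auto
qed

text \<open>Jensen's inequality for the uniform law on [u, t]: integrate the tangent of the power at
  the mean value \<open>y\<close>, whose linear term has integral 0.\<close>

lemma powr_integral_le:
  fixes g :: "real \<Rightarrow> real"
  assumes g: "set_integrable lborel {u..t} g" and g_nn: "\<And>s. s \<in> {u..t} \<Longrightarrow> 0 \<le> g s"
    and ga: "set_integrable lborel {u..t} (\<lambda>s. g s powr a)" and a: "a \<ge> 1" and ut: "u < t"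
  shows "(LINT s:{u..t}|lborel. g s) powr a \<le> (t - u) powr (a - 1) * (LINT s:{u..t}|lborel. g s powr a)"
proof -
  define I where "I = (LINT s:{u..t}|lborel. g s)"
  define y where "y = I / (t - u)"
  have I: "0 \<le> I" unfolding I_def set_lebesgue_integral_def using g_nn
    by (intro integral_nonneg_AE AE_I2) (auto simp: indicator_def)
  then have y: "0 \<le> y" using ut by (simp add: y_def)
  have tangent: "y powr a + a * y powr (a - 1) * (x - y) \<le> x powr a" if "0 \<le> x" for x
  proof (cases "y \<le> x")
    case True
    then show ?thesis using powr_tangent_bounds(1)[OF a y True] by simp
  next
    case False
    then show ?thesis using powr_tangent_bounds(2)[OF a that, of y] by (simp add: algebra_simps)
  qed
  have c: "set_integrable lborel {u..t} (\<lambda>s. k::real)" for k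
    by (simp add: set_integrable_def integrable_indicator_iff emeasure_lborel_Icc_eq)
  have cI: "(LINT s:{u..t}|lborel. k) = k * (t - u)" for k :: real
    using ut by (simp add: set_lebesgue_integral_def)
  have "(LINT s:{u..t}|lborel. y powr a + a * y powr (a - 1) * (g s - y)) \<le> (LINT s:{u..t}|lborel. g s powr a)"
    using g_nn by (intro set_integral_mono set_integral_add set_integrable_mult_right set_integral_diff c g ga tangent) auto
  also have "(LINT s:{u..t}|lborel. y powr a + a * y powr (a - 1) * (g s - y)) = y powr a * (t - u)"
    using ut g by (simp add: set_integral_add set_integral_diff c cI I_def[symmetric] y_def)
  finally have "(t - u) powr (a - 1) * (y powr a * (t - u)) \<le> (t - u) powr (a - 1) * (LINT s:{u..t}|lborel. g s powr a)"
    by (intro mult_left_mono) auto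
  also have "(t - u) powr (a - 1) * (y powr a * (t - u)) = I powr a"
  proof -
    have "(t - u) powr (a - 1) * (t - u) = (t - u) powr a"
      using ut powr_mult_base[of "t - u" "a - 1"] by (simp add: mult.commute)
    then have "(t - u) powr (a - 1) * (y powr a * (t - u)) = (y * (t - u)) powr a"
      using y ut by (simp add: powr_mult mult_ac)
    then show ?thesis using ut by (simp add: y_def)
  qed
  finally show ?thesis by (simp add: I_def)
qed

section \<open>Independence from a sub-sigma-algebra\<close>

text \<open>The measure is a parameter because independence is also used under the conditioned
  measures \<open>uniform_measure M A\<close>.\<close>

definition indep_from :: "'a measure \<Rightarrow> 'a measure \<Rightarrow> ('a \<Rightarrow> real) \<Rightarrow> bool" where
  "indep_from N G Y \<longleftrightarrow> Y \<in> borel_measurable N \<and>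
     (\<forall>A\<in>sets G. \<forall>B\<in>sets borel.
        measure N (A \<inter> (Y -` B \<inter> space N)) = measure N A * measure N (Y -` B \<inter> space N))"

lemma indep_fromD:
  "indep_from N G Y \<Longrightarrow> A \<in> sets G \<Longrightarrow> B \<in> sets borel \<Longrightarrow>
    measure N (A \<inter> (Y -` B \<inter> space N)) = measure N A * measure N (Y -` B \<inter> space N)"
  by (simp add: indep_from_def)

lemma indep_from_measurable: "indep_from N G Y \<Longrightarrow> Y \<in> borel_measurable N"
  by (simp add: indep_from_def)

lemma (in prob_space) distr_pair_indep_from:
  assumes G: "subalgebra M G" and Z: "Z \<in> borel_measurable G" and Y: "indep_from M G Y"
  shows "distr M (borel \<Otimes>\<^sub>M borel) (\<lambda>\<omega>. (Z \<omega>, Y \<omega>)) = distr M borel Z \<Otimes>\<^sub>M distr M borel Y"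
proof -
  have Y' [measurable]: "Y \<in> borel_measurable M" by (rule indep_from_measurable[OF Y])
  have Z' [measurable]: "Z \<in> borel_measurable M" by (rule measurable_from_subalg[OF G Z])
  have sp: "space G = space M" using G by (simp add: subalgebra_def)
  interpret Z: prob_space "distr M borel Z" by (rule prob_space_distr) simp
  interpret Y: prob_space "distr M borel Y" by (rule prob_space_distr) simp
  show ?thesis
  proof (rule pair_measure_eqI[symmetric])
    fix A B assume A: "A \<in> sets (distr M borel Z)" and B: "B \<in> sets (distr M borel Y)"
    have ZA: "Z -` A \<inter> space M \<in> sets G" using measurable_sets[OF Z, of A] A sp by simp
    have "emeasure (distr M (borel \<Otimes>\<^sub>M borel) (\<lambda>\<omega>. (Z \<omega>, Y \<omega>))) (A \<times> B)
      = emeasure M ((Z -` A \<inter> space M) \<inter> (Y -` B \<inter> space M))"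
      using A B by (subst emeasure_distr) (auto intro!: arg_cong[where f="emeasure M"])
    also have "\<dots> = ennreal (prob (Z -` A \<inter> space M) * prob (Y -` B \<inter> space M))"
      using indep_fromD[OF Y ZA, of B] B by (simp add: emeasure_eq_measure)
    also have "\<dots> = emeasure (distr M borel Z) A * emeasure (distr M borel Y) B"
      using A B by (simp add: emeasure_distr emeasure_eq_measure ennreal_mult)
    finally show "emeasure (distr M borel Z) A * emeasure (distr M borel Y) B =
      emeasure (distr M (borel \<Otimes>\<^sub>M borel) (\<lambda>\<omega>. (Z \<omega>, Y \<omega>))) (A \<times> B)" by simp
  qed (auto intro: Z.sigma_finite_measure_axioms Y.sigma_finite_measure_axioms)
qed

lemma (in prob_space) nn_integral_indep_from:
  assumes G: "subalgebra M G" and Z: "Z \<in> borel_measurable G" and Y: "indep_from M G Y"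
    and f [measurable]: "f \<in> borel_measurable borel" and h [measurable]: "h \<in> borel_measurable borel"
  shows "(\<integral>\<^sup>+\<omega>. f (Z \<omega>) * h (Y \<omega>) \<partial>M) = (\<integral>\<^sup>+\<omega>. f (Z \<omega>) \<partial>M) * (\<integral>\<^sup>+\<omega>. h (Y \<omega>) \<partial>M)"
proof -
  have [measurable]: "Y \<in> borel_measurable M" "Z \<in> borel_measurable M"
    by (rule indep_from_measurable[OF Y], rule measurable_from_subalg[OF G Z])
  interpret Z: prob_space "distr M borel Z" by (rule prob_space_distr) simp
  interpret Y: prob_space "distr M borel Y" by (rule prob_space_distr) simp
  interpret P: pair_sigma_finite "distr M borel Z" "distr M borel Y" ..
  have "(\<integral>\<^sup>+\<omega>. f (Z \<omega>) * h (Y \<omega>) \<partial>M) =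
    (\<integral>\<^sup>+p. f (fst p) * h (snd p) \<partial>distr M (borel \<Otimes>\<^sub>M borel) (\<lambda>\<omega>. (Z \<omega>, Y \<omega>)))"
    by (simp add: nn_integral_distr)
  also have "\<dots> = (\<integral>\<^sup>+z. \<integral>\<^sup>+y. f z * h y \<partial>distr M borel Y \<partial>distr M borel Z)"
    unfolding distr_pair_indep_from[OF G Z Y] by (subst Y.nn_integral_fst[symmetric]) auto
  also have "\<dots> = (\<integral>\<^sup>+z. f z \<partial>distr M borel Z) * (\<integral>\<^sup>+y. h y \<partial>distr M borel Y)"
    by (simp add: nn_integral_cmult nn_integral_multc)
  finally show ?thesis by (simp add: nn_integral_distr)
qed

text \<open>Equality of laws passes to limits and can be computed for functions of several
  variables, which makes it more flexible than the product formula for events. Null events satisfy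
  the product formula trivially, so conditioning on the others suffices.\<close>

lemma (in prob_space) indep_from_iff_distr:
  assumes G: "subalgebra M G" and Y [measurable]: "Y \<in> borel_measurable M"
  shows "indep_from M G Y \<longleftrightarrow>
    (\<forall>A\<in>sets G. prob A \<noteq> 0 \<longrightarrow> distr (uniform_measure M A) borel Y = distr M borel Y)"
proof -
  have A: "A \<in> events" if "A \<in> sets G" for A using that G by (auto simp: subalgebra_def)
  have em: "emeasure (distr (uniform_measure M A) borel Y) B = ennreal (prob (A \<inter> (Y -` B \<inter> space M)) / prob A)"
    if "A \<in> sets G" "prob A \<noteq> 0" "B \<in> sets borel" for A B
  proof -
    have "0 < prob A" using that by (simp add: zero_less_measure_iff measure_eq_0_null_sets less_le)
    then show ?thesis using that A[of A]
      by (simp add: emeasure_distr emeasure_uniform_measure emeasure_eq_measure divide_ennreal)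
  qed
  have eq: "distr (uniform_measure M A) borel Y = distr M borel Y \<longleftrightarrow>
      (\<forall>B\<in>sets borel. prob (A \<inter> (Y -` B \<inter> space M)) = prob A * prob (Y -` B \<inter> space M))"
    if "A \<in> sets G" "prob A \<noteq> 0" for A
  proof -
    have "distr (uniform_measure M A) borel Y = distr M borel Y \<longleftrightarrow>
      (\<forall>B\<in>sets borel. emeasure (distr (uniform_measure M A) borel Y) B = emeasure (distr M borel Y) B)"
      by (auto intro!: measure_eqI)
    also have "\<dots> \<longleftrightarrow> (\<forall>B\<in>sets borel. prob (A \<inter> (Y -` B \<inter> space M)) / prob A = prob (Y -` B \<inter> space M))"
    proof (intro ball_cong refl)
      fix B :: "real set" assume B: "B \<in> sets borel"
      have "emeasure (distr M borel Y) B = ennreal (prob (Y -` B \<inter> space M))"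
        using B by (simp add: emeasure_distr emeasure_eq_measure)
      then show "emeasure (distr (uniform_measure M A) borel Y) B = emeasure (distr M borel Y) B \<longleftrightarrow>
          prob (A \<inter> (Y -` B \<inter> space M)) / prob A = prob (Y -` B \<inter> space M)"
        by (simp add: em[OF that B])
    qed
    also have "\<dots> \<longleftrightarrow> (\<forall>B\<in>sets borel. prob (A \<inter> (Y -` B \<inter> space M)) = prob A * prob (Y -` B \<inter> space M))"
      using that(2) by (simp add: field_simps)
    finally show ?thesis .
  qed
  have null: "prob (A \<inter> (Y -` B \<inter> space M)) = prob A * prob (Y -` B \<inter> space M)"
    if "A \<in> sets G" "prob A = 0" "B \<in> sets borel" for A B
  proof -
    have "prob (A \<inter> (Y -` B \<inter> space M)) \<le> prob A"
      using A[of A] that by (intro finite_measure_mono) auto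
    then show ?thesis using that(2) by (simp add: measure_le_0_iff)
  qed
  show ?thesis
    unfolding indep_from_def using eq null Y by blast
qed

text \<open>Intersecting with \<open>A\<close> stays inside \<open>G\<close>, so the product formula
  under \<open>M\<close> can be divided by the probability of \<open>A\<close>.\<close>

lemma (in prob_space) indep_from_uniform_measure:
  assumes G: "subalgebra M G" and Y: "indep_from M G Y" and A: "A \<in> sets G" "prob A \<noteq> 0"
  shows "indep_from (uniform_measure M A) G Y"
proof -
  have Y' [measurable]: "Y \<in> borel_measurable M" by (rule indep_from_measurable[OF Y])
  have sets: "C \<in> events" if "C \<in> sets G" for C using that G by (auto simp: subalgebra_def)
  have m: "measure (uniform_measure M A) C = prob (A \<inter> C) / prob A" if "C \<in> events" for C
    using that A sets by (intro measure_uniform_measure) (auto simp: emeasure_eq_measure)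
  show ?thesis
    unfolding indep_from_def
  proof (intro conjI ballI)
    show "Y \<in> borel_measurable (uniform_measure M A)" by simp
    fix C B assume C: "C \<in> sets G" and B: "B \<in> sets (borel :: real measure)"
    have "prob (A \<inter> (C \<inter> (Y -` B \<inter> space M))) = prob (A \<inter> C) * prob (Y -` B \<inter> space M)"
      using indep_fromD[OF Y, of "A \<inter> C" B] A C B by (simp add: Int_assoc)
    moreover have "prob (A \<inter> (Y -` B \<inter> space M)) = prob A * prob (Y -` B \<inter> space M)"
      by (rule indep_fromD[OF Y A(1) B])
    ultimately show "measure (uniform_measure M A) (C \<inter> (Y -` B \<inter> space (uniform_measure M A))) =
      measure (uniform_measure M A) C * measure (uniform_measure M A) (Y -` B \<inter> space (uniform_measure M A))"
      using sets[OF C] B A by (simp add: m)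
  qed
qed

text \<open>Conditioning on \<open>A\<close> in \<open>G\<close> leaves the laws of \<open>D\<close>
  and \<open>R\<close> unchanged, the latter because \<open>A\<close> also lies in
  \<open>G'\<close>; and \<open>R\<close> stays independent of \<open>D\<close>, which is measurable
  for \<open>G'\<close>. So the pair keeps its product law.\<close>

lemma (in prob_space) indep_from_combine:
  assumes G: "subalgebra M G" "subalgebra M G'" "sets G \<subseteq> sets G'"
    and D: "indep_from M G D" "D \<in> borel_measurable G'" and R: "indep_from M G' R"
    and h [measurable]: "h \<in> borel_measurable (borel \<Otimes>\<^sub>M borel)"
  shows "indep_from M G (\<lambda>\<omega>. h (D \<omega>, R \<omega>))"
    and "distr M borel (\<lambda>\<omega>. h (D \<omega>, R \<omega>)) = distr (distr M borel D \<Otimes>\<^sub>M distr M borel R) borel h"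
proof -
  have [measurable]: "D \<in> borel_measurable M" "R \<in> borel_measurable M"
    using D R by (auto intro: indep_from_measurable)
  have comp: "distr N borel (\<lambda>\<omega>. h (D \<omega>, R \<omega>)) = distr (distr N (borel \<Otimes>\<^sub>M borel) (\<lambda>\<omega>. (D \<omega>, R \<omega>))) borel h"
    if "sets N = sets M" for N
    using that by (subst distr_distr) (auto simp: comp_def cong: measurable_cong_sets)
  show law: "distr M borel (\<lambda>\<omega>. h (D \<omega>, R \<omega>)) = distr (distr M borel D \<Otimes>\<^sub>M distr M borel R) borel h"
    by (simp add: comp distr_pair_indep_from[OF G(2) D(2) R])
  have "distr (uniform_measure M A) borel (\<lambda>\<omega>. h (D \<omega>, R \<omega>)) = distr M borel (\<lambda>\<omega>. h (D \<omega>, R \<omega>))"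
    if A: "A \<in> sets G" "prob A \<noteq> 0" for A
  proof -
    have A': "A \<in> sets G'" using A G by auto
    then have AM: "A \<in> events" using G by (auto simp: subalgebra_def)
    interpret Q: prob_space "uniform_measure M A"
      using A by (intro prob_space_uniform_measure) (auto simp: emeasure_eq_measure)
    have sub: "subalgebra (uniform_measure M A) G'" using G(2) by (simp add: subalgebra_def)
    have "distr (uniform_measure M A) (borel \<Otimes>\<^sub>M borel) (\<lambda>\<omega>. (D \<omega>, R \<omega>)) =
      distr (uniform_measure M A) borel D \<Otimes>\<^sub>M distr (uniform_measure M A) borel R"
      by (intro Q.distr_pair_indep_from[OF sub D(2)] indep_from_uniform_measure G R A' A)
    also have "distr (uniform_measure M A) borel D = distr M borel D"
      using D(1) A indep_from_iff_distr[OF G(1)] by auto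
    also have "distr (uniform_measure M A) borel R = distr M borel R"
      using R A A' indep_from_iff_distr[OF G(2)] by auto
    finally show ?thesis by (simp add: comp law)
  qed
  then show "indep_from M G (\<lambda>\<omega>. h (D \<omega>, R \<omega>))"
    by (subst indep_from_iff_distr[OF G(1)]) auto
qed

section \<open>Laws of pointwise limits\<close>

lemma (in prob_space) char_distr_tendsto:
  fixes Z :: "'a \<Rightarrow> real"
  assumes [measurable]: "\<And>n. Y n \<in> borel_measurable M" "Z \<in> borel_measurable M"
    and lim: "\<And>\<omega>. \<omega> \<in> space M \<Longrightarrow> (\<lambda>n. Y n \<omega>) \<longlonglongrightarrow> Z \<omega>"
  shows "(\<lambda>n. char (distr M borel (Y n)) l) \<longlonglongrightarrow> char (distr M borel Z) l"
proof -
  have "(\<lambda>n. CLINT \<omega>|M. iexp (l * Y n \<omega>)) \<longlonglongrightarrow> (CLINT \<omega>|M. iexp (l * Z \<omega>))"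
  proof (rule integral_dominated_convergence[where w="\<lambda>_. 1"])
    show "AE \<omega> in M. (\<lambda>n. iexp (l * Y n \<omega>)) \<longlonglongrightarrow> iexp (l * Z \<omega>)"
      using lim by (intro AE_I2 tendsto_intros)
  qed auto
  then show ?thesis by (simp add: char_def integral_distr)
qed

lemma (in prob_space) real_distribution_distr':
  fixes Y :: "'a \<Rightarrow> real"
  shows
  "Y \<in> borel_measurable M \<Longrightarrow> real_distribution (distr M borel Y)"
  by (auto simp: real_distribution_def real_distribution_axioms_def intro: prob_space_distr)

text \<open>Characteristic functions pass to pointwise limits and determine the law. Two spaces are
  allowed so that a law under \<open>M\<close> can be compared with one under a conditioned
  measure.\<close>

lemma distr_limit_eq:
  fixes Z :: "'a \<Rightarrow> real" and Z' :: "'b \<Rightarrow> real"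
  assumes "prob_space M" "prob_space N"
    and Y: "\<And>n. Y n \<in> borel_measurable M" "Z \<in> borel_measurable M"
    and Y': "\<And>n. Y' n \<in> borel_measurable N" "Z' \<in> borel_measurable N"
    and lim: "\<And>\<omega>. \<omega> \<in> space M \<Longrightarrow> (\<lambda>n. Y n \<omega>) \<longlonglongrightarrow> Z \<omega>"
    and lim': "\<And>\<omega>. \<omega> \<in> space N \<Longrightarrow> (\<lambda>n. Y' n \<omega>) \<longlonglongrightarrow> Z' \<omega>"
    and eq: "\<And>n. distr M borel (Y n) = distr N borel (Y' n)"
  shows "distr M borel Z = distr N borel Z'"
proof -
  interpret M: prob_space M by fact
  interpret N: prob_space N by fact
  have "char (distr M borel Z) l = char (distr N borel Z') l" for l
    using M.char_distr_tendsto[OF Y lim, of l] N.char_distr_tendsto[OF Y' lim', of l]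
    by (auto simp: eq intro: LIMSEQ_unique)
  then show ?thesis
    by (intro Levy_uniqueness M.real_distribution_distr' N.real_distribution_distr' Y Y' ext)
qed

lemma (in prob_space) indep_from_limit:
  assumes G: "subalgebra M G" and Y: "\<And>n. indep_from M G (Y n)"
    and Z: "Z \<in> borel_measurable M"
    and lim: "\<And>\<omega>. \<omega> \<in> space M \<Longrightarrow> (\<lambda>n. Y n \<omega>) \<longlonglongrightarrow> Z \<omega>"
  shows "indep_from M G Z"
  unfolding indep_from_iff_distr[OF G Z]
proof (intro ballI impI)
  fix A assume A: "A \<in> sets G" "prob A \<noteq> 0"
  have Y': "Y n \<in> borel_measurable M" for n by (rule indep_from_measurable[OF Y])
  have eq: "distr (uniform_measure M A) borel (Y n) = distr M borel (Y n)" for n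
    using Y[of n] A unfolding indep_from_iff_distr[OF G Y'] by blast
  have Q: "prob_space (uniform_measure M A)"
    using A by (intro prob_space_uniform_measure) (auto simp: emeasure_eq_measure)
  show "distr (uniform_measure M A) borel Z = distr M borel Z"
    by (rule distr_limit_eq[OF Q prob_space_axioms _ _ Y' Z _ lim eq]) (use Y' Z lim in auto)
qed

section \<open>Functionals of the future increments\<close>

text \<open>Dominated convergence; the endpoint \<open>u\<close> lies only in the limit interval and
  is null.\<close>

lemma set_integral_tendsto_upper:
  fixes h :: "real \<Rightarrow> 'b :: {banach, second_countable_topology}"
  assumes h: "set_integrable lborel {0..u} h" and s: "s \<longlonglongrightarrow> u" "\<And>n. s n < u"
  shows "(\<lambda>n. LINT r:{0..s n}|lborel. h r) \<longlonglongrightarrow> (LINT r:{0..u}|lborel. h r)"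
  unfolding set_lebesgue_integral_def
proof (rule integral_dominated_convergence[where w="\<lambda>r. norm (indicator {0..u} r *\<^sub>R h r)"])
  show "integrable lborel (\<lambda>r. norm (indicator {0..u} r *\<^sub>R h r))"
    by (rule integrable_norm[OF h[unfolded set_integrable_def]])
  show "(\<lambda>r. indicator {0..u} r *\<^sub>R h r) \<in> borel_measurable lborel"
    using h unfolding set_integrable_def by auto
  show "(\<lambda>r. indicator {0..s n} r *\<^sub>R h r) \<in> borel_measurable lborel" for n
    using set_integrable_subset[OF h, of "{0..s n}"] less_imp_le[OF s(2)[of n]]
    unfolding set_integrable_def by auto
  show "AE r in lborel. norm (indicator {0..s n} r *\<^sub>R h r) \<le> norm (indicator {0..u} r *\<^sub>R h r)" for n
    using less_imp_le[OF s(2)[of n]] by (intro AE_I2) (auto simp: indicator_def)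
  show "AE r in lborel. (\<lambda>n. indicator {0..s n} r *\<^sub>R h r) \<longlonglongrightarrow> indicator {0..u} r *\<^sub>R h r"
    using AE_lborel_singleton[of u]
  proof eventually_elim
    case (elim r)
    show ?case
    proof (cases "r < u")
      case True
      then have "eventually (\<lambda>n. r < s n) sequentially" using s(1) by (rule order_tendstoD(1)[rotated])
      then have "eventually (\<lambda>n. indicator {0..s n} r *\<^sub>R h r = indicator {0..u} r *\<^sub>R h r) sequentially"
        by (rule eventually_mono) (use True in \<open>auto simp: indicator_def\<close>)
      then show ?thesis by (rule tendsto_eventually)
    next
      case False
      then have "\<not> r \<le> s n" for n using s(2)[of n] elim by linarith
      then show ?thesis using False elim by (simp add: indicator_def)
    qed
  qed
qed

lemma cadlag_exp_neg_diff:
  assumes "cadlag f" shows "cadlag (\<lambda>s. exp (- (f s - c)))"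
proof -
  have "((\<lambda>s. exp (- (f s - c))) \<longlongrightarrow> exp (- (l - c))) F" if "(f \<longlongrightarrow> l) F" for l and F :: "real filter"
    using that by (intro tendsto_intros)
  with assms show ?thesis unfolding cadlag_def by blast
qed

context pii_semimartingale
begin

lemma space_natural_filtration [simp]: "space (natural_filtration M X s) = space M"
  unfolding natural_filtration_def by (rule space_measure_of) auto

lemma sets_natural_filtration:
  "sets (natural_filtration M X s) =
    sigma_sets (space M) (\<Union>r\<in>{0..s}. {X r -` A \<inter> space M | A. A \<in> sets borel})"
  unfolding natural_filtration_def by (rule sets_measure_of) auto

lemma subalgebra_natural_filtration: "subalgebra M (natural_filtration M X s)"
  unfolding subalgebra_def sets_natural_filtration
  using random_variable_X by (auto intro!: sets.sigma_sets_subset measurable_sets)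

lemma X_measurable_natural_filtration:
  assumes "0 \<le> r" "r \<le> s"
  shows "X r \<in> borel_measurable (natural_filtration M X s)"
proof (rule measurableI)
  fix A :: "real set" assume "A \<in> sets borel"
  then have "X r -` A \<inter> space M \<in> (\<Union>r\<in>{0..s}. {X r -` A \<inter> space M | A. A \<in> sets borel})"
    using assms by (intro UN_I[of r]) auto
  then show "X r -` A \<inter> space (natural_filtration M X s) \<in> sets (natural_filtration M X s)"
    unfolding sets_natural_filtration space_natural_filtration by (rule sigma_sets.Basic)
qed simp

lemma natural_filtration_mono:
  "s \<le> t \<Longrightarrow> sets (natural_filtration M X s) \<subseteq> sets (natural_filtration M X t)"
  unfolding sets_natural_filtration by (intro sigma_sets_mono' UN_mono) auto

lemma indep_from_increment:
  assumes "0 \<le> s" "s \<le> t"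
  shows "indep_from M (natural_filtration M X s) (\<lambda>\<omega>. X t \<omega> - X s \<omega>)"
  unfolding indep_from_def
proof (intro conjI ballI)
  have [measurable]: "X t \<in> borel_measurable M" "X s \<in> borel_measurable M"
    using assms by (auto intro: random_variable_X)
  show "(\<lambda>\<omega>. X t \<omega> - X s \<omega>) \<in> borel_measurable M" by measurable
  fix A B assume A: "A \<in> sets (natural_filtration M X s)" and B: "B \<in> sets (borel :: real measure)"
  have "(\<lambda>\<omega>. X t \<omega> - X s \<omega>) -` B \<inter> space M \<in> sets (vimage_algebra (space M) (\<lambda>\<omega>. X t \<omega> - X s \<omega>) borel)"
    using B by (rule in_vimage_algebra)
  from indep_setD[OF independent_increments[OF assms] this A]
  show "prob (A \<inter> ((\<lambda>\<omega>. X t \<omega> - X s \<omega>) -` B \<inter> space M)) =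
    prob A * prob ((\<lambda>\<omega>. X t \<omega> - X s \<omega>) -` B \<inter> space M)"
    by (simp add: Int_commute mult.commute)
qed

text \<open>
  Right-endpoint Riemann sums of \<open>exp (- (X r - X s))\<close>. Peeling off the first increment, which is independent
  of the remaining sum, gives both independence from the past and, for stationary
  increments, a law that does not depend on \<open>s\<close>.
\<close>

primrec grid_functional :: "nat \<Rightarrow> real \<Rightarrow> real \<Rightarrow> 'a \<Rightarrow> real" where
  "grid_functional 0 \<Delta> s \<omega> = 0"
| "grid_functional (Suc n) \<Delta> s \<omega> =
     exp (- (X (s + \<Delta>) \<omega> - X s \<omega>)) * (\<Delta> + grid_functional n \<Delta> (s + \<Delta>) \<omega>)"

lemma grid_functional_eq_sum:
  "grid_functional n \<Delta> s \<omega> = (\<Sum>i<n. \<Delta> * exp (- (X (s + real (Suc i) * \<Delta>) \<omega> - X s \<omega>)))"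
proof (induction n arbitrary: s)
  case (Suc n)
  have "(\<Sum>i<Suc n. \<Delta> * exp (- (X (s + real (Suc i) * \<Delta>) \<omega> - X s \<omega>))) =
      \<Delta> * exp (- (X (s + \<Delta>) \<omega> - X s \<omega>)) + (\<Sum>i<n. \<Delta> * exp (- (X (s + real (Suc (Suc i)) * \<Delta>) \<omega> - X s \<omega>)))"
    by (subst sum.lessThan_Suc_shift) simp
  also have "(\<Sum>i<n. \<Delta> * exp (- (X (s + real (Suc (Suc i)) * \<Delta>) \<omega> - X s \<omega>))) =
      exp (- (X (s + \<Delta>) \<omega> - X s \<omega>)) * (\<Sum>i<n. \<Delta> * exp (- (X (s + \<Delta> + real (Suc i) * \<Delta>) \<omega> - X (s + \<Delta>) \<omega>)))"
    unfolding sum_distrib_left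
    by (intro sum.cong refl) (simp add: exp_add[symmetric] algebra_simps)
  finally show ?case by (simp only: grid_functional.simps Suc.IH distrib_left mult.commute)
qed simp

text \<open>The first increment is independent of the past at \<open>s\<close> and known at
  \<open>s + \<Delta>\<close>, while the remaining sum is independent of the past at
  \<open>s + \<Delta>\<close>: the situation of \<open>indep_from_combine\<close>. The induction
  leaves \<open>s\<close> free because the remaining sum starts later. The recursion for the laws
  feeds \<open>distr_future_functional\<close>.\<close>

lemma indep_from_grid_functional:
  assumes "0 \<le> s" "0 \<le> \<Delta>"
  shows "indep_from M (natural_filtration M X s) (grid_functional n \<Delta> s)"
    and "distr M borel (grid_functional (Suc n) \<Delta> s) =
      distr (distr M borel (\<lambda>\<omega>. X (s + \<Delta>) \<omega> - X s \<omega>) \<Otimes>\<^sub>M distr M borel (grid_functional n \<Delta> (s + \<Delta>)))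
        borel (\<lambda>(d, r). exp (- d) * (\<Delta> + r))"
proof -
  have grid_Suc: "grid_functional (Suc n) \<Delta> s =
      (\<lambda>\<omega>. (\<lambda>(d, r). exp (- d) * (\<Delta> + r)) (X (s + \<Delta>) \<omega> - X s \<omega>, grid_functional n \<Delta> (s + \<Delta>) \<omega>))" for n s
    by (simp add: fun_eq_iff)
  have step: "indep_from M (natural_filtration M X s) (\<lambda>\<omega>. (\<lambda>(d, r). exp (- d) * (\<Delta> + r)) (X (s + \<Delta>) \<omega> - X s \<omega>, grid_functional n \<Delta> (s + \<Delta>) \<omega>))"
    "distr M borel (\<lambda>\<omega>. (\<lambda>(d, r). exp (- d) * (\<Delta> + r)) (X (s + \<Delta>) \<omega> - X s \<omega>, grid_functional n \<Delta> (s + \<Delta>) \<omega>)) =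
      distr (distr M borel (\<lambda>\<omega>. X (s + \<Delta>) \<omega> - X s \<omega>) \<Otimes>\<^sub>M distr M borel (grid_functional n \<Delta> (s + \<Delta>)))
        borel (\<lambda>(d, r). exp (- d) * (\<Delta> + r))"
    if "0 \<le> s" "indep_from M (natural_filtration M X (s + \<Delta>)) (grid_functional n \<Delta> (s + \<Delta>))" for s n
  proof -
    have D: "(\<lambda>\<omega>. X (s + \<Delta>) \<omega> - X s \<omega>) \<in> borel_measurable (natural_filtration M X (s + \<Delta>))"
      using that assms by (intro borel_measurable_diff X_measurable_natural_filtration) auto
    have h: "(\<lambda>(d, r). exp (- d) * (\<Delta> + r)) \<in> borel_measurable (borel \<Otimes>\<^sub>M borel)" by measurable
    note c = indep_from_combine[OF subalgebra_natural_filtration subalgebra_natural_filtration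
        natural_filtration_mono indep_from_increment D that(2) h]
    show "indep_from M (natural_filtration M X s) (\<lambda>\<omega>. (\<lambda>(d, r). exp (- d) * (\<Delta> + r)) (X (s + \<Delta>) \<omega> - X s \<omega>, grid_functional n \<Delta> (s + \<Delta>) \<omega>))"
      by (rule c) (use that assms in auto)
    show "distr M borel (\<lambda>\<omega>. (\<lambda>(d, r). exp (- d) * (\<Delta> + r)) (X (s + \<Delta>) \<omega> - X s \<omega>, grid_functional n \<Delta> (s + \<Delta>) \<omega>)) =
      distr (distr M borel (\<lambda>\<omega>. X (s + \<Delta>) \<omega> - X s \<omega>) \<Otimes>\<^sub>M distr M borel (grid_functional n \<Delta> (s + \<Delta>)))
        borel (\<lambda>(d, r). exp (- d) * (\<Delta> + r))"
      by (rule c) (use that assms in auto)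
  qed
  have indep: "indep_from M (natural_filtration M X s) (grid_functional n \<Delta> s)" if "0 \<le> s" for n s
    using that
  proof (induction n arbitrary: s)
    case 0
    have "prob (A \<inter> ((\<lambda>_. 0 :: real) -` B \<inter> space M)) = prob A * prob ((\<lambda>_. 0 :: real) -` B \<inter> space M)"
      if "A \<in> sets (natural_filtration M X s)" for A B
    proof -
      have "A \<subseteq> space M" using sets.sets_into_space[OF that] by simp
      then show ?thesis by (cases "0 \<in> B") (auto simp: prob_space Int_absorb2)
    qed
    moreover have "grid_functional 0 \<Delta> s = (\<lambda>_. 0)" by auto
    ultimately show ?case by (simp add: indep_from_def)
  next
    case (Suc n)
    have "0 \<le> s + \<Delta>" using Suc assms by simp
    from step(1)[OF Suc.prems Suc.IH[OF this]] show ?case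
      by (simp only: grid_Suc)
  qed
  show "indep_from M (natural_filtration M X s) (grid_functional n \<Delta> s)" by (rule indep) fact
  have "indep_from M (natural_filtration M X (s + \<Delta>)) (grid_functional n \<Delta> (s + \<Delta>))"
    using assms by (intro indep) simp
  from step(2)[OF assms(1) this, folded grid_Suc]
  show "distr M borel (grid_functional (Suc n) \<Delta> s) =
      distr (distr M borel (\<lambda>\<omega>. X (s + \<Delta>) \<omega> - X s \<omega>) \<Otimes>\<^sub>M distr M borel (grid_functional n \<Delta> (s + \<Delta>)))
        borel (\<lambda>(d, r). exp (- d) * (\<Delta> + r))" .
qed

text \<open>Based at \<open>X u\<close> instead of the left limit at \<open>u\<close>, hence a
  function of the increments after \<open>u\<close>; it agrees almost surely with
  \<open>exp_functional_from\<close>.\<close>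

definition future_functional :: "real \<Rightarrow> real \<Rightarrow> 'a \<Rightarrow> real" where
  "future_functional u t \<omega> = (LINT s:{u..t}|lborel. exp (- (X s \<omega> - X u \<omega>)))"

lemma grid_functional_tendsto:
  assumes "0 \<le> u" "u < t" "\<omega> \<in> space M"
  shows "(\<lambda>n. grid_functional (Suc n) ((t - u) / real (Suc n)) u \<omega>) \<longlonglongrightarrow> future_functional u t \<omega>"
  unfolding future_functional_def grid_functional_eq_sum
  by (rule riemann_sums_cadlag[OF cadlag_exp_neg_diff[OF cadlag_X[OF assms(3)]] assms(1,2)])

lemma future_functional_degenerate: "future_functional u u \<omega> = 0"
  unfolding future_functional_def set_lebesgue_integral_def
  by (rule integral_eq_zero_AE) (use AE_lborel_singleton[of u] in eventually_elim, simp)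

lemma grid_functional_measurable:
  "0 \<le> s \<Longrightarrow> 0 \<le> \<Delta> \<Longrightarrow> grid_functional n \<Delta> s \<in> borel_measurable M"
  by (rule indep_from_measurable[OF indep_from_grid_functional(1)])

lemma future_functional_measurable:
  assumes "0 \<le> u" "u \<le> t"
  shows "future_functional u t \<in> borel_measurable M"
proof (cases "u = t")
  case False
  then show ?thesis using assms
    by (intro borel_measurable_LIMSEQ_real[OF grid_functional_tendsto[of u t] grid_functional_measurable]) auto
next
  case True
  then have "future_functional u t = (\<lambda>_. 0)" by (auto simp: future_functional_degenerate)
  then show ?thesis by simp
qed

lemma indep_from_future_functional:
  assumes "0 \<le> u" "u < t"
  shows "indep_from M (natural_filtration M X u) (future_functional u t)"
  by (rule indep_from_limit[OF subalgebra_natural_filtration indep_from_grid_functional(1)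
      future_functional_measurable grid_functional_tendsto[OF assms]])
     (use assms in auto)

text \<open>In the recursion for the laws of the Riemann sums, the starting time enters the one-step
  factor only through the law of an increment; stationarity removes it step by step, and the limit
  keeps the equality.\<close>

lemma distr_future_functional:
  assumes stat: "\<And>s h. 0 \<le> s \<Longrightarrow> 0 \<le> h \<Longrightarrow> distr M borel (\<lambda>\<omega>. X (s + h) \<omega> - X s \<omega>) = distr M borel (X h)"
    and u: "0 \<le> u" "0 < h"
  shows "distr M borel (future_functional u (u + h)) = distr M borel (future_functional 0 h)"
proof -
  have eq: "distr M borel (grid_functional n \<Delta> s) = distr M borel (grid_functional n \<Delta> s')"
    if "0 \<le> s" "0 \<le> s'" "0 \<le> \<Delta>" for n \<Delta> s s'
    using that
  proof (induction n arbitrary: s s')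
    case 0
    then show ?case by (simp cong: distr_cong)
  next
    case (Suc n)
    have IH: "distr M borel (grid_functional n \<Delta> (s + \<Delta>)) = distr M borel (grid_functional n \<Delta> (s' + \<Delta>))"
      by (rule Suc.IH) (use Suc.prems in auto)
    show ?case
      unfolding indep_from_grid_functional(2)[OF Suc.prems(1,3)] indep_from_grid_functional(2)[OF Suc.prems(2,3)]
        stat[OF Suc.prems(1,3)] stat[OF Suc.prems(2,3)] IH ..
  qed
  show ?thesis
  proof (rule distr_limit_eq[OF prob_space_axioms prob_space_axioms])
    show "(\<lambda>n. grid_functional (Suc n) (h / real (Suc n)) u \<omega>) \<longlonglongrightarrow> future_functional u (u + h) \<omega>"
      if "\<omega> \<in> space M" for \<omega>
      using grid_functional_tendsto[of u "u + h" \<omega>] u that by simp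
    show "(\<lambda>n. grid_functional (Suc n) (h / real (Suc n)) 0 \<omega>) \<longlonglongrightarrow> future_functional 0 h \<omega>"
      if "\<omega> \<in> space M" for \<omega>
      using grid_functional_tendsto[of 0 h \<omega>] u that by simp
  qed (use u in \<open>auto intro!: grid_functional_measurable future_functional_measurable eq simp del: grid_functional.simps\<close>)
qed

text \<open>By right continuity, \<open>X\<close> is a limit of functions that are constant in time
  on countably many cells and measurable in \<omega> on each. The outer \<open>max 0\<close> keeps
  the time attached to every cell in the range where \<open>X\<close> is measurable.\<close>

lemma X_jointly_measurable:
  "(\<lambda>(\<omega>, s). X (max 0 s) \<omega>) \<in> borel_measurable (M \<Otimes>\<^sub>M (lborel :: real measure))"
proof (rule borel_measurable_LIMSEQ_real)
  let ?d = "\<lambda>n. 1 / real (Suc n)"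
  let ?i = "\<lambda>n p. \<lfloor>(max 0 (snd p) - 0) / ?d n\<rfloor>"
  show "(\<lambda>p. X (max 0 (grid_right 0 (?d n) (max 0 (snd p)))) (fst p)) \<in> borel_measurable (M \<Otimes>\<^sub>M (lborel :: real measure))" for n
    unfolding grid_right_def
  proof (rule measurable_compose_countable[where g="?i n" and f="\<lambda>i p. X (max 0 (0 + (of_int i + 1) * ?d n)) (fst p)"])
    show "(\<lambda>p. X (max 0 (0 + (of_int i + 1) * ?d n)) (fst p)) \<in> borel_measurable (M \<Otimes>\<^sub>M (lborel :: real measure))" for i :: int
      by (rule measurable_compose[OF measurable_fst random_variable_X]) simp
    show "?i n \<in> measurable (M \<Otimes>\<^sub>M (lborel :: real measure)) (count_space UNIV)" by measurable
  qed
  fix p assume "p \<in> space (M \<Otimes>\<^sub>M (lborel :: real measure))"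
  then have p: "fst p \<in> space M" by (auto simp: space_pair_measure)
  have "(\<lambda>n. X (grid_right 0 (?d n) (max 0 (snd p))) (fst p)) \<longlonglongrightarrow> X (max 0 (snd p)) (fst p)"
    by (rule cadlag_grid_right[OF cadlag_X[OF p]]) (simp, simp, real_asymp)
  moreover have "max 0 (grid_right 0 (?d n) (max 0 (snd p))) = grid_right 0 (?d n) (max 0 (snd p))" for n
  proof -
    have "max 0 (snd p) < grid_right 0 (?d n) (max 0 (snd p))" by (rule grid_right_bounds) simp
    then show ?thesis by linarith
  qed
  ultimately show "(\<lambda>n. X (max 0 (grid_right 0 (?d n) (max 0 (snd p)))) (fst p)) \<longlonglongrightarrow> (\<lambda>(\<omega>, s). X (max 0 s) \<omega>) p"
    by (simp add: case_prod_beta)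
qed

end

section \<open>Laplace transforms of the process; absence of fixed discontinuities\<close>

context pii_semimartingale
begin

lemma nn_integral_jump_mixture_set:
  assumes "f \<in> borel_measurable borel"
  shows "(\<integral>\<^sup>+x. f x \<partial>jump_mixture t) = (\<integral>\<^sup>+s\<in>{0..t}. (\<integral>\<^sup>+x. f x \<partial>K s) \<partial>lborel)"
  unfolding nn_integral_jump_mixture(2)[OF assms] by (rule nn_integral_restrict_space) simp

lemma jump_mixture_small:
  "(\<integral>\<^sup>+x. ennreal (min (x\<^sup>2) \<bar>x\<bar>) \<partial>jump_mixture t) < \<infinity>"
proof -
  have "(\<integral>\<^sup>+x. ennreal (min (x\<^sup>2) \<bar>x\<bar>) \<partial>jump_mixture t) =
      (\<integral>\<^sup>+s\<in>{0..t}. (\<integral>\<^sup>+x. ennreal (min (x\<^sup>2) \<bar>x\<bar>) \<partial>K s) \<partial>lborel)"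
    by (rule nn_integral_jump_mixture_set) simp
  \<comment> \<open>The horizon is enlarged to \<open>max t 1\<close> because
    \<open>K_integrable\<close> asks for a positive one.\<close>
  also have "\<dots> \<le> (\<integral>\<^sup>+s\<in>{0..max t 1}. (\<integral>\<^sup>+x. ennreal (min (x\<^sup>2) \<bar>x\<bar>) \<partial>K s) \<partial>lborel)"
    by (intro nn_integral_mono) (auto simp: indicator_def)
  also have "\<dots> < \<infinity>" by (rule K_integrable) simp
  finally show ?thesis .
qed

lemma integrable_jump_mixture_min: "integrable (jump_mixture t) (\<lambda>x. min (x\<^sup>2) \<bar>x\<bar>)"
  by (rule integrableI_nonneg) (use jump_mixture_small[of t] in auto)

lemma set_integral_jump_mixture:
  fixes f :: "real \<Rightarrow> real"
  assumes "f \<in> borel_measurable borel" "integrable (jump_mixture t) f"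
  shows "(LINT s:{0..t}|lborel. (LINT x|K s. f x)) = (LINT x|jump_mixture t. f x)"
  using has_bochner_integral_jump_mixture_real[OF assms]
  by (simp add: has_bochner_integral_iff integral_restrict_space set_lebesgue_integral_def)

lemma set_integral_jump_mixture_complex:
  fixes f :: "real \<Rightarrow> complex"
  assumes "f \<in> borel_measurable borel" "integrable (jump_mixture t) f"
  shows "set_integrable lborel {0..t} (\<lambda>s. CLINT x|K s. f x)"
    and "(LINT s:{0..t}|lborel. (CLINT x|K s. f x)) = (CLINT x|jump_mixture t. f x)"
  using has_bochner_integral_jump_mixture_complex[OF assms]
  by (simp_all add: has_bochner_integral_iff integrable_restrict_space integral_restrict_space set_lebesgue_integral_def set_integrable_def)

lemma integrable_char_remainder:
  "integrable (jump_mixture t) (\<lambda>x. iexp (l * x) - 1 - \<i> * complex_of_real (l * x))"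
proof (rule Bochner_Integration.integrable_bound)
  show "integrable (jump_mixture t) (\<lambda>x. (l\<^sup>2 / 2 + 2 * \<bar>l\<bar>) * min (x\<^sup>2) \<bar>x\<bar>)"
    by (intro integrable_mult_right integrable_jump_mixture_min)
  show "AE x in jump_mixture t. norm (iexp (l * x) - 1 - \<i> * complex_of_real (l * x)) \<le>
      norm ((l\<^sup>2 / 2 + 2 * \<bar>l\<bar>) * min (x\<^sup>2) \<bar>x\<bar>)"
    using norm_iexp_remainder_le[of l] by (intro AE_I2) (auto intro: order.trans[OF _ abs_ge_self])
qed simp

lemma char_X_jump_mixture:
  assumes "t \<ge> 0"
  shows "char (distr M borel (X t)) l =
    exp (\<i> * complex_of_real (l * (LINT s:{0..t}|lborel. b s))
       - complex_of_real (l\<^sup>2 / 2 * (LINT s:{0..t}|lborel. c s))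
       + (CLINT x|jump_mixture t. iexp (l * x) - 1 - \<i> * complex_of_real (l * x)))"
  unfolding char_X[OF assms] set_integral_jump_mixture_complex(2)[OF _ integrable_char_remainder, simplified]
  by (subst set_integral_jump_mixture_complex(2)[OF _ integrable_char_remainder]) simp_all

lemma char_X_increment:
  assumes "0 \<le> s" "s \<le> t"
  shows "char (distr M borel (X t)) l =
    char (distr M borel (X s)) l * char (distr M borel (\<lambda>\<omega>. X t \<omega> - X s \<omega>)) l"
proof -
  have [measurable]: "X s \<in> borel_measurable M" "X t \<in> borel_measurable M"
    using assms by (auto intro: random_variable_X)
  have "distr M borel (X t) =
    distr (distr M (borel \<Otimes>\<^sub>M borel) (\<lambda>\<omega>. (X s \<omega>, X t \<omega> - X s \<omega>))) borel (\<lambda>(x, y). x + y)"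
    by (subst distr_distr) (simp_all add: comp_def)
  also have "\<dots> = convolution (distr M borel (X s)) (distr M borel (\<lambda>\<omega>. X t \<omega> - X s \<omega>))"
    unfolding convolution_def
    by (subst distr_pair_indep_from[OF subalgebra_natural_filtration X_measurable_natural_filtration indep_from_increment])
       (use assms in auto)
  finally show ?thesis by (simp add: char_convolution real_distribution_distr')
qed

lemma left_limit_tendsto:
  assumes "\<omega> \<in> space M" "u > 0"
  shows "((\<lambda>r. X r \<omega>) \<longlongrightarrow> left_limit (\<lambda>r. X r \<omega>) u) (at_left u)"
proof -
  obtain l where "((\<lambda>r. X r \<omega>) \<longlongrightarrow> l) (at_left u)"
    using cadlag_X[OF assms(1)] assms(2) unfolding cadlag_def by blast
  moreover from this have "Lim (at_left u) (\<lambda>r. X r \<omega>) = l" by (intro tendsto_Lim) auto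
  ultimately show ?thesis using assms(2) by (simp add: left_limit_def)
qed

text \<open>
  The characteristic function of \<open>X u - X s\<close> is a quotient of two continuous functions of time, hence
  tends to \<open>1\<close> as \<open>s\<close> increases to \<open>u\<close>.
\<close>

lemma left_limit_measurable_and_AE_eq:
  assumes u: "u \<ge> 0"
  shows "(\<lambda>\<omega>. left_limit (\<lambda>r. X r \<omega>) u) \<in> borel_measurable M \<and>
    (AE \<omega> in M. left_limit (\<lambda>r. X r \<omega>) u = X u \<omega>)"
proof (cases "u = 0")
  case True
  then show ?thesis by (simp add: left_limit_def random_variable_X)
next
  case False
  then have u: "u > 0" using assms by simp
  define s where "s = (\<lambda>n. u - u / real (n + 2))"
  have s: "s \<longlonglongrightarrow> u" unfolding s_def by real_asymp
  have s_lt: "s n < u" and s_ge: "0 \<le> s n" for n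
    using u by (auto simp: s_def field_simps)
  have [measurable]: "X u \<in> borel_measurable M" "X (s n) \<in> borel_measurable M" for n
    using u s_ge by (auto intro: random_variable_X)
  let ?L = "\<lambda>\<omega>. left_limit (\<lambda>r. X r \<omega>) u"
  have "filterlim s (at_left u) sequentially"
    using s s_lt unfolding filterlim_at by (auto intro!: always_eventually simp: less_imp_neq)
  then have lim: "(\<lambda>n. X (s n) \<omega>) \<longlonglongrightarrow> ?L \<omega>" if "\<omega> \<in> space M" for \<omega>
    by (rule filterlim_compose[OF left_limit_tendsto[OF that u]])
  have L [measurable]: "?L \<in> borel_measurable M"
    by (rule borel_measurable_LIMSEQ_real[OF lim]) auto
  have "char (distr M borel (\<lambda>\<omega>. X u \<omega> - ?L \<omega>)) l = 1" for l
  proof (rule LIMSEQ_unique)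
    show "(\<lambda>n. char (distr M borel (\<lambda>\<omega>. X u \<omega> - X (s n) \<omega>)) l) \<longlonglongrightarrow> char (distr M borel (\<lambda>\<omega>. X u \<omega> - ?L \<omega>)) l"
      by (rule char_distr_tendsto) (auto intro!: tendsto_intros lim)
    have nz: "char (distr M borel (X r)) l \<noteq> 0" if "0 \<le> r" for r
      using char_X[OF that, of l] by simp
    \<comment> \<open>All three integrals up to \<open>s n\<close> converge to those up to
      \<open>u\<close>, since a single time has Lebesgue measure 0: the characteristics have no atom
      in time.\<close>
    have "(\<lambda>n. char (distr M borel (X (s n))) l) \<longlonglongrightarrow> char (distr M borel (X u)) l"
      unfolding char_X[OF s_ge] char_X[OF less_imp_le[OF u]]
      using b_locally_integrable[OF u] c_locally_integrable[OF u] set_integral_jump_mixture_complex(1)[OF _ integrable_char_remainder, of l u]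
      by (intro tendsto_intros set_integral_tendsto_upper s s_lt) simp_all
    then have "(\<lambda>n. char (distr M borel (X u)) l / char (distr M borel (X (s n))) l) \<longlonglongrightarrow> char (distr M borel (X u)) l / char (distr M borel (X u)) l"
      using nz u by (intro tendsto_intros) auto
    moreover have "char (distr M borel (X u)) l / char (distr M borel (X (s n))) l = char (distr M borel (\<lambda>\<omega>. X u \<omega> - X (s n) \<omega>)) l" for n
      using char_X_increment[OF s_ge[of n] less_imp_le[OF s_lt[of n]], of l] nz[OF s_ge[of n]] by simp
    ultimately show "(\<lambda>n. char (distr M borel (\<lambda>\<omega>. X u \<omega> - X (s n) \<omega>)) l) \<longlonglongrightarrow> 1"
      using nz[of u] u by simp
  qed
  then have "distr M borel (\<lambda>\<omega>. X u \<omega> - ?L \<omega>) = return borel 0"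
    by (intro Levy_uniqueness real_distribution_distr' real_distribution_return ext) (simp_all add: char_return)
  moreover have "AE x in return borel (0::real). x = 0" by (subst AE_return) auto
  ultimately have "AE x in distr M borel (\<lambda>\<omega>. X u \<omega> - ?L \<omega>). x = 0" by (simp only:)
  then have "AE \<omega> in M. X u \<omega> - ?L \<omega> = 0" by (subst (asm) AE_distr_iff) auto
  then have "AE \<omega> in M. ?L \<omega> = X u \<omega>" by eventually_elim simp
  with L show ?thesis by simp
qed

lemma jump_mixture_large:
  assumes jumps: "(\<integral>\<^sup>+ s\<in>{0..t}. (\<integral>\<^sup>+ x\<in>{x. x < -1}. ennreal (exp (- a * x)) \<partial>K s) \<partial>lborel) < \<infinity>"
    and s: "s \<le> t"
  shows "(\<integral>\<^sup>+x. ennreal (indicator {..<-1} x * exp (- a * x)) \<partial>jump_mixture s) < \<infinity>"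
proof -
  have "(\<integral>\<^sup>+x. ennreal (indicator {..<-1} x * exp (- a * x)) \<partial>jump_mixture s) =
      (\<integral>\<^sup>+ r\<in>{0..s}. (\<integral>\<^sup>+ x. ennreal (indicator {..<-1} x * exp (- a * x)) \<partial>K r) \<partial>lborel)"
    by (rule nn_integral_jump_mixture_set) simp
  also have "\<dots> \<le> (\<integral>\<^sup>+ r\<in>{0..t}. (\<integral>\<^sup>+ x\<in>{x. x < -1}. ennreal (exp (- a * x)) \<partial>K r) \<partial>lborel)"
    using s by (intro nn_integral_mono mult_mono) (auto simp: indicator_def intro!: nn_integral_mono)
  finally show ?thesis using jumps by (rule le_less_trans)
qed

lemma integrable_laplace_remainder:
  assumes \<alpha>: "\<alpha> > 0" "\<delta> > 0"
    and jumps: "(\<integral>\<^sup>+ s\<in>{0..t}. (\<integral>\<^sup>+ x\<in>{x. x < -1}. ennreal (exp (- (\<alpha> + \<delta>) * x)) \<partial>K s) \<partial>lborel) < \<infinity>"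
    and s: "s \<le> t"
  shows "integrable (jump_mixture s) (\<lambda>x. exp (- \<alpha> * x) - 1 + \<alpha> * x)"
proof (rule Bochner_Integration.integrable_bound)
  have "integrable (jump_mixture s) (\<lambda>x. indicator {..<-1} x * exp (- (\<alpha> + \<delta>) * x))"
    using jump_mixture_large[OF jumps s] by (intro integrableI_nonneg) auto
  then show "integrable (jump_mixture s) (\<lambda>x. (exp \<alpha> * \<alpha>\<^sup>2 + \<alpha> + 1) * (min (x\<^sup>2) \<bar>x\<bar> + indicator {..<-1} x * exp (- (\<alpha> + \<delta>) * x)))"
    by (intro integrable_mult_right Bochner_Integration.integrable_add integrable_jump_mixture_min)
  show "AE x in jump_mixture s. norm (exp (- \<alpha> * x) - 1 + \<alpha> * x) \<le>
    norm ((exp \<alpha> * \<alpha>\<^sup>2 + \<alpha> + 1) * (min (x\<^sup>2) \<bar>x\<bar> + indicator {..<-1} x * exp (- (\<alpha> + \<delta>) * x)))"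
  proof (intro AE_I2)
    fix x
    show "norm (exp (- \<alpha> * x) - 1 + \<alpha> * x) \<le>
      norm ((exp \<alpha> * \<alpha>\<^sup>2 + \<alpha> + 1) * (min (x\<^sup>2) \<bar>x\<bar> + indicator {..<-1} x * exp (- (\<alpha> + \<delta>) * x)))"
      using exp_remainder_le[of \<alpha> "\<alpha> + \<delta>" x] exp_remainder_nonneg[of \<alpha> x] \<alpha>
      unfolding real_norm_def by linarith
  qed
qed simp

text \<open>\<open>laplace_transform_of_char\<close> with jump measure \<open>jump_mixture s\<close>
  and orders \<alpha> < \<alpha> + \<delta>; the condition on large negative jumps up to
  \<open>t\<close> covers every earlier \<open>s\<close>.\<close>

lemma laplace_X:
  assumes \<alpha>: "\<alpha> > 0" "\<delta> > 0"
    and jumps: "(\<integral>\<^sup>+ s\<in>{0..t}. (\<integral>\<^sup>+ x\<in>{x. x < -1}. ennreal (exp (- (\<alpha> + \<delta>) * x)) \<partial>K s) \<partial>lborel) < \<infinity>"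
    and s: "0 \<le> s" "s \<le> t"
  shows "integrable M (\<lambda>\<omega>. exp (- \<alpha> * X s \<omega>))"
    and "(LINT \<omega>|M. exp (- \<alpha> * X s \<omega>)) = exp (- laplace_exponent b c K s \<alpha>)"
proof -
  have X [measurable]: "X s \<in> borel_measurable M" using s by (intro random_variable_X)
  note large = jump_mixture_large[OF jumps s(2)]
  have C: "0 \<le> (LINT s:{0..s}|lborel. c s)"
    unfolding set_lebesgue_integral_def using c_nonneg
    by (intro integral_nonneg_AE AE_I2) (auto simp: indicator_def)
  have "\<alpha> < \<alpha> + \<delta>" using \<alpha> by simp
  note L = laplace_transform_of_char[OF sets_jump_mixture jump_mixture_small large \<alpha>(1) this C
      real_distribution_distr'[OF X] char_X_jump_mixture[OF s(1)]]
  show "integrable M (\<lambda>\<omega>. exp (- \<alpha> * X s \<omega>))"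
    using L(1) by (simp add: integrable_distr_eq)
  note f = integrable_laplace_remainder[OF \<alpha> jumps s(2)]
  have "(LINT \<omega>|M. exp (- \<alpha> * X s \<omega>)) = (LINT x|distr M borel (X s). exp (- \<alpha> * x))"
    by (simp add: integral_distr)
  also have "\<dots> = exp (- laplace_exponent b c K s \<alpha>)"
    unfolding L(2) laplace_exponent_def set_integral_jump_mixture[OF _ f, simplified]
    by (subst set_integral_jump_mixture[OF _ f]) (simp_all add: algebra_simps)
  finally show "(LINT \<omega>|M. exp (- \<alpha> * X s \<omega>)) = exp (- laplace_exponent b c K s \<alpha>)" .
qed

end

section \<open>The recursion for the moments\<close>

lemma abs_set_integral_le:
  fixes h :: "real \<Rightarrow> real"
  assumes h: "set_integrable lborel {0..t} h" and s: "s \<le> t"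
  shows "\<bar>LINT r:{0..s}|lborel. h r\<bar> \<le> (LINT r:{0..t}|lborel. \<bar>h r\<bar>)"
proof -
  have i: "integrable lborel (\<lambda>r. indicator {0..s} r *\<^sub>R h r)"
    using set_integrable_subset[OF h, of "{0..s}"] s unfolding set_integrable_def by auto
  have "\<bar>LINT r:{0..s}|lborel. h r\<bar> \<le> (LINT r|lborel. \<bar>indicator {0..s} r *\<^sub>R h r\<bar>)"
    unfolding set_lebesgue_integral_def by (rule integral_abs_bound)
  also have "\<dots> \<le> (LINT r|lborel. indicator {0..t} r *\<^sub>R \<bar>h r\<bar>)"
    using set_integrable_abs[OF h] i s unfolding set_integrable_def
    by (intro integral_mono integrable_abs) (auto simp: indicator_def)
  finally show ?thesis by (simp add: set_lebesgue_integral_def)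
qed

lemma cadlag_cmult:
  assumes "cadlag f" shows "cadlag (\<lambda>s. a * f s)"
proof -
  have "((\<lambda>s. a * f s) \<longlongrightarrow> a * l) F" if "(f \<longlongrightarrow> l) F" for l and F :: "real filter"
    using that by (intro tendsto_intros)
  with assms show ?thesis unfolding cadlag_def by blast
qed

context pii_semimartingale
begin

text \<open>Absolute integrals over the whole of [0, t] bound the exponent at all earlier times at
  once; this makes the exponential moments of the increments uniformly bounded.\<close>

lemma laplace_exponent_bounded:
  assumes \<alpha>: "\<alpha> > 0" "\<delta> > 0"
    and jumps: "(\<integral>\<^sup>+ s\<in>{0..t}. (\<integral>\<^sup>+ x\<in>{x. x < -1}. ennreal (exp (- (\<alpha> + \<delta>) * x)) \<partial>K s) \<partial>lborel) < \<infinity>"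
    and t: "t > 0"
  obtains D where "\<And>s. s \<in> {0..t} \<Longrightarrow> \<bar>laplace_exponent b c K s \<alpha>\<bar> \<le> D"
proof -
  define k where "k = (\<lambda>s. LINT x|K s. exp (- \<alpha> * x) - 1 + \<alpha> * x)"
  have k: "set_integrable lborel {0..t} k"
    using has_bochner_integral_jump_mixture_real[OF _ integrable_laplace_remainder[OF \<alpha> jumps order.refl]]
    by (simp add: k_def has_bochner_integral_iff integrable_restrict_space set_integrable_def)
  show ?thesis
  proof (rule that)
    fix s assume "s \<in> {0..t}"
    then have s: "s \<le> t" by simp
    have "\<bar>laplace_exponent b c K s \<alpha>\<bar> \<le> \<bar>\<alpha> * (LINT s:{0..s}|lborel. b s)\<bar> + \<bar>\<alpha>\<^sup>2 / 2 * (LINT s:{0..s}|lborel. c s)\<bar>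
        + \<bar>LINT s:{0..s}|lborel. k s\<bar>"
      unfolding laplace_exponent_def k_def by linarith
    also have "\<dots> = \<alpha> * \<bar>LINT s:{0..s}|lborel. b s\<bar> + \<alpha>\<^sup>2 / 2 * \<bar>LINT s:{0..s}|lborel. c s\<bar>
        + \<bar>LINT s:{0..s}|lborel. k s\<bar>"
      using \<alpha> by (simp add: abs_mult)
    also have "\<dots> \<le> \<alpha> * (LINT r:{0..t}|lborel. \<bar>b r\<bar>) + \<alpha>\<^sup>2 / 2 * (LINT r:{0..t}|lborel. \<bar>c r\<bar>)
        + (LINT r:{0..t}|lborel. \<bar>k r\<bar>)"
      using \<alpha> b_locally_integrable[OF t] c_locally_integrable[OF t] k
      by (intro add_mono mult_left_mono abs_set_integral_le s) auto
    finally show "\<bar>laplace_exponent b c K s \<alpha>\<bar> \<le> \<alpha> * (LINT r:{0..t}|lborel. \<bar>b r\<bar>) + \<alpha>\<^sup>2 / 2 * (LINT r:{0..t}|lborel. \<bar>c r\<bar>)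
        + (LINT r:{0..t}|lborel. \<bar>k r\<bar>)" .
  qed
qed

lemma X_jointly_measurable':
  assumes "f \<in> borel_measurable N" "g \<in> measurable N M"
  shows "(\<lambda>p. X (max 0 (f p)) (g p)) \<in> borel_measurable N"
proof -
  have "(\<lambda>p. (g p, f p)) \<in> measurable N (M \<Otimes>\<^sub>M lborel)"
    using assms by (simp cong: measurable_cong_sets)
  from measurable_compose[OF this X_jointly_measurable] show ?thesis by simp
qed

lemma cadlag_exp_neg_X:
  "\<omega> \<in> space M \<Longrightarrow> cadlag (\<lambda>s. exp (- X s \<omega>))"
  using cadlag_exp_neg_diff[OF cadlag_X, of \<omega> 0] by simp

definition tail_functional :: "real \<Rightarrow> 'a \<Rightarrow> real \<Rightarrow> real" where
  "tail_functional t \<omega> u = (LINT s:{u..t}|lborel. exp (- X s \<omega>))"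

lemma tail_functional_eq: "tail_functional t \<omega> u = exp (- X u \<omega>) * future_functional u t \<omega>"
proof -
  have "exp (- X u \<omega>) * future_functional u t \<omega> =
      (LINT s:{u..t}|lborel. exp (- X u \<omega>) * exp (- (X s \<omega> - X u \<omega>)))"
    unfolding future_functional_def by simp
  also have "\<dots> = tail_functional t \<omega> u"
    unfolding tail_functional_def by (simp add: exp_add[symmetric])
  finally show ?thesis by simp
qed

lemma future_functional_nonneg: "0 \<le> future_functional u t \<omega>"
  unfolding future_functional_def set_lebesgue_integral_def
  by (intro integral_nonneg_AE AE_I2) (simp add: indicator_def)

lemma future_functional_0: "\<omega> \<in> space M \<Longrightarrow> future_functional 0 t \<omega> = exp_functional X t \<omega>"
  by (simp add: future_functional_def exp_functional_def X_zero)

text \<open>Separates the possible jump at \<open>u\<close> as a factor, which is almost surely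
  1.\<close>

lemma exp_functional_from_eq:
  "exp_functional_from X u t \<omega> = exp (left_limit (\<lambda>r. X r \<omega>) u - X u \<omega>) * future_functional u t \<omega>"
proof -
  have "exp (left_limit (\<lambda>r. X r \<omega>) u - X u \<omega>) * future_functional u t \<omega> =
      (LINT s:{u..t}|lborel. exp (left_limit (\<lambda>r. X r \<omega>) u - X u \<omega>) * exp (- (X s \<omega> - X u \<omega>)))"
    unfolding future_functional_def by simp
  also have "\<dots> = exp_functional_from X u t \<omega>"
    unfolding exp_functional_from_def by (simp add: exp_add[symmetric])
  finally show ?thesis by simp
qed

lemma exp_functional_from_AE_eq:
  assumes "0 \<le> u" "u \<le> t"
  shows "exp_functional_from X u t \<in> borel_measurable M"
    and "AE \<omega> in M. exp_functional_from X u t \<omega> = future_functional u t \<omega>"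
proof -
  have [measurable]: "X u \<in> borel_measurable M" "(\<lambda>\<omega>. left_limit (\<lambda>r. X r \<omega>) u) \<in> borel_measurable M"
    "future_functional u t \<in> borel_measurable M"
    using assms left_limit_measurable_and_AE_eq[of u] random_variable_X future_functional_measurable by auto
  show "exp_functional_from X u t \<in> borel_measurable M"
    unfolding exp_functional_from_eq[abs_def] by measurable
  have "AE \<omega> in M. left_limit (\<lambda>r. X r \<omega>) u = X u \<omega>"
    using left_limit_measurable_and_AE_eq[of u] assms by simp
  then show "AE \<omega> in M. exp_functional_from X u t \<omega> = future_functional u t \<omega>"
    by eventually_elim (simp add: exp_functional_from_eq)
qed

text \<open>The moving lower limit becomes a condition on the triple (\<omega>, u, s), so that the
  measurability of parameter integrals applies.\<close>

lemma tail_functional_measurable: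
  "(\<lambda>(\<omega>, u). indicator {0..t} u * tail_functional t \<omega> u) \<in> borel_measurable (M \<Otimes>\<^sub>M lborel)"
proof -
  let ?N = "M \<Otimes>\<^sub>M (lborel :: real measure)"
  have *: "indicator {0..t} u * tail_functional t \<omega> u =
      (LINT s|lborel. (if 0 \<le> u \<and> u \<le> t \<and> u \<le> s \<and> s \<le> t then exp (- X (max 0 s) \<omega>) else 0))" for \<omega> u
    unfolding tail_functional_def set_lebesgue_integral_def
    by (subst integral_mult_right_zero[symmetric]) (auto intro!: Bochner_Integration.integral_cong simp: indicator_def max_def)
  have "(\<lambda>(p, s). if 0 \<le> snd p \<and> snd p \<le> t \<and> snd p \<le> s \<and> s \<le> t then exp (- X (max 0 s) (fst p)) else 0)
      \<in> borel_measurable (?N \<Otimes>\<^sub>M (lborel :: real measure))"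
  proof -
    have [measurable]: "(\<lambda>q. X (max 0 (snd q)) (fst (fst q))) \<in> borel_measurable (?N \<Otimes>\<^sub>M (lborel :: real measure))"
      by (rule X_jointly_measurable') measurable
    show ?thesis unfolding case_prod_beta by measurable
  qed
  then have "(\<lambda>p. LINT s|lborel. (if 0 \<le> snd p \<and> snd p \<le> t \<and> snd p \<le> s \<and> s \<le> t then exp (- X (max 0 s) (fst p)) else 0))
      \<in> borel_measurable ?N"
    by (rule lborel.borel_measurable_lebesgue_integral)
  then show ?thesis by (simp add: * case_prod_beta)
qed

lemma exp_neg_X_lower_bound:
  assumes "\<omega> \<in> space M" "t \<ge> 0"
  obtains m where "m > 0" "\<And>s. s \<in> {0..t} \<Longrightarrow> m \<le> exp (- X s \<omega>)"
proof -
  obtain B where B: "\<forall>x\<in>{0..t}. \<bar>X x \<omega>\<bar> \<le> B" using cadlag_bounded[OF cadlag_X[OF assms(1)] assms(2)] by auto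
  show ?thesis by (rule that[of "exp (- B)"]) (use B in force)+
qed

text \<open>The pathwise identity in nonnegative form, ready for Tonelli; \<open>max 0 u\<close>
  matches the jointly measurable version of \<open>X\<close>.\<close>

lemma exp_functional_powr_eq:
  assumes \<omega>: "\<omega> \<in> space M" and \<alpha>: "\<alpha> \<ge> 1" and t: "t \<ge> 0"
  shows "ennreal (exp_functional X t \<omega> powr \<alpha>) =
    (\<integral>\<^sup>+u. ennreal (indicator {0..t} u * (\<alpha> * tail_functional t \<omega> u powr (\<alpha> - 1) * exp (- X (max 0 u) \<omega>))) \<partial>lborel)"
proof -
  obtain m where m: "m > 0" "\<And>s. s \<in> {0..t} \<Longrightarrow> m \<le> exp (- X s \<omega>)"
    using exp_neg_X_lower_bound[OF \<omega> t] by blast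
  note I' = powr_tail_integral[OF set_integrable_cadlag[OF cadlag_exp_neg_X[OF \<omega>] order.refl] m \<alpha> t]
  have I: "set_integrable lborel {0..t} (\<lambda>u. \<alpha> * tail_functional t \<omega> u powr (\<alpha> - 1) * exp (- X u \<omega>))"
    "(LINT u:{0..t}|lborel. \<alpha> * tail_functional t \<omega> u powr (\<alpha> - 1) * exp (- X u \<omega>)) = tail_functional t \<omega> 0 powr \<alpha>"
    unfolding tail_functional_def by (rule I', assumption)+
  have "ennreal (exp_functional X t \<omega> powr \<alpha>) =
      ennreal (LINT u:{0..t}|lborel. \<alpha> * tail_functional t \<omega> u powr (\<alpha> - 1) * exp (- X u \<omega>))"
    unfolding I(2) by (simp add: tail_functional_def exp_functional_def)
  also have "\<dots> = (\<integral>\<^sup>+u. ennreal (indicator {0..t} u *\<^sub>R (\<alpha> * tail_functional t \<omega> u powr (\<alpha> - 1) * exp (- X u \<omega>))) \<partial>lborel)"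
    unfolding set_lebesgue_integral_def
    by (intro nn_integral_eq_integral[symmetric] I(1)[unfolded set_integrable_def] AE_I2
        scaleR_nonneg_nonneg mult_nonneg_nonneg) (use \<alpha> in simp_all)
  also have "\<dots> = (\<integral>\<^sup>+u. ennreal (indicator {0..t} u * (\<alpha> * tail_functional t \<omega> u powr (\<alpha> - 1) * exp (- X (max 0 u) \<omega>))) \<partial>lborel)"
  proof (rule nn_integral_cong)
    fix u
    show "ennreal (indicator {0..t} u *\<^sub>R (\<alpha> * tail_functional t \<omega> u powr (\<alpha> - 1) * exp (- X u \<omega>))) =
        ennreal (indicator {0..t} u * (\<alpha> * tail_functional t \<omega> u powr (\<alpha> - 1) * exp (- X (max 0 u) \<omega>)))"
      by (cases "u \<in> {0..t}") simp_all
  qed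
  finally show ?thesis .
qed

lemma tail_functional_powr_eq:
  assumes "\<alpha> \<ge> 1"
  shows "tail_functional t \<omega> u powr (\<alpha> - 1) * exp (- X u \<omega>) =
    exp (- \<alpha> * X u \<omega>) * future_functional u t \<omega> powr (\<alpha> - 1)"
  unfolding tail_functional_eq
  by (simp add: powr_mult future_functional_nonneg exp_powr_real exp_add[symmetric] mult.commute[of _ "exp (- X u \<omega>)"]
      mult.assoc[symmetric]) (simp add: algebra_simps exp_add[symmetric])

text \<open>Independence factors E (exp (- \<alpha> X s)) at time \<open>u\<close>; the factor
  belonging to \<open>X u\<close> is positive and finite, so it can be divided out.\<close>

lemma nn_integral_exp_increment:
  assumes \<alpha>: "\<alpha> > 0" "\<delta> > 0"
    and jumps: "(\<integral>\<^sup>+ s\<in>{0..t}. (\<integral>\<^sup>+ x\<in>{x. x < -1}. ennreal (exp (- (\<alpha> + \<delta>) * x)) \<partial>K s) \<partial>lborel) < \<infinity>"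
    and s: "0 \<le> u" "u \<le> s" "s \<le> t"
  shows "(\<integral>\<^sup>+\<omega>. ennreal (exp (- \<alpha> * (X s \<omega> - X u \<omega>))) \<partial>M) =
    ennreal (exp (laplace_exponent b c K u \<alpha> - laplace_exponent b c K s \<alpha>))"
proof -
  have nn: "(\<integral>\<^sup>+\<omega>. ennreal (exp (- \<alpha> * X r \<omega>)) \<partial>M) = ennreal (exp (- laplace_exponent b c K r \<alpha>))"
    if "0 \<le> r" "r \<le> t" for r
    using laplace_X[OF \<alpha> jumps that] by (subst nn_integral_eq_integral) auto
  have "(\<integral>\<^sup>+\<omega>. ennreal (exp (- \<alpha> * X u \<omega>)) * ennreal (exp (- \<alpha> * (X s \<omega> - X u \<omega>))) \<partial>M) =
      (\<integral>\<^sup>+\<omega>. ennreal (exp (- \<alpha> * X u \<omega>)) \<partial>M) * (\<integral>\<^sup>+\<omega>. ennreal (exp (- \<alpha> * (X s \<omega> - X u \<omega>))) \<partial>M)"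
    by (rule nn_integral_indep_from[OF subalgebra_natural_filtration X_measurable_natural_filtration indep_from_increment])
       (use s in auto)
  moreover have "ennreal (exp (- \<alpha> * X u \<omega>)) * ennreal (exp (- \<alpha> * (X s \<omega> - X u \<omega>))) = ennreal (exp (- \<alpha> * X s \<omega>))" for \<omega>
    by (simp add: ennreal_mult[symmetric] exp_add[symmetric] algebra_simps)
  ultimately have eq: "ennreal (exp (- laplace_exponent b c K s \<alpha>)) =
      ennreal (exp (- laplace_exponent b c K u \<alpha>)) * (\<integral>\<^sup>+\<omega>. ennreal (exp (- \<alpha> * (X s \<omega> - X u \<omega>))) \<partial>M)"
    using nn[of s] nn[of u] s by simp
  have "ennreal (exp (laplace_exponent b c K u \<alpha>)) * ennreal (exp (- laplace_exponent b c K u \<alpha>)) = 1"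
    by (simp add: ennreal_mult[symmetric] exp_add[symmetric])
  then have "(\<integral>\<^sup>+\<omega>. ennreal (exp (- \<alpha> * (X s \<omega> - X u \<omega>))) \<partial>M) =
      ennreal (exp (laplace_exponent b c K u \<alpha>)) * ennreal (exp (- laplace_exponent b c K s \<alpha>))"
    unfolding eq by (simp add: mult.assoc[symmetric])
  then show ?thesis by (simp add: ennreal_mult[symmetric] exp_add[symmetric])
qed

text \<open>Jensen in time, Tonelli and the bounded moments of the increments give order \<alpha>;
  order \<alpha> - 1 follows from y^(\<alpha> - 1) <= 1 + y^\<alpha>.\<close>

lemma integrable_future_functional_powr:
  assumes \<alpha>: "\<alpha> \<ge> 1" "\<delta> > 0"
    and jumps: "(\<integral>\<^sup>+ s\<in>{0..t}. (\<integral>\<^sup>+ x\<in>{x. x < -1}. ennreal (exp (- (\<alpha> + \<delta>) * x)) \<partial>K s) \<partial>lborel) < \<infinity>"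
    and u: "0 \<le> u" "u \<le> t"
  shows "integrable M (\<lambda>\<omega>. future_functional u t \<omega> powr \<alpha>)"
    and "integrable M (\<lambda>\<omega>. future_functional u t \<omega> powr (\<alpha> - 1))"
proof -
  have \<alpha>0: "\<alpha> > 0" using \<alpha> by simp
  have m [measurable]: "future_functional u t \<in> borel_measurable M"
    by (rule future_functional_measurable[OF u])
  show 1: "integrable M (\<lambda>\<omega>. future_functional u t \<omega> powr \<alpha>)"
  proof (cases "u = t")
    case True
    then show ?thesis using \<alpha> by (simp add: future_functional_degenerate)
  next
    case False
    then have ut: "u < t" using u by simp
    interpret pair_sigma_finite M lborel ..
    have [measurable]: "X u \<in> borel_measurable M" by (rule random_variable_X[OF u(1)])
    obtain D where D: "\<And>s. s \<in> {0..t} \<Longrightarrow> \<bar>laplace_exponent b c K s \<alpha>\<bar> \<le> D"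
      using laplace_exponent_bounded[OF \<alpha>0 \<alpha>(2) jumps] ut u by auto
    \<comment> \<open>\<open>max 0 s\<close> gives joint measurability, and the indicator hides the
      change at negative times.\<close>
    define E where "E = (\<lambda>\<omega> s. ennreal (indicator {u..t} s * exp (- \<alpha> * (X (max 0 s) \<omega> - X u \<omega>))))"
    have Em: "case_prod E \<in> borel_measurable (M \<Otimes>\<^sub>M lborel)"
    proof -
      have [measurable]: "(\<lambda>q. X (max 0 (snd q)) (fst q)) \<in> borel_measurable (M \<Otimes>\<^sub>M (lborel :: real measure))"
        by (rule X_jointly_measurable') measurable
      show ?thesis unfolding E_def case_prod_beta by measurable
    qed
    have le: "ennreal (future_functional u t \<omega> powr \<alpha>) \<le> ennreal ((t - u) powr (\<alpha> - 1)) * (\<integral>\<^sup>+s. E \<omega> s \<partial>lborel)"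
      if \<omega>: "\<omega> \<in> space M" for \<omega>
    proof -
      let ?g = "\<lambda>s. exp (- (X s \<omega> - X u \<omega>))"
      have g\<alpha>: "?g s powr \<alpha> = exp (- (\<alpha> * X s \<omega> - \<alpha> * X u \<omega>))" for s
        by (simp add: exp_powr_real algebra_simps)
      have i2: "set_integrable lborel {u..t} (\<lambda>s. ?g s powr \<alpha>)"
        unfolding g\<alpha> by (intro set_integrable_cadlag cadlag_exp_neg_diff cadlag_cmult cadlag_X \<omega> u)
      have "future_functional u t \<omega> powr \<alpha> \<le> (t - u) powr (\<alpha> - 1) * (LINT s:{u..t}|lborel. ?g s powr \<alpha>)"
        unfolding future_functional_def
        by (rule powr_integral_le[OF set_integrable_cadlag[OF cadlag_exp_neg_diff[OF cadlag_X[OF \<omega>]] u(1)] _ i2 \<alpha>(1) ut]) simp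
      then have 1: "ennreal (future_functional u t \<omega> powr \<alpha>) \<le> ennreal ((t - u) powr (\<alpha> - 1)) * ennreal (LINT s:{u..t}|lborel. ?g s powr \<alpha>)"
        by (simp add: ennreal_mult'[symmetric] ennreal_leI)
      have "ennreal (LINT s:{u..t}|lborel. ?g s powr \<alpha>) = (\<integral>\<^sup>+s. ennreal (indicator {u..t} s *\<^sub>R (?g s powr \<alpha>)) \<partial>lborel)"
        unfolding set_lebesgue_integral_def
        by (intro nn_integral_eq_integral[symmetric] i2[unfolded set_integrable_def] AE_I2) simp
      also have "\<dots> = (\<integral>\<^sup>+s. E \<omega> s \<partial>lborel)"
      proof (rule nn_integral_cong)
        fix s
        show "ennreal (indicator {u..t} s *\<^sub>R (?g s powr \<alpha>)) = E \<omega> s"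
          unfolding g\<alpha> E_def using u by (cases "s \<in> {u..t}") (simp_all add: right_diff_distrib)
      qed
      finally show ?thesis using 1 by (simp only:)
    qed
    have "(\<integral>\<^sup>+\<omega>. ennreal (future_functional u t \<omega> powr \<alpha>) \<partial>M) \<le>
        (\<integral>\<^sup>+\<omega>. ennreal ((t - u) powr (\<alpha> - 1)) * (\<integral>\<^sup>+s. E \<omega> s \<partial>lborel) \<partial>M)"
      by (intro nn_integral_mono le)
    also have "\<dots> = ennreal ((t - u) powr (\<alpha> - 1)) * (\<integral>\<^sup>+\<omega>. \<integral>\<^sup>+s. E \<omega> s \<partial>lborel \<partial>M)"
      using lborel.borel_measurable_nn_integral[OF Em] by (intro nn_integral_cmult) simp
    also have "(\<integral>\<^sup>+\<omega>. \<integral>\<^sup>+s. E \<omega> s \<partial>lborel \<partial>M) = (\<integral>\<^sup>+s. \<integral>\<^sup>+\<omega>. E \<omega> s \<partial>M \<partial>lborel)"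
      by (rule Fubini'[OF Em, symmetric])
    also have "\<dots> \<le> (\<integral>\<^sup>+s. ennreal (exp (2 * D)) * indicator {u..t} s \<partial>lborel)"
    proof (intro nn_integral_mono)
      fix s
      show "(\<integral>\<^sup>+\<omega>. E \<omega> s \<partial>M) \<le> ennreal (exp (2 * D)) * indicator {u..t} s"
      proof (cases "s \<in> {u..t}")
        case True
        then have "(\<integral>\<^sup>+\<omega>. E \<omega> s \<partial>M) = ennreal (exp (laplace_exponent b c K u \<alpha> - laplace_exponent b c K s \<alpha>))"
          using nn_integral_exp_increment[OF \<alpha>0 \<alpha>(2) jumps, of u s] u by (simp add: E_def)
        \<comment> \<open>Two values of the Laplace exponent, each at most \<open>D\<close> in
          modulus.\<close>
        also have "\<dots> \<le> ennreal (exp (2 * D))"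
          using D[of u] D[of s] True u by (intro ennreal_leI) auto
        finally show ?thesis using True by simp
      qed (simp add: E_def)
    qed
    also have "\<dots> = ennreal (exp (2 * D)) * ennreal (t - u)"
      using ut by (subst nn_integral_cmult) auto
    finally have "(\<integral>\<^sup>+\<omega>. ennreal (future_functional u t \<omega> powr \<alpha>) \<partial>M) \<le>
      ennreal ((t - u) powr (\<alpha> - 1)) * (ennreal (exp (2 * D)) * ennreal (t - u))"
      by (simp add: mult_left_mono)
    also have "\<dots> < \<infinity>" by (simp add: ennreal_mult_less_top)
    finally show ?thesis by (intro integrableI_nonneg) auto
  qed
  have "integrable M (\<lambda>\<omega>. 1 + future_functional u t \<omega> powr \<alpha>)" using 1 by simp
  then show "integrable M (\<lambda>\<omega>. future_functional u t \<omega> powr (\<alpha> - 1))"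
  proof (rule Bochner_Integration.integrable_bound)
    show "AE \<omega> in M. norm (future_functional u t \<omega> powr (\<alpha> - 1)) \<le> norm (1 + future_functional u t \<omega> powr \<alpha>)"
    proof (intro AE_I2)
      fix \<omega>
      have "y powr (\<alpha> - 1) \<le> 1 + y powr \<alpha>" if "0 \<le> y" for y :: real
      proof (cases "y \<le> 1")
        case True
        then have "y powr (\<alpha> - 1) \<le> 1" using that \<alpha> by (cases "y = 0") (auto intro: powr_le1)
        then show ?thesis using powr_ge_zero[of y \<alpha>] by linarith
      next
        case False
        then have "y powr (\<alpha> - 1) \<le> y powr \<alpha>" by (intro powr_mono) auto
        then show ?thesis by simp
      qed
      from this[OF future_functional_nonneg]
      show "norm (future_functional u t \<omega> powr (\<alpha> - 1)) \<le> norm (1 + future_functional u t \<omega> powr \<alpha>)" by simp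
    qed
  qed measurable
qed

text \<open>Tonelli for the pathwise identity. With nonnegative integrals throughout, finiteness of
  the moment yields the integrability of the right-hand integrand as a by-product.\<close>

theorem moment_recursion:
  assumes \<alpha>: "\<alpha> \<ge> 1" "\<delta> > 0" and t: "t > 0"
    and jumps: "(\<integral>\<^sup>+ s\<in>{0..t}. (\<integral>\<^sup>+ x\<in>{x. x < -1}. ennreal (exp (- (\<alpha> + \<delta>) * x)) \<partial>K s) \<partial>lborel) < \<infinity>"
  shows "integrable M (\<lambda>\<omega>. exp_functional X t \<omega> powr \<alpha>)"
    and "integrable M (\<lambda>\<omega>. exp_functional X t \<omega> powr (\<alpha> - 1))"
    and "u \<in> {0..t} \<Longrightarrow> integrable M (\<lambda>\<omega>. exp_functional_from X u t \<omega> powr (\<alpha> - 1))"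
    and "u \<in> {0..t} \<Longrightarrow> moment_from M X (\<alpha> - 1) u t = (LINT \<omega>|M. future_functional u t \<omega> powr (\<alpha> - 1))"
    and "set_integrable lborel {0..t}
         (\<lambda>u. moment_from M X (\<alpha> - 1) u t * exp (- laplace_exponent b c K u \<alpha>))"
    and "moment M X \<alpha> t =
         \<alpha> * (LINT u:{0..t}|lborel.
                moment_from M X (\<alpha> - 1) u t * exp (- laplace_exponent b c K u \<alpha>))"
proof -
  have \<alpha>0: "\<alpha> > 0" using \<alpha> by simp
  note intF = integrable_future_functional_powr[OF \<alpha> jumps]
  show I\<alpha>: "integrable M (\<lambda>\<omega>. exp_functional X t \<omega> powr \<alpha>)"
    using intF(1)[of 0] t by (simp add: future_functional_0 cong: Bochner_Integration.integrable_cong)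
  show "integrable M (\<lambda>\<omega>. exp_functional X t \<omega> powr (\<alpha> - 1))"
    using intF(2)[of 0] t by (simp add: future_functional_0 cong: Bochner_Integration.integrable_cong)
  have from_meas: "(\<lambda>\<omega>. exp_functional_from X u t \<omega> powr (\<alpha> - 1)) \<in> borel_measurable M"
    and from_ae: "AE \<omega> in M. exp_functional_from X u t \<omega> powr (\<alpha> - 1) = future_functional u t \<omega> powr (\<alpha> - 1)"
    if "u \<in> {0..t}" for u
    using exp_functional_from_AE_eq[of u t] that by (auto elim: eventually_mono)
  show "integrable M (\<lambda>\<omega>. exp_functional_from X u t \<omega> powr (\<alpha> - 1))" if "u \<in> {0..t}" for u
    using intF(2)[of u] that by (subst integrable_cong_AE[OF from_meas _ from_ae]) auto
  have mom: "moment_from M X (\<alpha> - 1) u t = (LINT \<omega>|M. future_functional u t \<omega> powr (\<alpha> - 1))" if "u \<in> {0..t}" for u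
    unfolding moment_from_def using intF(2)[of u] that
    by (intro integral_cong_AE from_meas from_ae) auto
  then show "moment_from M X (\<alpha> - 1) u t = (LINT \<omega>|M. future_functional u t \<omega> powr (\<alpha> - 1))" if "u \<in> {0..t}" for u
    using that .
  interpret pair_sigma_finite M lborel ..
  define w where "w = (\<lambda>u. moment_from M X (\<alpha> - 1) u t * exp (- laplace_exponent b c K u \<alpha>))"
  define H where "H = (\<lambda>\<omega> u. ennreal (indicator {0..t} u * (\<alpha> * tail_functional t \<omega> u powr (\<alpha> - 1) * exp (- X (max 0 u) \<omega>))))"
  have Hm: "case_prod H \<in> borel_measurable (M \<Otimes>\<^sub>M lborel)"
  proof -
    have [measurable]: "(\<lambda>q. X (max 0 (snd q)) (fst q)) \<in> borel_measurable (M \<Otimes>\<^sub>M (lborel :: real measure))"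
      by (rule X_jointly_measurable') measurable
    have [measurable]: "(\<lambda>q. indicator {0..t} (snd q) * tail_functional t (fst q) (snd q)) \<in> borel_measurable (M \<Otimes>\<^sub>M lborel)"
      using tail_functional_measurable[of t] by (simp add: case_prod_beta)
    \<comment> \<open>Joint measurability of the tail functional is available together with its
      indicator, so the indicator is inserted a second time inside the power.\<close>
    have "case_prod H = (\<lambda>q. ennreal (indicator {0..t} (snd q) *
        (\<alpha> * (indicator {0..t} (snd q) * tail_functional t (fst q) (snd q)) powr (\<alpha> - 1) * exp (- X (max 0 (snd q)) (fst q)))))"
      by (auto simp: H_def fun_eq_iff indicator_def)
    then show ?thesis by simp
  qed
  have H_eq: "(\<integral>\<^sup>+\<omega>. H \<omega> u \<partial>M) = ennreal (indicator {0..t} u * (\<alpha> * w u))" for u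
  proof (cases "u \<in> {0..t}")
    case True
    have X [measurable]: "X u \<in> borel_measurable M" using True by (intro random_variable_X) simp
    have F [measurable]: "future_functional u t \<in> borel_measurable M" using True by (intro future_functional_measurable) auto
    have "(\<integral>\<^sup>+\<omega>. H \<omega> u \<partial>M) = (\<integral>\<^sup>+\<omega>. ennreal \<alpha> * (ennreal (exp (- \<alpha> * X u \<omega>)) * ennreal (future_functional u t \<omega> powr (\<alpha> - 1))) \<partial>M)"
    proof (intro nn_integral_cong)
      fix \<omega>
      have "H \<omega> u = ennreal (\<alpha> * (tail_functional t \<omega> u powr (\<alpha> - 1) * exp (- X u \<omega>)))"
        using True by (simp add: H_def mult.assoc)
      then show "H \<omega> u = ennreal \<alpha> * (ennreal (exp (- \<alpha> * X u \<omega>)) * ennreal (future_functional u t \<omega> powr (\<alpha> - 1)))"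
        unfolding tail_functional_powr_eq[OF \<alpha>(1)] using \<alpha>0 by (simp add: ennreal_mult)
    qed
    also have "\<dots> = ennreal \<alpha> * (\<integral>\<^sup>+\<omega>. ennreal (exp (- \<alpha> * X u \<omega>)) * ennreal (future_functional u t \<omega> powr (\<alpha> - 1)) \<partial>M)"
      by (intro nn_integral_cmult) measurable
    also have "(\<integral>\<^sup>+\<omega>. ennreal (exp (- \<alpha> * X u \<omega>)) * ennreal (future_functional u t \<omega> powr (\<alpha> - 1)) \<partial>M) =
        (\<integral>\<^sup>+\<omega>. ennreal (exp (- \<alpha> * X u \<omega>)) \<partial>M) * (\<integral>\<^sup>+\<omega>. ennreal (future_functional u t \<omega> powr (\<alpha> - 1)) \<partial>M)"
    \<comment> \<open>\<open>indep_from_future_functional\<close> concerns u < t. At u = t the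
      functional is 0 and \<open>0 powr (\<alpha> - 1) = 0\<close> also for \<alpha> = 1, so both
      sides vanish.\<close>
    proof (cases "u = t")
      case True
      then show ?thesis by (simp add: future_functional_degenerate)
    next
      case False
      with True have "0 \<le> u" "u < t" by auto
      then show ?thesis
        by (intro nn_integral_indep_from[OF subalgebra_natural_filtration X_measurable_natural_filtration indep_from_future_functional]) auto
    qed
    also have "(\<integral>\<^sup>+\<omega>. ennreal (exp (- \<alpha> * X u \<omega>)) \<partial>M) = ennreal (exp (- laplace_exponent b c K u \<alpha>))"
      using laplace_X[OF \<alpha>0 \<alpha>(2) jumps, of u] True by (subst nn_integral_eq_integral) auto
    also have "(\<integral>\<^sup>+\<omega>. ennreal (future_functional u t \<omega> powr (\<alpha> - 1)) \<partial>M) = ennreal (moment_from M X (\<alpha> - 1) u t)"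
      unfolding mom[OF True] using intF(2)[of u] True by (subst nn_integral_eq_integral) auto
    finally show ?thesis
      using True \<alpha>0 mom[OF True] by (simp add: w_def ennreal_mult' mult.commute)
  qed (simp add: H_def)
  have w_nn: "0 \<le> indicator {0..t} u * (\<alpha> * w u)" for u
    using \<alpha>0 mom[of u] by (auto simp: w_def indicator_def intro!: mult_nonneg_nonneg integral_nonneg_AE)
  \<comment> \<open>Measurability of \<open>w\<close> is read off from that of the inner Tonelli
    integral, by \<open>H_eq\<close>.\<close>
  have wm: "(\<lambda>u. indicator {0..t} u * (\<alpha> * w u)) \<in> borel_measurable lborel"
  proof -
    have "(\<lambda>(u, \<omega>). H \<omega> u) \<in> borel_measurable (lborel \<Otimes>\<^sub>M M)"
      using measurable_pair_swap[OF Hm] by simp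
    then have "(\<lambda>u. \<integral>\<^sup>+\<omega>. H \<omega> u \<partial>M) \<in> borel_measurable lborel"
      by (rule sigma_finite_measure.borel_measurable_nn_integral[OF prob_space_imp_sigma_finite[OF prob_space_axioms]])
    then have "(\<lambda>u. enn2real (\<integral>\<^sup>+\<omega>. H \<omega> u \<partial>M)) \<in> borel_measurable lborel" by (rule measurable_compose) simp
    then show ?thesis unfolding H_eq using w_nn by simp
  qed
  have "ennreal (moment M X \<alpha> t) = (\<integral>\<^sup>+\<omega>. ennreal (exp_functional X t \<omega> powr \<alpha>) \<partial>M)"
    unfolding moment_def using I\<alpha> by (intro nn_integral_eq_integral[symmetric]) auto
  also have "\<dots> = (\<integral>\<^sup>+\<omega>. \<integral>\<^sup>+u. H \<omega> u \<partial>lborel \<partial>M)"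
    unfolding H_def using t by (intro nn_integral_cong exp_functional_powr_eq \<alpha>) auto
  also have "\<dots> = (\<integral>\<^sup>+u. \<integral>\<^sup>+\<omega>. H \<omega> u \<partial>M \<partial>lborel)"
    by (rule Fubini'[OF Hm, symmetric])
  also have "\<dots> = (\<integral>\<^sup>+u. ennreal (indicator {0..t} u * (\<alpha> * w u)) \<partial>lborel)"
    by (simp only: H_eq)
  finally have eq: "(\<integral>\<^sup>+u. ennreal (indicator {0..t} u * (\<alpha> * w u)) \<partial>lborel) = ennreal (moment M X \<alpha> t)" by simp
  have mnn: "0 \<le> moment M X \<alpha> t" unfolding moment_def by (intro integral_nonneg_AE) auto
  have hb: "has_bochner_integral lborel (\<lambda>u. indicator {0..t} u * (\<alpha> * w u)) (moment M X \<alpha> t)"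
    by (rule has_bochner_integral_nn_integral[OF wm _ mnn eq]) (use w_nn in auto)
  then have "integrable lborel (\<lambda>u. inverse \<alpha> * (indicator {0..t} u * (\<alpha> * w u)))"
    by (intro integrable_mult_right) (auto simp: has_bochner_integral_iff)
  moreover have "inverse \<alpha> * (indicator {0..t} u * (\<alpha> * w u)) = indicator {0..t} u *\<^sub>R w u" for u
    using \<alpha>0 by simp
  ultimately have "integrable lborel (\<lambda>u. indicator {0..t} u *\<^sub>R w u)" by (simp only:)
  then show "set_integrable lborel {0..t} (\<lambda>u. moment_from M X (\<alpha> - 1) u t * exp (- laplace_exponent b c K u \<alpha>))"
    by (simp add: set_integrable_def w_def)
  have "moment M X \<alpha> t = (LINT u|lborel. \<alpha> * (indicator {0..t} u *\<^sub>R w u))"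
    using hb by (simp add: has_bochner_integral_iff mult.left_commute)
  then show "moment M X \<alpha> t = \<alpha> * (LINT u:{0..t}|lborel. moment_from M X (\<alpha> - 1) u t * exp (- laplace_exponent b c K u \<alpha>))"
    by (simp add: set_lebesgue_integral_def w_def)
qed

end

section \<open>The stationary case\<close>

context pii_semimartingale
begin

lemma exp_functional_measurable:
  assumes "0 \<le> t" shows "exp_functional X t \<in> borel_measurable M"
  using future_functional_measurable[of 0 t] assms
  by (subst measurable_cong[of M _ "future_functional 0 t"]) (simp_all add: future_functional_0)

lemma exp_functional_pos:
  assumes "\<omega> \<in> space M" "0 < t" shows "0 < exp_functional X t \<omega>"
proof -
  obtain m where m: "m > 0" "\<And>s. s \<in> {0..t} \<Longrightarrow> m \<le> exp (- X s \<omega>)"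
    using exp_neg_X_lower_bound[OF assms(1), of t] assms by auto
  have "set_integrable lborel {0..t} (\<lambda>_. m)"
    by (simp add: set_integrable_def integrable_indicator_iff emeasure_lborel_Icc_eq)
  then have "(LINT s:{0..t}|lborel. m) \<le> exp_functional X t \<omega>"
    unfolding exp_functional_def
    by (rule set_integral_mono[OF _ set_integrable_cadlag[OF cadlag_exp_neg_X[OF assms(1)] order.refl] m(2)])
  moreover have "(LINT s:{0..t}|lborel. m) = t * m" using assms by (simp add: set_lebesgue_integral_def)
  ultimately show ?thesis using m assms mult_pos_pos[of t m] by linarith
qed

lemma exp_functional_nonneg: "0 \<le> exp_functional X t \<omega>"
  unfolding exp_functional_def set_lebesgue_integral_def
  by (intro integral_nonneg_AE AE_I2) (simp add: indicator_def)

lemma exp_functional_mono: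
  assumes "\<omega> \<in> space M" "0 \<le> s" "s \<le> t"
  shows "exp_functional X s \<omega> \<le> exp_functional X t \<omega>"
proof -
  have "exp_functional X t \<omega> = exp_functional X s \<omega> + (LINT u:{s..t}|lborel. exp (- X u \<omega>))"
    unfolding exp_functional_def
    using assms by (intro set_integral_split set_integrable_cadlag cadlag_exp_neg_X) auto
  moreover have "0 \<le> (LINT u:{s..t}|lborel. exp (- X u \<omega>))"
    unfolding set_lebesgue_integral_def by (intro integral_nonneg_AE AE_I2) (simp add: indicator_def)
  ultimately show ?thesis by simp
qed

lemma exp_functional_continuous:
  assumes "\<omega> \<in> space M"
  shows "continuous_on {0..t} (\<lambda>s. exp_functional X s \<omega>)"
proof -
  have i: "set_integrable lborel {0..s} (\<lambda>u. exp (- X u \<omega>))" for s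
    by (intro set_integrable_cadlag cadlag_exp_neg_X assms) simp
  show ?thesis
    unfolding exp_functional_def set_borel_integral_eq_integral(2)[OF i]
    by (intro indefinite_integral_continuous_1 set_borel_integral_eq_integral(1) i)
qed

text \<open>Domination by the value at the right end \<open>v\<close>, from monotonicity in time.
  The interval starts at u > 0 because the functional vanishes at time 0, where for \<beta> = 0 the
  moment jumps from 0 to 1.\<close>

lemma moment_continuous:
  assumes i: "integrable M (\<lambda>\<omega>. exp_functional X v \<omega> powr \<beta>)" and \<beta>: "\<beta> \<ge> 0" and u: "0 < u"
  shows "continuous_on {u..v} (\<lambda>s. moment M X \<beta> s)"
proof (rule continuous_on_sequentiallyI)
  fix y x assume y: "\<forall>n. y n \<in> {u..v}" and x: "x \<in> {u..v}" and lim: "y \<longlonglongrightarrow> x"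
  show "(\<lambda>n. moment M X \<beta> (y n)) \<longlonglongrightarrow> moment M X \<beta> x"
    unfolding moment_def
  proof (rule integral_dominated_convergence[OF _ _ i])
    have powr: "(\<lambda>\<omega>. exp_functional X s \<omega> powr \<beta>) \<in> borel_measurable M" if "s \<in> {u..v}" for s
      using that u by (intro measurable_compose[OF exp_functional_measurable, where g="\<lambda>z. z powr \<beta>"]) auto
    show "(\<lambda>\<omega>. exp_functional X x \<omega> powr \<beta>) \<in> borel_measurable M"
      "(\<lambda>\<omega>. exp_functional X (y n) \<omega> powr \<beta>) \<in> borel_measurable M" for n
      using x y by (auto intro!: powr)
    show "AE \<omega> in M. (\<lambda>n. exp_functional X (y n) \<omega> powr \<beta>) \<longlonglongrightarrow> exp_functional X x \<omega> powr \<beta>"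
    proof (rule AE_I2)
      fix \<omega> assume \<omega>: "\<omega> \<in> space M"
      have "0 \<le> y n" "y n \<le> v" for n using y u by (auto intro: order.trans[OF less_imp_le])
      then have "\<forall>\<^sub>F n in sequentially. y n \<in> {0..v}" by simp
      then have "(\<lambda>n. exp_functional X (y n) \<omega>) \<longlonglongrightarrow> exp_functional X x \<omega>"
        using x u by (intro continuous_on_tendsto_compose[OF exp_functional_continuous[OF \<omega>, of v] lim]) auto
      moreover have "exp_functional X x \<omega> \<noteq> 0"
        using exp_functional_pos[OF \<omega>, of x] x u by auto
      ultimately show "(\<lambda>n. exp_functional X (y n) \<omega> powr \<beta>) \<longlonglongrightarrow> exp_functional X x \<omega> powr \<beta>"
        by (intro tendsto_powr tendsto_const)
    qed
    show "AE \<omega> in M. norm (exp_functional X (y n) \<omega> powr \<beta>) \<le> exp_functional X v \<omega> powr \<beta>" for n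
    proof (rule AE_I2)
      fix \<omega> assume \<omega>: "\<omega> \<in> space M"
      have yn: "u \<le> y n" "y n \<le> v" using y by auto
      have "exp_functional X (y n) \<omega> \<le> exp_functional X v \<omega>"
        using yn u by (intro exp_functional_mono[OF \<omega>]) auto
      then show "norm (exp_functional X (y n) \<omega> powr \<beta>) \<le> exp_functional X v \<omega> powr \<beta>"
        using powr_mono2[OF \<beta> exp_functional_nonneg] by simp
    qed
  qed
qed

lemma levy_laplace_exponent_eq:
  assumes levy: "levy_with_parameters M X b c K b0 c0 K0" and u: "0 \<le> u"
  shows "laplace_exponent b c K u \<alpha> = u * levy_laplace_exponent b0 c0 K0 \<alpha>"
proof -
  have c: "(LINT s:{0..u}|lborel. f s) = u * k" if "\<And>s. s \<ge> 0 \<Longrightarrow> f s = k" for f :: "real \<Rightarrow> real" and k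
  proof -
    have "(LINT s:{0..u}|lborel. f s) = (LINT s:{0..u}|lborel. k)"
      using that by (intro set_lebesgue_integral_cong) auto
    then show ?thesis using u by (simp add: set_lebesgue_integral_def)
  qed
  have p: "b s = b0" "c s = c0" "K s = K0" if "s \<ge> 0" for s
    using levy that by (auto simp: levy_with_parameters_def)
  have "(LINT s:{0..u}|lborel. b s) = u * b0" "(LINT s:{0..u}|lborel. c s) = u * c0"
    "(LINT s:{0..u}|lborel. (LINT x|K s. exp (- \<alpha> * x) - 1 + \<alpha> * x)) = u * (LINT x|K0. exp (- \<alpha> * x) - 1 + \<alpha> * x)"
    by (rule c; simp add: p)+
  then show ?thesis
    unfolding laplace_exponent_def levy_laplace_exponent_def by (simp only:) (simp add: algebra_simps)
qed

text \<open>With a constant kernel the integral is a constant times the length of the time interval,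
  so one positive horizon decides all of them.\<close>

lemma levy_jumps:
  assumes levy: "levy_with_parameters M X b c K b0 c0 K0" and t: "0 < t"
    and jumps: "(\<integral>\<^sup>+ s\<in>{0..t}. (\<integral>\<^sup>+ x\<in>{x. x < -1}. ennreal (exp (- a * x)) \<partial>K s) \<partial>lborel) < \<infinity>"
  shows "(\<integral>\<^sup>+ s\<in>{0..r}. (\<integral>\<^sup>+ x\<in>{x. x < -1}. ennreal (exp (- a * x)) \<partial>K s) \<partial>lborel) < \<infinity>"
proof -
  define k where "k = (\<integral>\<^sup>+ x\<in>{x. x < -1}. ennreal (exp (- a * x)) \<partial>K0)"
  have eq: "(\<integral>\<^sup>+ s\<in>{0..r}. (\<integral>\<^sup>+ x\<in>{x. x < -1}. ennreal (exp (- a * x)) \<partial>K s) \<partial>lborel) = k * emeasure lborel {0..r}" for r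
  proof -
    have "(\<integral>\<^sup>+ s\<in>{0..r}. (\<integral>\<^sup>+ x\<in>{x. x < -1}. ennreal (exp (- a * x)) \<partial>K s) \<partial>lborel) = (\<integral>\<^sup>+ s. k * indicator {0..r} s \<partial>lborel)"
    proof (rule nn_integral_cong)
      fix s
      show "(\<integral>\<^sup>+ x\<in>{x. x < -1}. ennreal (exp (- a * x)) \<partial>K s) * indicator {0..r} s = k * indicator {0..r} s"
        using levy by (cases "s \<in> {0..r}") (auto simp: k_def levy_with_parameters_def)
    qed
    then show ?thesis by (simp add: nn_integral_cmult_indicator)
  qed
  have "k < \<infinity>" using jumps t unfolding eq by (auto simp: ennreal_mult_less_top)
  then show ?thesis unfolding eq by (simp add: ennreal_mult_less_top emeasure_lborel_Icc_eq)
qed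

text \<open>Stationarity moves the starting point \<open>u\<close> to 0. The degenerate interval u =
  r is separate, the equality of laws being stated for positive lengths; both functionals vanish
  there.\<close>

lemma moment_from_levy:
  assumes levy: "levy_with_parameters M X b c K b0 c0 K0" and u: "u \<in> {0..r}" and r: "0 < r"
    and mom: "moment_from M X \<beta> u r = (LINT \<omega>|M. future_functional u r \<omega> powr \<beta>)"
  shows "moment_from M X \<beta> u r = moment M X \<beta> (r - u)"
proof -
  have m: "moment M X \<beta> (r - u) = (LINT \<omega>|M. future_functional 0 (r - u) \<omega> powr \<beta>)"
    unfolding moment_def by (intro Bochner_Integration.integral_cong) (simp_all add: future_functional_0)
  show ?thesis
  proof (cases "u = r")
    case True
    then show ?thesis unfolding mom m by (simp add: future_functional_degenerate)
  next
    case False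
    then have *: "0 \<le> u" "0 < r - u" "u \<le> r" using u by auto
    have "distr M borel (\<lambda>\<omega>. X (s + h) \<omega> - X s \<omega>) = distr M borel (X h)" if "0 \<le> s" "0 \<le> h" for s h
      using levy that by (auto simp: levy_with_parameters_def)
    then have d: "distr M borel (future_functional u r) = distr M borel (future_functional 0 (r - u))"
      using distr_future_functional[of u "r - u"] * by simp
    have "(LINT \<omega>|M. future_functional u r \<omega> powr \<beta>) = (LINT x|distr M borel (future_functional u r). x powr \<beta>)"
      using * by (intro integral_distr[symmetric] future_functional_measurable) auto
    also have "\<dots> = (LINT \<omega>|M. future_functional 0 (r - u) \<omega> powr \<beta>)"
      unfolding d using * by (intro integral_distr future_functional_measurable) auto
    finally show ?thesis unfolding mom m .
  qed
qed

theorem levy_moment_recursion: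
  assumes \<alpha>: "\<alpha> \<ge> 1" "\<delta> > 0" and t: "t > 0"
    and jumps: "(\<integral>\<^sup>+ s\<in>{0..t}. (\<integral>\<^sup>+ x\<in>{x. x < -1}. ennreal (exp (- (\<alpha> + \<delta>) * x)) \<partial>K s) \<partial>lborel) < \<infinity>"
    and levy: "levy_with_parameters M X b c K b0 c0 K0" and r: "r > 0"
  defines "\<Phi> \<equiv> levy_laplace_exponent b0 c0 K0 \<alpha>"
  shows "set_integrable lborel {0..r} (\<lambda>s. moment M X (\<alpha> - 1) s * exp (\<Phi> * s))"
    and "moment M X \<alpha> r = \<alpha> * exp (- \<Phi> * r) * (LINT s:{0..r}|lborel. moment M X (\<alpha> - 1) s * exp (\<Phi> * s))"
proof -
  note rec = moment_recursion[OF \<alpha> r levy_jumps[OF levy t jumps]]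
  define m where "m = moment M X (\<alpha> - 1)"
  define f where "f = (\<lambda>u. indicator {0..r} u *\<^sub>R (moment_from M X (\<alpha> - 1) u r * exp (- laplace_exponent b c K u \<alpha>)))"
  have f: "integrable lborel f" using rec(5) by (simp add: set_integrable_def f_def)
  \<comment> \<open>Substitution u = r - s, with the coefficient -1 written out to fit the affine
    change of variables; exp (- u \<Phi>) splits into exp (- \<Phi> r) and exp (\<Phi> s).\<close>
  have feq: "f (r + (- 1) * s) = exp (- \<Phi> * r) * (indicator {0..r} s *\<^sub>R (m s * exp (\<Phi> * s)))" for s
  proof (cases "s \<in> {0..r}")
    case True
    then have u: "r - s \<in> {0..r}" by simp
    have "f (r - s) = m s * exp (- ((r - s) * \<Phi>))"
      using moment_from_levy[OF levy u r rec(4)[OF u]] levy_laplace_exponent_eq[OF levy, of "r - s" \<alpha>] u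
      by (simp add: f_def m_def \<Phi>_def)
    also have "exp (- ((r - s) * \<Phi>)) = exp (- \<Phi> * r) * exp (\<Phi> * s)"
      by (simp add: exp_add[symmetric] algebra_simps)
    finally show ?thesis using True by (simp add: mult_ac)
  next
    case False
    then have "r - s \<notin> {0..r}" by auto
    then show ?thesis using False by (simp add: f_def)
  qed
  have i: "integrable lborel (\<lambda>s. exp (- \<Phi> * r) * (indicator {0..r} s *\<^sub>R (m s * exp (\<Phi> * s))))"
    using lborel_integrable_real_affine[OF f, of "- 1" r] unfolding feq by simp
  \<comment> \<open>Multiplying by exp (\<Phi> r) cancels the constant factor of
    \<open>i\<close>.\<close>
  have "integrable lborel (\<lambda>s. exp (\<Phi> * r) * (exp (- \<Phi> * r) * (indicator {0..r} s *\<^sub>R (m s * exp (\<Phi> * s)))))"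
    using i by (rule integrable_mult_right)
  moreover have "exp (\<Phi> * r) * (exp (- \<Phi> * r) * y) = y" for y :: real
    by (simp add: mult.assoc[symmetric] exp_add[symmetric])
  ultimately show "set_integrable lborel {0..r} (\<lambda>s. moment M X (\<alpha> - 1) s * exp (\<Phi> * s))"
    unfolding set_integrable_def m_def by (simp only:)
  have "moment M X \<alpha> r = \<alpha> * (LINT u|lborel. f u)"
    using rec(6) by (simp add: set_lebesgue_integral_def f_def)
  also have "(LINT u|lborel. f u) = (LINT s|lborel. exp (- \<Phi> * r) * (indicator {0..r} s *\<^sub>R (m s * exp (\<Phi> * s))))"
    using lborel_integral_real_affine[of "- 1" f r] unfolding feq by simp
  also have "\<dots> = exp (- \<Phi> * r) * (LINT s:{0..r}|lborel. m s * exp (\<Phi> * s))"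
    unfolding set_lebesgue_integral_def by (rule integral_mult_right_zero)
  finally show "moment M X \<alpha> r = \<alpha> * exp (- \<Phi> * r) * (LINT s:{0..r}|lborel. moment M X (\<alpha> - 1) s * exp (\<Phi> * s))"
    by (simp add: m_def)
qed

theorem levy_moment_derivative:
  assumes \<alpha>: "\<alpha> \<ge> 1" "\<delta> > 0" and t: "t > 0"
    and jumps: "(\<integral>\<^sup>+ s\<in>{0..t}. (\<integral>\<^sup>+ x\<in>{x. x < -1}. ennreal (exp (- (\<alpha> + \<delta>) * x)) \<partial>K s) \<partial>lborel) < \<infinity>"
    and levy: "levy_with_parameters M X b c K b0 c0 K0" and r: "r > 0"
  defines "\<Phi> \<equiv> levy_laplace_exponent b0 c0 K0 \<alpha>"
  shows "((\<lambda>s. moment M X \<alpha> s) has_real_derivative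
    (- moment M X \<alpha> r * \<Phi> + \<alpha> * moment M X (\<alpha> - 1) r)) (at r)"
proof -
  define w where "w = (\<lambda>s. moment M X (\<alpha> - 1) s * exp (\<Phi> * s))"
  note rec = levy_moment_recursion[OF \<alpha> t jumps levy, folded \<Phi>_def, folded w_def]
  \<comment> \<open>[a, v] is a compact neighbourhood of \<open>r\<close> away from 0, on which
    \<open>moment_continuous\<close> applies with the functional at \<open>v\<close> as dominating
    value.\<close>
  define a where "a = r / 2"
  define v where "v = 2 * r"
  have av: "0 < a" "a < r" "r < v" using r by (auto simp: a_def v_def)
  have "integrable M (\<lambda>\<omega>. exp_functional X v \<omega> powr (\<alpha> - 1))"
    using moment_recursion(2)[OF \<alpha> _ levy_jumps[OF levy t jumps]] av by simp
  then have "continuous_on {a..v} w"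
    unfolding w_def using \<alpha> av by (intro continuous_on_mult moment_continuous continuous_intros) auto
  then have "((\<lambda>x. integral {a..x} w) has_real_derivative w r) (at r within {a..v})"
    using av by (intro integral_has_real_derivative) auto
  then have d: "((\<lambda>x. integral {a..x} w) has_real_derivative w r) (at r)"
    using av by (simp add: at_within_Icc_at)
  \<comment> \<open>The part over [0, a] is constant in \<open>x\<close>; splitting it off confines
    the fundamental theorem of calculus to the range where \<open>w\<close> is continuous.\<close>
  define W where "W = (LINT s:{0..a}|lborel. w s)"
  have eq: "\<alpha> * exp (- \<Phi> * x) * (W + integral {a..x} w) = moment M X \<alpha> x" if "x \<in> {a<..<v}" for x
  proof -
    have x: "0 < x" "a \<le> x" using that av by auto
    have "(LINT s:{0..x}|lborel. w s) = W + (LINT s:{a..x}|lborel. w s)"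
      unfolding W_def using rec(1)[OF x(1)] av x by (intro set_integral_split) auto
    also have "(LINT s:{a..x}|lborel. w s) = integral {a..x} w"
      by (intro set_borel_integral_eq_integral set_integrable_subset[OF rec(1)[OF x(1)]]) (use av in auto)
    finally show ?thesis using rec(2)[OF x(1)] by simp
  qed
  \<comment> \<open>Product rule: differentiating the exponential gives - \<Phi> times the moment by
    \<open>eq\<close>, and differentiating the integral gives \<open>w r\<close>, whose exponential
    cancels.\<close>
  have "((\<lambda>x. \<alpha> * exp (- \<Phi> * x) * (W + integral {a..x} w)) has_real_derivative
      (\<alpha> * (- \<Phi> * exp (- \<Phi> * r)) * (W + integral {a..r} w) + \<alpha> * exp (- \<Phi> * r) * w r)) (at r)"
    by (rule derivative_eq_intros d refl | simp)+
  also have "\<alpha> * (- \<Phi> * exp (- \<Phi> * r)) * (W + integral {a..r} w) = - moment M X \<alpha> r * \<Phi>"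
    using eq[of r] av by (simp add: mult_ac)
  also have "\<alpha> * exp (- \<Phi> * r) * w r = \<alpha> * moment M X (\<alpha> - 1) r"
    by (simp add: w_def mult.assoc exp_add[symmetric] mult.left_commute[of "exp _"])
  finally show ?thesis
    by (rule has_field_derivative_transform_within_open[where S="{a<..<v}"]) (use av eq in auto)
qed

end

theorem theorem1:
  fixes M :: "'a measure"
    and X :: "real \<Rightarrow> 'a \<Rightarrow> real"
    and b c :: "real \<Rightarrow> real"
    and K :: "real \<Rightarrow> real measure"
    and \<alpha> t :: real
  assumes "pii_semimartingale M X b c K"
    and "\<alpha> \<ge> 1" and "t > 0"
    and "\<exists>\<delta>>0. (\<integral>\<^sup>+ s\<in>{0..t}. (\<integral>\<^sup>+ x\<in>{x. x < -1}. ennreal (exp (- (\<alpha> + \<delta>) * x)) \<partial>K s) \<partial>lborel) < \<infinity>"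
  shows "integrable M (\<lambda>\<omega>. exp_functional X t \<omega> powr \<alpha>)
    \<and> (\<forall>u\<in>{0..t}. integrable M (\<lambda>\<omega>. exp_functional_from X u t \<omega> powr (\<alpha> - 1)))
    \<and> set_integrable lborel {0..t}
         (\<lambda>u. moment_from M X (\<alpha> - 1) u t * exp (- laplace_exponent b c K u \<alpha>))
    \<and> moment M X \<alpha> t =
         \<alpha> * (LINT u:{0..t}|lborel.
                moment_from M X (\<alpha> - 1) u t * exp (- laplace_exponent b c K u \<alpha>))
    \<and> (\<forall>b0 c0 K0. levy_with_parameters M X b c K b0 c0 K0 \<longrightarrow>
         (let \<Phi> = levy_laplace_exponent b0 c0 K0 in
          \<forall>r>0. integrable M (\<lambda>\<omega>. exp_functional X r \<omega> powr \<alpha>)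
            \<and> integrable M (\<lambda>\<omega>. exp_functional X r \<omega> powr (\<alpha> - 1))
            \<and> set_integrable lborel {0..r} (\<lambda>s. moment M X (\<alpha> - 1) s * exp (\<Phi> \<alpha> * s))
            \<and> moment M X \<alpha> r =
                 \<alpha> * exp (- \<Phi> \<alpha> * r) *
                 (LINT s:{0..r}|lborel. moment M X (\<alpha> - 1) s * exp (\<Phi> \<alpha> * s))
            \<and> ((\<lambda>s. moment M X \<alpha> s) has_real_derivative
                 (- moment M X \<alpha> r * \<Phi> \<alpha> + \<alpha> * moment M X (\<alpha> - 1) r)) (at r)))"
proof -
  interpret pii_semimartingale M X b c K by fact
  obtain \<delta> where \<delta>: "\<delta> > 0"
    and jumps: "(\<integral>\<^sup>+ s\<in>{0..t}. (\<integral>\<^sup>+ x\<in>{x. x < -1}. ennreal (exp (- (\<alpha> + \<delta>) * x)) \<partial>K s) \<partial>lborel) < \<infinity>"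
    using assms(4) by blast
  note rec = moment_recursion[OF assms(2) \<delta> assms(3) jumps]
  show ?thesis
  proof (intro conjI ballI allI impI, goal_cases)
    case 1
    show ?case by (rule rec(1))
  next
    case (2 u)
    then show ?case by (rule rec(3))
  next
    case 3
    show ?case by (rule rec(5))
  next
    case 4
    show ?case by (rule rec(6))
  next
    case (5 b0 c0 K0)
    note levy = 5
    show ?case
      unfolding Let_def
    proof (intro allI impI conjI)
      fix r :: real assume r: "r > 0"
      \<comment> \<open>The jump condition spreads from the horizon \<open>t\<close> to every r > 0,
        so the recursion is available at \<open>r\<close>.\<close>
      note rec' = moment_recursion[OF assms(2) \<delta> r levy_jumps[OF levy assms(3) jumps]]
      note lrec = levy_moment_recursion[OF assms(2) \<delta> assms(3) jumps levy r]
      show "integrable M (\<lambda>\<omega>. exp_functional X r \<omega> powr \<alpha>)" by (rule rec'(1))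
      show "integrable M (\<lambda>\<omega>. exp_functional X r \<omega> powr (\<alpha> - 1))" by (rule rec'(2))
      show "set_integrable lborel {0..r} (\<lambda>s. moment M X (\<alpha> - 1) s * exp (levy_laplace_exponent b0 c0 K0 \<alpha> * s))"
        by (rule lrec(1))
      show "moment M X \<alpha> r = \<alpha> * exp (- levy_laplace_exponent b0 c0 K0 \<alpha> * r) *
          (LINT s:{0..r}|lborel. moment M X (\<alpha> - 1) s * exp (levy_laplace_exponent b0 c0 K0 \<alpha> * s))"
        by (rule lrec(2))
      show "((\<lambda>s. moment M X \<alpha> s) has_real_derivative
          (- moment M X \<alpha> r * levy_laplace_exponent b0 c0 K0 \<alpha> + \<alpha> * moment M X (\<alpha> - 1) r)) (at r)"
        by (rule levy_moment_derivative[OF assms(2) \<delta> assms(3) jumps levy r])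
    qed
  qed
qed

end
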